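(* Let $P_1,\dots,P_k$ be finite simple graphs, with density functionals $\tau_1,\dots,\tau_k$ on graphons. For any achievable $k$-tuple $(t_1,\dots,t_k)$, the double limit $$B_{t_1,\dots,t_k}=\lim_{\delta\to0^+}\lim_{n\to\infty}\frac{\ln\left(Z^{n,\delta}_{t_1,\dots,t_k}\right)}{n^2}$$ exists, in the sense that replacing the inner limit by $\liminf_{n\to\infty}$ or by $\limsup_{n\to\infty}$ gives, as $\delta\to0^+$, convergence to the same value, and it equals $$\max S(g),$$ where the maximum is over all graphons $g$ with $(\tau_1(g),\dots,\tau_k(g))=(t_1,\dots,t_k)$.
   Context: A graphon is a symmetric measurable function $g:[0,1]^2\to[0,1]$. If a simple graph $P$ has $m$ vertices and $\ell$ edges, the $k$-th edge connecting vertices $s_k$ and $f_k$, the density of $P$ in a graphon $g$ is $\tau(g)=\int_{[0,1]^m}\prod_{k=1}^{\ell}g(x_{s_k},x_{f_k})\,d^mx$; $\tau_i$ denotes the density functional of $P_i$. The checkerboard graphon $g^G$ of a graph $G$ on vertices $\{1,\dots,n\}$ is the graphon equal to $1$ on $(\frac{i-1}{n},\frac in)\times(\frac{j-1}{n},\frac jn)$ if $\{i,j\}$ is an edge of $G$ and $0$ otherwise; the density of $P_i$ in $G$ is $\tau_i(g^G)$. A $k$-tuple $(t_1,\dots,t_k)$ is achievable if there is at least one graphon $g$ with $(\tau_1(g),\dots,\tau_k(g))=(t_1,\dots,t_k)$. $Z^{n,\delta}_{t_1,\dots,t_k}$ is the number of (labeled) simple graphs $G$ on $n$ vertices such that, for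 each $i$, the density of $P_i$ in $G$ lies in $(t_i-\delta,t_i+\delta)$. The Shannon entropy of a graphon is $S(g)=\int_0^1\int_0^1 H(g(x,y))\,dx\,dy$ with $H(u)=-\frac12\left(u\ln u+(1-u)\ln(1-u)\right)$ (and $0\ln0=0$). *)

theory Defs
  imports "HOL-Analysis.Analysis"
begin

record 'v sgraph =
  verts :: "'v set"
  edges :: "'v set set"

definition simple_graph :: "'v sgraph \<Rightarrow> bool" where
  "simple_graph G \<longleftrightarrow> finite (verts G) \<and> edges G \<subseteq> {e. e \<subseteq> verts G \<and> card e = 2}"

text \<open>Only the values on the unit square matter; measurable means Lebesgue measurable.\<close>

definition graphon :: "(real \<Rightarrow> real \<Rightarrow> real) \<Rightarrow> bool" where
  "graphon g \<longleftrightarrow>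
     (\<lambda>(x, y). g x y) \<in> borel_measurable (lebesgue_on ({0..1} \<times> {0..1})) \<and>
     (\<forall>x\<in>{0..1}. \<forall>y\<in>{0..1}. g x y \<in> {0..1} \<and> g x y = g y x)"

text \<open>An arbitrary ordering \<open>(s, f)\<close> of the two ends of an edge. Which one is chosen is
  immaterial, since graphons are symmetric.\<close>

definition edge_ends :: "'v set \<Rightarrow> 'v \<times> 'v" where
  "edge_ends e = (SOME (s, f). e = {s, f})"

text \<open>The completion of the product of Borel measures is Lebesgue measure on \<open>[0,1]\<close> to the power
  \<open>verts P\<close>. It is needed because the integrand is only Lebesgue measurable when \<open>g\<close> is.\<close>

definition hom_density :: "'v sgraph \<Rightarrow> (real \<Rightarrow> real \<Rightarrow> real) \<Rightarrow> real" where
  "hom_density P g =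
     (\<integral>x. (\<Prod>e\<in>edges P. g (x (fst (edge_ends e))) (x (snd (edge_ends e))))
        \<partial>completion (\<Pi>\<^sub>M v\<in>verts P. restrict_space lborel {0..1}))"

definition checkerboard :: "nat \<Rightarrow> nat sgraph \<Rightarrow> real \<Rightarrow> real \<Rightarrow> real" where
  "checkerboard n G x y =
     (if \<exists>i\<in>{1..n}. \<exists>j\<in>{1..n}. {i, j} \<in> edges G \<and>
           x \<in> {(real i - 1) / real n <..< real i / real n} \<and>
           y \<in> {(real j - 1) / real n <..< real j / real n}
      then 1 else 0)"

text \<open>Tuples are functions on \<open>nat\<close> of which only the values at \<open>1, \<dots>, k\<close> are used.\<close>

definition graphons_with :: "nat \<Rightarrow> (nat \<Rightarrow> 'v sgraph) \<Rightarrow> (nat \<Rightarrow> real) \<Rightarrow> (real \<Rightarrow> real \<Rightarrow> real) set" where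
  "graphons_with k P t = {g. graphon g \<and> (\<forall>i\<in>{1..k}. hom_density (P i) g = t i)}"

definition achievable :: "nat \<Rightarrow> (nat \<Rightarrow> 'v sgraph) \<Rightarrow> (nat \<Rightarrow> real) \<Rightarrow> bool" where
  "achievable k P t \<longleftrightarrow> graphons_with k P t \<noteq> {}"

definition Z :: "nat \<Rightarrow> (nat \<Rightarrow> 'v sgraph) \<Rightarrow> (nat \<Rightarrow> real) \<Rightarrow> nat \<Rightarrow> real \<Rightarrow> nat" where
  "Z k P t n \<delta> =
     card {G :: nat sgraph. simple_graph G \<and> verts G = {1..n} \<and>
       (\<forall>i\<in>{1..k}. hom_density (P i) (checkerboard n G) \<in> {t i - \<delta> <..< t i + \<delta>})}"

text \<open>Extended real valued, so that \<open>ln 0\<close> is \<open>-\<infinity>\<close> rather than the library's \<open>0\<close>.\<close>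

definition log_Z_rate :: "nat \<Rightarrow> (nat \<Rightarrow> 'v sgraph) \<Rightarrow> (nat \<Rightarrow> real) \<Rightarrow> real \<Rightarrow> nat \<Rightarrow> ereal" where
  "log_Z_rate k P t \<delta> n =
     (if Z k P t n \<delta> = 0 then -\<infinity> else ereal (ln (real (Z k P t n \<delta>)) / (real n)\<^sup>2))"

text \<open>The convention \<open>0 ln 0 = 0\<close> is automatic, as the factor \<open>0\<close> annihilates the total function
  \<open>ln\<close> at \<open>0\<close>.\<close>

definition H :: "real \<Rightarrow> real" where
  "H u = - (1 / 2) * (u * ln u + (1 - u) * ln (1 - u))"

definition shannon_entropy :: "(real \<Rightarrow> real \<Rightarrow> real) \<Rightarrow> real" where
  "shannon_entropy g = (\<integral>(x, y). H (g x y) \<partial>lebesgue_on ({0..1} \<times> {0..1}))"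

end

theory Submission
  imports Defs "HOL-Probability.Probability"
begin

text \<open>The theorem is the large deviation principle for dense random graphs, in counting form. A random
  graph on \<open>n\<close> vertices that looks like the graphon \<open>g\<close> and has
  independent edges has entropy \<open>n\<^sup>2 \<cdot> S(g)\<close> up to lower order terms,
  where the factor \<open>1/2\<close> in \<open>H\<close> compensates for the two orders of the
  ends of an edge; and the number of graphs that look like \<open>g\<close> is the exponential
  of this entropy. Two bounds are proved, and they fit together without a separate existence
  proof for the maximum. Let \<open>B\<close> be the infimum over \<open>\<delta> > 0\<close> of
  the upper rates.

  Lower bound (\<open>shannon_entropy_le_liminf\<close>): every graphon \<open>g\<close> with the
  prescribed densities has \<open>S(g) \<le> liminf\<close>, for every \<open>\<delta>\<close>.
  Draw \<open>x\<^sub>1, \<dots>, x\<^sub>n\<close> independently and uniformly from the unit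
  interval and join \<open>i\<close> and \<open>j\<close> with probability
  \<open>g(x\<^sub>i, x\<^sub>j)\<close>, independently. The mean entropy of this random graph
  is exactly \<open>n (n - 1) S(g)\<close>, and a second moment estimate shows that its
  densities are within \<open>\<delta>\<close> of those of \<open>g\<close> with probability
  \<open>1 - O(1/n)\<close> (\<open>second_moment\<close>). A random object that lies in a
  finite set \<open>A\<close> with probability close to \<open>1\<close> has entropy at most
  \<open>ln |A|\<close> up to a small error (\<open>binary_entropy_sum_le_ln_card\<close>), so
  the number of graphs with the right densities is large.

  Upper bound (\<open>maximizing_graphon\<close>): there is a graphon \<open>g\<close> with the
  prescribed densities and \<open>B \<le> S(g)\<close>. By the Frieze-Kannan weak regularity
  lemma each graph is close in cut norm, at finitely many levels of precision, to a combination
  of boundedly many rectangles \<open>S \<times> T\<close>. The rectangles can be chosen in only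
  \<open>exp (O(n))\<close> ways, so at least a fraction \<open>exp (- O(n))\<close> of the
  graphs that are counted share all of them (\<open>common_rectangle_sums\<close>); the average
  of these graphs is a weighted graph whose entropy, times \<open>n\<^sup>2\<close>, is at least
  the logarithm of their number (\<open>ln_card_le_binary_entropy\<close>) and which is still
  close to each of them in cut norm, so its densities are right by the counting lemma
  (\<open>averaged_kernel\<close>). If the vertices are sorted lexicographically by their
  membership in the sets \<open>S\<close> and \<open>T\<close>, each of these sets becomes a
  union of boundedly many intervals, whose end points form a bounded vector of reals
  (\<open>sort_to_staircases\<close>).

  As \<open>\<delta> \<rightarrow> 0\<close>, this yields a sequence of step kernels
  \<open>W\<^sub>m\<close>. Along a suitable filter the integrals of \<open>W\<^sub>m\<close>
  over all measurable sets and the end points of all intervals converge simultaneously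
  (\<open>common_cluster_filter\<close>, a use of Tychonoff's theorem). The limits of the
  integrals form a measure dominated by Lebesgue measure, whose density is the limit
  \<open>g\<close> (\<open>kernel_of_set_limit\<close>). Convergence of the end points upgrades
  this weak convergence to convergence in cut norm (\<open>cut_convergence\<close>), hence to
  convergence of all densities, while the concavity of \<open>H\<close> makes the entropy upper
  semicontinuous (\<open>entropy_upper_semicontinuous\<close>).

  Since \<open>S(g) \<le> liminf \<le> limsup\<close>, both bounds force \<open>S(g) = B\<close>,
  so \<open>g\<close> is a maximizer, and both iterated limits equal \<open>B\<close>.\<close>

section \<open>Uniform measure on the unit interval\<close>

abbreviation I01 :: "real measure" where "I01 \<equiv> restrict_space lborel {0..1}"

abbreviation I01sq :: "(real \<times> real) measure" where "I01sq \<equiv> I01 \<Otimes>\<^sub>M I01"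

lemma space_I01: "space I01 = {0..1}"
  by (simp add: space_restrict_space)

lemma prob_space_I01: "prob_space I01"
  by (rule prob_spaceI) (simp add: emeasure_restrict_space space_I01)

interpretation I01: prob_space I01 by (rule prob_space_I01)

interpretation I01_pair: pair_prob_space I01 I01 ..

interpretation I01_product: product_prob_space "\<lambda>_. I01" UNIV ..

text \<open>Identifying the product measure on the square with the restriction of planar Lebesgue measure
  links densities, which are defined on powers of the unit interval, with entropy, which is
  defined in the plane.\<close>

lemma sets_I01_pair: "sets I01sq = sets (restrict_space lborel ({0..1::real}\<times>{0..1::real}))"
proof
  show "sets I01sq \<subseteq> sets (restrict_space lborel ({0..1::real}\<times>{0..1::real}))"
  proof
    fix A assume A: "A \<in> sets I01sq"
    have "(\<lambda>z. (fst z, snd z)) \<in> restrict_space lborel ({0..1::real}\<times>{0..1::real}) \<rightarrow>\<^sub>M I01sq"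
      by (intro measurable_Pair measurable_restrict_space2 measurable_restrict_space1)
         (auto simp: space_restrict_space borel_prod[symmetric])
    moreover have "(\<lambda>z. (fst z, snd z)) -` A \<inter> space (restrict_space lborel ({0..1::real}\<times>{0..1::real})) = A"
      using sets.sets_into_space[OF A] by (auto simp: space_restrict_space space_pair_measure)
    ultimately show "A \<in> sets (restrict_space lborel ({0..1::real}\<times>{0..1::real}))"
      using A by (metis (no_types, lifting) measurable_sets)
  qed
  show "sets (restrict_space lborel ({0..1::real}\<times>{0..1::real})) \<subseteq> sets I01sq"
  proof
    fix A assume "A \<in> sets (restrict_space lborel ({0..1::real}\<times>{0..1::real}))"
    then obtain B where B: "B \<in> sets borel" "A = ({0..1}\<times>{0..1}) \<inter> B"
      by (auto simp: sets_restrict_space)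
    have "(\<lambda>z. (fst z, snd z)) \<in> I01sq \<rightarrow>\<^sub>M lborel \<Otimes>\<^sub>M lborel"
      by (intro measurable_Pair measurable_compose[OF measurable_fst] measurable_compose[OF measurable_snd]
          measurable_restrict_space1) auto
    moreover have "B \<in> sets (lborel \<Otimes>\<^sub>M (lborel::real measure))" using B unfolding lborel_prod by simp
    ultimately have "(\<lambda>z. (fst z, snd z)) -` B \<inter> space I01sq \<in> sets I01sq"
      by (rule measurable_sets)
    then show "A \<in> sets I01sq"
      using B by (simp add: space_pair_measure space_I01 Int_commute vimage_def)
  qed
qed

lemma I01_pair_eq: "I01sq = restrict_space lborel ({0..1::real}\<times>{0..1::real})"
proof (rule pair_measure_eqI)
  show "sigma_finite_measure I01" by unfold_locales
  show "sigma_finite_measure I01" by unfold_locales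
  show "sets I01sq = sets (restrict_space lborel ({0..1::real}\<times>{0..1::real}))"
    by (rule sets_I01_pair)
  have S: "{0..1::real}\<times>{0..1::real} \<in> sets borel" by (intro borel_closed closed_Times) auto
  fix A B assume "A \<in> sets I01" "B \<in> sets I01"
  then have AB: "A \<in> sets borel" "B \<in> sets borel" "A \<subseteq> {0..1}" "B \<subseteq> {0..1}"
    by (auto simp: sets_restrict_space)
  have "emeasure (lborel::(real\<times>real) measure) (A \<times> B) = emeasure lborel A * emeasure lborel B"
    by (subst lborel_prod[symmetric], subst lborel.emeasure_pair_measure_Times) (use AB in auto)
  then show "emeasure I01 A * emeasure I01 B = emeasure (restrict_space lborel ({0..1} \<times> {0..1})) (A \<times> B)"
    using AB S by (subst (1 2 3) emeasure_restrict_space) (auto simp: Sigma_mono)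
qed

lemma borel_measurable_lebesgue_square:
  fixes f :: "real \<times> real \<Rightarrow> real"
  assumes f: "f \<in> borel_measurable I01sq"
  shows "f \<in> borel_measurable (lebesgue_on ({0..1} \<times> {0..1}))"
    and "(\<integral>z. f z \<partial>lebesgue_on ({0..1} \<times> {0..1})) = (\<integral>z. f z \<partial>I01sq)"
proof -
  let ?S = "{0..1::real}\<times>{0..1::real}"
  have S: "?S \<in> sets borel" by (intro borel_closed closed_Times) auto
  have m: "(\<lambda>z. indicator ?S z *\<^sub>R f z) \<in> borel_measurable lborel"
    using f unfolding I01_pair_eq by (subst (asm) borel_measurable_restrict_space_iff) (use S in auto)
  then have mc: "(\<lambda>z. indicator ?S z *\<^sub>R f z) \<in> borel_measurable (completion lborel)"
    by (rule measurable_completion)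
  then show "f \<in> borel_measurable (lebesgue_on ?S)"
    by (subst borel_measurable_restrict_space_iff) (use S in auto)
  show "(\<integral>z. f z \<partial>lebesgue_on ?S) = (\<integral>z. f z \<partial>I01sq)"
    unfolding I01_pair_eq using S m
    by (simp add: integral_restrict_space integral_completion)
qed

section \<open>Borel versions of graphons\<close>

text \<open>Graphons are only Lebesgue measurable, while Fubini's theorem is used below for Borel functions.
  A Borel function equal to \<open>g\<close> almost everywhere is made symmetric and
  \<open>[0,1]\<close>-valued everywhere by averaging and clamping, which does not alter it
  where it agrees with \<open>g\<close>.\<close>

lemma graphon_borel_version:
  assumes g: "graphon g"
  obtains W where "(\<lambda>(x,y). W x y) \<in> borel_measurable borel" "\<And>x y. 0 \<le> W x y" "\<And>x y. W x y \<le> 1"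
    "\<And>x y. W x y = W y x" "AE z in I01sq. g (fst z) (snd z) = W (fst z) (snd z)"
proof -
  let ?S = "{0..1::real}\<times>{0..1::real}"
  have S: "?S \<in> sets borel" by (intro borel_closed closed_Times) auto
  have "(\<lambda>(x, y). g x y) \<in> borel_measurable (lebesgue_on ?S)" using g by (auto simp: graphon_def)
  then have "(\<lambda>z. indicator ?S z *\<^sub>R (\<lambda>(x, y). g x y) z) \<in> borel_measurable (completion lborel)"
    by (subst (asm) borel_measurable_restrict_space_iff) (use S in auto)
  from completion_ex_borel_measurable_real[OF this] obtain f where
    f: "f \<in> borel_measurable lborel" and ae: "AE z in lborel. indicator ?S z *\<^sub>R (\<lambda>(x, y). g x y) z = f z"
    by auto
  define W where "W x y = max 0 (min 1 ((f (x,y) + f (y,x))/2))" for x y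
  have fm: "f \<in> borel_measurable borel" using f by simp
  have sw: "(\<lambda>z. f (snd z, fst z)) \<in> borel_measurable (borel :: (real\<times>real) measure)"
    by (rule measurable_compose[OF _ fm]) (simp add: borel_prod[symmetric])
  have meas: "(\<lambda>(x,y). W x y) \<in> borel_measurable borel"
    unfolding W_def case_prod_beta using fm sw by simp
  have ae': "AE z in lborel. indicator ?S (snd z, fst z) *\<^sub>R (\<lambda>(x, y). g x y) (snd z, fst z) = f (snd z, fst z)"
  proof -
    have "AE z in lborel \<Otimes>\<^sub>M lborel. indicator ?S z *\<^sub>R (\<lambda>(x, y). g x y) z = f z"
      by (rule ssubst[OF lborel_prod]) (rule ae)
    then have "AE z in distr (lborel \<Otimes>\<^sub>M lborel) (lborel \<Otimes>\<^sub>M lborel) (\<lambda>(x, y). (y, x)). indicator ?S z *\<^sub>R (\<lambda>(x, y). g x y) z = f z"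
      by (subst lborel_pair.distr_pair_swap[symmetric])
    from AE_distrD[OF measurable_pair_swap' this]
    have "AE z in lborel \<Otimes>\<^sub>M lborel. indicator ?S (snd z, fst z) *\<^sub>R (\<lambda>(x, y). g x y) (snd z, fst z) = f (snd z, fst z)"
      by (simp add: case_prod_beta)
    then show ?thesis unfolding lborel_prod .
  qed
  have "AE z in lborel. z \<in> ?S \<longrightarrow> g (fst z) (snd z) = W (fst z) (snd z)"
    using ae ae'
  proof eventually_elim
    case (elim z)
    show ?case
    proof
      assume z: "z \<in> ?S"
      then have "f z = g (fst z) (snd z)" "f (snd z, fst z) = g (snd z) (fst z)"
        using elim by (auto simp: indicator_def)
      moreover have "g (fst z) (snd z) \<in> {0..1}" "g (snd z) (fst z) = g (fst z) (snd z)"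
        using g z by (auto simp: graphon_def)
      ultimately show "g (fst z) (snd z) = W (fst z) (snd z)"
        unfolding W_def by (cases z) auto
    qed
  qed
  then have "AE z in I01sq. g (fst z) (snd z) = W (fst z) (snd z)"
    unfolding I01_pair_eq using S by (subst AE_restrict_space_iff) auto
  with meas show ?thesis by (intro that[of W]) (auto simp: W_def add.commute)
qed

text \<open>Two distinct coordinates of a uniform point of the cube are uniform on the square; so null sets
  of the square pull back to null sets of the cube, and densities depend on a kernel only up to
  null sets.\<close>

lemma distr_PiM_pair:
  fixes a b :: 'v
  assumes V: "finite V" "a \<in> V" "b \<in> V" "a \<noteq> b"
  shows "distr (\<Pi>\<^sub>M v\<in>V. I01) I01sq (\<lambda>x. (x a, x b)) = I01sq"
proof (rule pair_measure_eqI[symmetric])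
  show "sigma_finite_measure I01" by unfold_locales
  show "sigma_finite_measure I01" by unfold_locales
  have m: "(\<lambda>x. (x a, x b)) \<in> (\<Pi>\<^sub>M v\<in>V. I01) \<rightarrow>\<^sub>M I01sq" using V by simp
  interpret P: product_prob_space "\<lambda>_::'v. I01" V ..
  fix A B assume AB: "A \<in> sets I01" "B \<in> sets I01"
  have "emeasure (distr (\<Pi>\<^sub>M v\<in>V. I01) I01sq (\<lambda>x. (x a, x b))) (A \<times> B)
      = emeasure (\<Pi>\<^sub>M v\<in>V. I01) {x\<in>space (\<Pi>\<^sub>M v\<in>V. I01). \<forall>i\<in>{a,b}. x i \<in> (if i = a then A else B)}"
    using AB V by (subst emeasure_distr[OF m]) (auto intro!: arg_cong[where f="emeasure _"])
  also have "\<dots> = emeasure I01 A * emeasure I01 B"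
    using V AB by (subst P.emeasure_PiM_Collect) auto
  finally show "emeasure I01 A * emeasure I01 B = emeasure (distr (\<Pi>\<^sub>M v\<in>V. I01) I01sq (\<lambda>x. (x a, x b))) (A \<times> B)"
    by simp
qed simp

text \<open>The integrand in \<open>hom_density\<close> need not be Borel, but in the completion a function
  that agrees almost everywhere with a measurable one is measurable and has the same integral.\<close>

lemma borel_measurable_completion_AE_cong:
  fixes f g :: "'a \<Rightarrow> real"
  assumes g: "g \<in> borel_measurable M" and ae: "AE x in M. f x = g x"
  shows "f \<in> borel_measurable (completion M)" "(\<integral>x. f x \<partial>completion M) = (\<integral>x. g x \<partial>M)"
proof -
  from ae obtain N where N: "N \<in> null_sets M" "{x\<in>space M. f x \<noteq> g x} \<subseteq> N"
    by (auto elim!: AE_E intro: null_setsI)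
  have gc: "g \<in> borel_measurable (completion M)" using g by (rule measurable_completion)
  show fm: "f \<in> borel_measurable (completion M)"
  proof (rule measurableI)
    fix A :: "real set" assume A: "A \<in> sets borel"
    have 1: "f -` A \<inter> N \<inter> space M \<in> sets (completion M)"
      by (rule null_setsD2[OF null_sets_completion_subset[OF _ null_sets_completionI[OF N(1)]]]) auto
    have 2: "g -` A \<inter> space M - N \<in> sets (completion M)"
      using measurable_sets[OF gc A] N(1) by (auto intro: sets_completionI_sets)
    have "f -` A \<inter> space (completion M) = (f -` A \<inter> N \<inter> space M) \<union> (g -` A \<inter> space M - N)"
      using N(2) by auto
    then show "f -` A \<inter> space (completion M) \<in> sets (completion M)"
      using 1 2 by (simp add: sets.Un)
  qed auto
  have "(\<integral>x. f x \<partial>completion M) = (\<integral>x. g x \<partial>completion M)"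
    using AE_completion[OF ae] by (intro integral_cong_AE fm gc)
  then show "(\<integral>x. f x \<partial>completion M) = (\<integral>x. g x \<partial>M)" using g by (simp add: integral_completion)
qed

abbreviation src :: "'v set \<Rightarrow> 'v" where "src e \<equiv> fst (edge_ends e)"
abbreviation tgt :: "'v set \<Rightarrow> 'v" where "tgt e \<equiv> snd (edge_ends e)"

lemma edge_ends: assumes "card e = 2" shows "e = {src e, tgt e}" "src e \<noteq> tgt e"
proof -
  obtain x y where xy: "e = {x,y}" "x \<noteq> y" using assms by (auto simp: card_2_iff)
  have *: "(\<lambda>(s,f). e = {s,f}) (edge_ends e)"
    unfolding edge_ends_def by (rule someI[of _ "(x,y)"]) (simp add: xy(1))
  obtain s f where sf: "edge_ends e = (s,f)" by (cases "edge_ends e")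
  with * have e: "e = {s,f}" by simp
  then show "e = {src e, tgt e}" unfolding sf by simp
  have "s \<noteq> f" using assms e by auto
  then show "src e \<noteq> tgt e" by (simp add: sf)
qed

lemma simple_graph_edge:
  assumes "simple_graph P" "e \<in> edges P"
  shows "src e \<in> verts P" "tgt e \<in> verts P" "src e \<noteq> tgt e" "card e = 2"
proof -
  have e: "e \<subseteq> verts P" "card e = 2" using assms by (auto simp: simple_graph_def)
  show "card e = 2" by (rule e(2))
  show "src e \<noteq> tgt e" by (rule edge_ends(2)[OF e(2)])
  have eq: "e = {src e, tgt e}" by (rule edge_ends(1)[OF e(2)])
  have "src e \<in> e" by (subst (2) eq) simp
  then show "src e \<in> verts P" using e(1) by blast
  have "tgt e \<in> e" by (subst (2) eq) simp
  then show "tgt e \<in> verts P" using e(1) by blast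
qed

lemma simple_graph_finite: assumes "simple_graph P" shows "finite (verts P)" "finite (edges P)"
proof -
  show V: "finite (verts P)" using assms by (auto simp: simple_graph_def)
  have "edges P \<subseteq> Pow (verts P)" using assms by (auto simp: simple_graph_def)
  then show "finite (edges P)" using V by (meson finite_Pow_iff finite_subset)
qed

definition hom_prod :: "'v sgraph \<Rightarrow> (real \<Rightarrow> real \<Rightarrow> real) \<Rightarrow> ('v \<Rightarrow> real) \<Rightarrow> real" where
  "hom_prod P W x = (\<Prod>e\<in>edges P. W (x (src e)) (x (tgt e)))"

lemma borel_measurable_hom_prod:
  assumes "simple_graph P" and W: "(\<lambda>(x,y). W x y) \<in> borel_measurable I01sq"
  shows "hom_prod P W \<in> borel_measurable (\<Pi>\<^sub>M v\<in>verts P. I01)"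
  unfolding hom_prod_def
proof (rule borel_measurable_prod)
  fix e assume "e \<in> edges P"
  then have m: "(\<lambda>x. (x (src e), x (tgt e))) \<in> (\<Pi>\<^sub>M v\<in>verts P. I01) \<rightarrow>\<^sub>M I01sq"
    using simple_graph_edge[OF assms(1)] by simp
  from measurable_compose[OF m W]
  show "(\<lambda>x. W (x (src e)) (x (tgt e))) \<in> borel_measurable (\<Pi>\<^sub>M v\<in>verts P. I01)" by simp
qed

lemma hom_density_version:
  assumes P: "simple_graph P" and W: "(\<lambda>(x,y). W x y) \<in> borel_measurable I01sq"
    and ae: "AE z in I01sq. g (fst z) (snd z) = W (fst z) (snd z)"
  shows "hom_density P g = (\<integral>x. hom_prod P W x \<partial>(\<Pi>\<^sub>M v\<in>verts P. I01))"
proof -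
  have "AE x in (\<Pi>\<^sub>M v\<in>verts P. I01). \<forall>e\<in>edges P. g (x (src e)) (x (tgt e)) = W (x (src e)) (x (tgt e))"
  proof (subst AE_finite_all[OF simple_graph_finite(2)[OF P]], rule ballI)
    fix e assume e: "e \<in> edges P"
    have m: "(\<lambda>x. (x (src e), x (tgt e))) \<in> (\<Pi>\<^sub>M v\<in>verts P. I01) \<rightarrow>\<^sub>M I01sq"
      using simple_graph_edge[OF P e] by simp
    have "AE z in distr (\<Pi>\<^sub>M v\<in>verts P. I01) I01sq (\<lambda>x. (x (src e), x (tgt e))). g (fst z) (snd z) = W (fst z) (snd z)"
      using ae simple_graph_edge[OF P e] simple_graph_finite[OF P] by (subst distr_PiM_pair) auto
    from AE_distrD[OF m this] show "AE x in (\<Pi>\<^sub>M v\<in>verts P. I01). g (x (src e)) (x (tgt e)) = W (x (src e)) (x (tgt e))"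
      by simp
  qed
  then have "AE x in (\<Pi>\<^sub>M v\<in>verts P. I01). (\<Prod>e\<in>edges P. g (x (src e)) (x (tgt e))) = hom_prod P W x"
    by eventually_elim (auto simp: hom_prod_def)
  from borel_measurable_completion_AE_cong(2)[OF borel_measurable_hom_prod[OF P W] this]
  show ?thesis by (simp add: hom_density_def)
qed

lemma shannon_entropy_version:
  assumes W: "(\<lambda>(x,y). W x y) \<in> borel_measurable I01sq"
    and g: "(\<lambda>(x,y). g x y) \<in> borel_measurable (lebesgue_on ({0..1} \<times> {0..1}))"
    and ae: "AE z in I01sq. g (fst z) (snd z) = W (fst z) (snd z)"
  shows "shannon_entropy g = (\<integral>z. H (W (fst z) (snd z)) \<partial>I01sq)"
proof -
  let ?S = "{0..1::real}\<times>{0..1::real}"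
  have S: "?S \<in> sets borel" by (intro borel_closed closed_Times) auto
  have H: "H \<in> borel_measurable borel" unfolding H_def[abs_def] by measurable
  have W': "(\<lambda>z. H (W (fst z) (snd z))) \<in> borel_measurable I01sq"
    using measurable_compose[OF W H] by (simp add: case_prod_beta)
  have "AE z in lborel. z \<in> ?S \<longrightarrow> g (fst z) (snd z) = W (fst z) (snd z)"
    using ae unfolding I01_pair_eq using S by (subst (asm) AE_restrict_space_iff) auto
  then have "AE z in lebesgue_on ?S. H (g (fst z) (snd z)) = H (W (fst z) (snd z))"
    using S by (subst AE_restrict_space_iff) (auto intro!: AE_completion)
  then have "(\<integral>z. H (g (fst z) (snd z)) \<partial>lebesgue_on ?S) = (\<integral>z. H (W (fst z) (snd z)) \<partial>lebesgue_on ?S)"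
    using measurable_compose[OF g H] borel_measurable_lebesgue_square(1)[OF W']
    by (intro integral_cong_AE) (auto simp: case_prod_beta)
  then show ?thesis
    using borel_measurable_lebesgue_square(2)[OF W'] by (simp add: shannon_entropy_def case_prod_unfold)
qed

section \<open>The cut norm and the counting lemma\<close>

text \<open>The cut norm of \<open>D\<close> is at most \<open>\<epsilon>\<close>, in the form with test
  functions instead of test sets. This form survives freezing all other coordinates in a
  density, and averaging over the cells of a step kernel.\<close>

definition cut_bounded :: "real \<Rightarrow> (real \<Rightarrow> real \<Rightarrow> real) \<Rightarrow> bool" where
  "cut_bounded \<epsilon> D \<longleftrightarrow> (\<forall>f\<in>borel_measurable I01. \<forall>h\<in>borel_measurable I01.
     (\<forall>x. 0 \<le> f x \<and> f x \<le> 1) \<longrightarrow> (\<forall>x. 0 \<le> h x \<and> h x \<le> 1) \<longrightarrow>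
     \<bar>\<integral>z. f (fst z) * D (fst z) (snd z) * h (snd z) \<partial>I01sq\<bar> \<le> \<epsilon>)"

lemma cut_boundedD:
  assumes "cut_bounded \<epsilon> D" "f \<in> borel_measurable I01" "h \<in> borel_measurable I01"
    "\<And>x. 0 \<le> f x \<and> f x \<le> 1" "\<And>x. 0 \<le> h x \<and> h x \<le> 1"
  shows "\<bar>\<integral>z. f (fst z) * D (fst z) (snd z) * h (snd z) \<partial>I01sq\<bar> \<le> \<epsilon>"
  using assms unfolding cut_bounded_def by blast

lemma (in prob_space) abs_integral_le_bound:
  fixes f :: "'a \<Rightarrow> real"
  assumes "\<And>x. x \<in> space M \<Longrightarrow> \<bar>f x\<bar> \<le> c"
  shows "\<bar>\<integral>x. f x \<partial>M\<bar> \<le> c"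
proof -
  obtain x where "x \<in> space M" using not_empty by auto
  then have c: "0 \<le> c" using assms[of x] by linarith
  show ?thesis
  proof (cases "integrable M f")
    case True
    have "\<bar>\<integral>x. f x \<partial>M\<bar> \<le> (\<integral>x. \<bar>f x\<bar> \<partial>M)" by (rule integral_abs_bound)
    also have "\<dots> \<le> (\<integral>x. c \<partial>M)" using True assms by (intro integral_mono) auto
    finally show ?thesis by (simp add: prob_space)
  next
    case False
    then show ?thesis using c by (simp add: not_integrable_integral_eq)
  qed
qed

lemma prob_space_PiM_I01: "prob_space (\<Pi>\<^sub>M v\<in>V. I01)"
  by (rule prob_space_PiM) (rule prob_space_I01)

text \<open>Fix all coordinates but \<open>a\<close> and \<open>b\<close>. Then \<open>F\<close> depends on
  the coordinate \<open>a\<close> only and \<open>G\<close> on \<open>b\<close> only, so the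
  inner integral is one of those bounded by the cut norm.\<close>

lemma cut_bounded_edge:
  fixes F G :: "('v \<Rightarrow> real) \<Rightarrow> real"
  assumes V: "finite V" "a \<in> V" "b \<in> V" "a \<noteq> b"
    and D: "cut_bounded \<epsilon> D" "(\<lambda>(x,y). D x y) \<in> borel_measurable I01sq" "\<And>x y. \<bar>D x y\<bar> \<le> 1"
    and F: "F \<in> borel_measurable (\<Pi>\<^sub>M v\<in>V. I01)" "\<And>x. 0 \<le> F x \<and> F x \<le> 1" "\<And>x y. F (x(b := y)) = F x"
    and G: "G \<in> borel_measurable (\<Pi>\<^sub>M v\<in>V. I01)" "\<And>x. 0 \<le> G x \<and> G x \<le> 1" "\<And>x y. G (x(a := y)) = G x"
  shows "\<bar>\<integral>x. F x * D (x a) (x b) * G x \<partial>(\<Pi>\<^sub>M v\<in>V. I01)\<bar> \<le> \<epsilon>"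
proof -
  interpret VP: prob_space "\<Pi>\<^sub>M v\<in>V. I01" by (rule prob_space_PiM_I01)
  define V' where "V' = V - {a,b}"
  have VV: "V = V' \<union> {a,b}" "V' \<inter> {a,b} = {}" "finite V'" using V by (auto simp: V'_def)
  interpret V'P: prob_space "\<Pi>\<^sub>M v\<in>V'. I01" by (rule prob_space_PiM_I01)
  have mD: "(\<lambda>x. D (x a) (x b)) \<in> borel_measurable (\<Pi>\<^sub>M v\<in>V. I01)"
  proof -
    have "(\<lambda>x. (x a, x b)) \<in> (\<Pi>\<^sub>M v\<in>V. I01) \<rightarrow>\<^sub>M I01sq" using V by simp
    from measurable_compose[OF this D(2)] show ?thesis by simp
  qed
  have bnd: "\<bar>F x * D (x a) (x b) * G x\<bar> \<le> 1" for x
    using F(2)[of x] G(2)[of x] D(3)[of "x a" "x b"]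
    by (simp add: abs_mult mult_le_one)
  have int: "integrable (\<Pi>\<^sub>M v\<in>V. I01) (\<lambda>x. F x * D (x a) (x b) * G x)"
    using mD F(1) G(1) bnd by (intro VP.integrable_const_bound[where B=1]) auto
  have "(\<integral>x. F x * D (x a) (x b) * G x \<partial>(\<Pi>\<^sub>M v\<in>V. I01))
    = (\<integral>x. (\<integral>y. F (merge V' {a,b} (x,y)) * D (merge V' {a,b} (x,y) a) (merge V' {a,b} (x,y) b) * G (merge V' {a,b} (x,y))
         \<partial>(\<Pi>\<^sub>M v\<in>{a,b}. I01)) \<partial>(\<Pi>\<^sub>M v\<in>V'. I01))"
    using int VV unfolding VV(1) by (intro I01_product.product_integral_fold) auto
  also have "\<bar>\<dots>\<bar> \<le> \<epsilon>"
  proof (rule V'P.abs_integral_le_bound)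
    fix x assume x: "x \<in> space (\<Pi>\<^sub>M v\<in>V'. I01)"
    \<comment> \<open>\<open>u s\<close> puts the value \<open>s\<close> at both free coordinates; by the invariance
      of \<open>F\<close> and \<open>G\<close>, \<open>F (u s)\<close> and
      \<open>G (u s)\<close> are the values of \<open>F\<close> and \<open>G\<close> whenever
      the relevant coordinate is \<open>s\<close>.\<close>
    define u where "u s = merge V' {a,b} (x, \<lambda>i\<in>{a,b}. s)" for s :: real
    have u: "u \<in> I01 \<rightarrow>\<^sub>M (\<Pi>\<^sub>M v\<in>V. I01)"
    proof -
      have "(\<lambda>s. (x, \<lambda>i\<in>{a,b}. s)) \<in> I01 \<rightarrow>\<^sub>M (\<Pi>\<^sub>M v\<in>V'. I01) \<Otimes>\<^sub>M (\<Pi>\<^sub>M v\<in>{a,b}. I01)"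
        using x by (intro measurable_Pair measurable_restrict) auto
      from measurable_compose[OF this measurable_merge] show ?thesis unfolding u_def VV(1) .
    qed
    have ua: "merge V' {a,b} (x,y) = (u (y a))(b := y b)" "merge V' {a,b} (x,y) = (u (y b))(a := y a)" for y
      using V VV(2) by (auto simp: u_def merge_def fun_eq_iff)
    have mab: "(\<lambda>x. (x a, x b)) \<in> (\<Pi>\<^sub>M v\<in>{a,b}. I01) \<rightarrow>\<^sub>M I01sq" by simp
    have fm: "(\<lambda>s. F (u s)) \<in> borel_measurable I01" "(\<lambda>s. G (u s)) \<in> borel_measurable I01"
      using measurable_compose[OF u] F(1) G(1) by auto
    have mm: "(\<lambda>z. F (u (fst z)) * D (fst z) (snd z) * G (u (snd z))) \<in> borel_measurable I01sq"
      using measurable_compose[OF measurable_fst fm(1)] measurable_compose[OF measurable_snd fm(2)] D(2)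
      by (intro borel_measurable_times) (auto simp: case_prod_beta)
    have "(\<integral>y. F (merge V' {a,b} (x,y)) * D (merge V' {a,b} (x,y) a) (merge V' {a,b} (x,y) b) * G (merge V' {a,b} (x,y))
         \<partial>(\<Pi>\<^sub>M v\<in>{a,b}. I01)) = (\<integral>y. F (u (y a)) * D (y a) (y b) * G (u (y b)) \<partial>(\<Pi>\<^sub>M v\<in>{a,b}. I01))"
    proof (rule Bochner_Integration.integral_cong[OF refl])
      fix y
      have "F (merge V' {a,b} (x,y)) = F (u (y a))" unfolding ua(1) by (rule F(3))
      moreover have "G (merge V' {a,b} (x,y)) = G (u (y b))" unfolding ua(2) by (rule G(3))
      moreover have "merge V' {a,b} (x,y) a = y a" "merge V' {a,b} (x,y) b = y b"
        using VV(2) by (auto simp: merge_def)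
      ultimately show "F (merge V' {a,b} (x,y)) * D (merge V' {a,b} (x,y) a) (merge V' {a,b} (x,y) b) * G (merge V' {a,b} (x,y))
        = F (u (y a)) * D (y a) (y b) * G (u (y b))" by simp
    qed
    also have "\<dots> = (\<integral>z. F (u (fst z)) * D (fst z) (snd z) * G (u (snd z)) \<partial>distr (\<Pi>\<^sub>M v\<in>{a,b}. I01) I01sq (\<lambda>x. (x a, x b)))"
      using mm by (subst integral_distr[OF mab]) auto
    also have "\<dots> = (\<integral>z. F (u (fst z)) * D (fst z) (snd z) * G (u (snd z)) \<partial>I01sq)"
      using V by (subst distr_PiM_pair) auto
    also have "\<bar>\<dots>\<bar> \<le> \<epsilon>"
      using F(2) G(2) by (intro cut_boundedD[OF D(1)] fm) auto
    finally show "\<bar>\<integral>y. F (merge V' {a,b} (x,y)) * D (merge V' {a,b} (x,y) a) (merge V' {a,b} (x,y) b) * G (merge V' {a,b} (x,y))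
         \<partial>(\<Pi>\<^sub>M v\<in>{a,b}. I01)\<bar> \<le> \<epsilon>" .
  qed
  finally show ?thesis .
qed

text \<open>Replace \<open>W\<close> by \<open>U\<close> one edge at a time. Any other edge misses one of
  the two ends of the edge \<open>d\<close> being replaced, as the graph is simple, so the
  remaining product splits into a factor that ignores \<open>tgt d\<close> and one that ignores
  \<open>src d\<close>, and \<open>cut_bounded_edge\<close> bounds the change by
  \<open>\<epsilon>\<close>.\<close>

lemma counting_lemma:
  assumes P: "simple_graph P"
    and U: "(\<lambda>(x,y). U x y) \<in> borel_measurable I01sq" "\<And>x y. 0 \<le> U x y \<and> U x y \<le> 1"
    and W: "(\<lambda>(x,y). W x y) \<in> borel_measurable I01sq" "\<And>x y. 0 \<le> W x y \<and> W x y \<le> 1"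
    and cut: "cut_bounded \<epsilon> (\<lambda>x y. U x y - W x y)"
  shows "\<bar>hom_density P U - hom_density P W\<bar> \<le> real (card (edges P)) * \<epsilon>"
proof -
  interpret VP: prob_space "\<Pi>\<^sub>M v\<in>verts P. I01" by (rule prob_space_PiM_I01)
  let ?E = "edges P" and ?M = "\<Pi>\<^sub>M v\<in>verts P. I01"
  define w where "w D e x = (if e \<in> D then U (x (src e)) (x (tgt e)) else W (x (src e)) (x (tgt e)))" for D e and x :: "'a \<Rightarrow> real"
  have wm: "w D e \<in> borel_measurable ?M" if "e \<in> ?E" for D e
  proof -
    have m: "(\<lambda>x. (x (src e), x (tgt e))) \<in> ?M \<rightarrow>\<^sub>M I01sq"
      using simple_graph_edge[OF P that] by simp
    show ?thesis
      using measurable_compose[OF m U(1)] measurable_compose[OF m W(1)] by (cases "e \<in> D") (auto simp: w_def[abs_def])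
  qed
  have w01: "0 \<le> w D e x \<and> w D e x \<le> 1" for D e x using U(2) W(2) by (auto simp: w_def)
  have p01: "0 \<le> (\<Prod>e\<in>S. w D e x) \<and> (\<Prod>e\<in>S. w D e x) \<le> 1" for S D x
    using w01 by (auto intro!: prod_nonneg prod_le_1)
  have pint: "integrable ?M (\<lambda>x. \<Prod>e\<in>?E. w D e x)" for D
    using p01 wm by (intro VP.integrable_const_bound[where B=1] borel_measurable_prod) (auto simp: abs_le_iff intro: order_trans[OF _ p01[THEN conjunct1]])
  have main: "D \<subseteq> ?E \<Longrightarrow> \<bar>(\<integral>x. (\<Prod>e\<in>?E. w D e x) \<partial>?M) - (\<integral>x. (\<Prod>e\<in>?E. w {} e x) \<partial>?M)\<bar> \<le> real (card D) * \<epsilon>"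
    if "finite D" for D
    using that
  proof (induction D rule: finite_induct)
    case empty
    then show ?case by simp
  next
    case (insert d D)
    have d: "d \<in> ?E" using insert by auto
    define F where "F x = (\<Prod>e\<in>{e\<in>?E - {d}. tgt d \<notin> e}. w D e x)" for x
    define G where "G x = (\<Prod>e\<in>{e\<in>?E - {d}. tgt d \<in> e}. w D e x)" for x
    have ee: "e = {src e, tgt e}" if "e \<in> ?E" for e using edge_ends simple_graph_edge(4)[OF P that] by blast
    have upd: "w D e (x(c := y)) = w D e x" if "e \<in> ?E" "c \<notin> e" for e x y c
    proof -
      have "src e \<noteq> c" "tgt e \<noteq> c" using ee[OF that(1)] that(2) by auto
      then show ?thesis by (simp add: w_def)
    qed
    have fin: "finite ?E" by (rule simple_graph_finite(2)[OF P])
    have split: "(\<Prod>e\<in>?E. w D' e x) = w D' d x * (\<Prod>e\<in>?E - {d}. w D' e x)" for D' x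
      using prod.remove[OF fin d] .
    have FG: "(\<Prod>e\<in>?E - {d}. w D e x) = F x * G x" for x
      unfolding F_def G_def using fin by (subst prod.union_disjoint[symmetric]) (auto intro!: prod.cong)
    have "(\<Prod>e\<in>?E. w (insert d D) e x) - (\<Prod>e\<in>?E. w D e x)
        = F x * (U (x (src d)) (x (tgt d)) - W (x (src d)) (x (tgt d))) * G x" for x
    proof -
      have "(\<Prod>e\<in>?E - {d}. w (insert d D) e x) = (\<Prod>e\<in>?E - {d}. w D e x)"
        by (intro prod.cong) (auto simp: w_def)
      then show ?thesis unfolding split[of _ x] FG using insert.hyps by (simp add: w_def FG algebra_simps)
    qed
    then have "(\<integral>x. (\<Prod>e\<in>?E. w (insert d D) e x) \<partial>?M) - (\<integral>x. (\<Prod>e\<in>?E. w D e x) \<partial>?M)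
        = (\<integral>x. F x * (U (x (src d)) (x (tgt d)) - W (x (src d)) (x (tgt d))) * G x \<partial>?M)"
      by (subst Bochner_Integration.integral_diff[symmetric, OF pint pint]) simp
    also have "\<bar>\<dots>\<bar> \<le> \<epsilon>"
    proof (rule cut_bounded_edge[where D="\<lambda>x y. U x y - W x y", OF _ _ _ _ cut])
      show "finite (verts P)" "src d \<in> verts P" "tgt d \<in> verts P" "src d \<noteq> tgt d"
        using simple_graph_finite[OF P] simple_graph_edge[OF P d] by auto
      show "(\<lambda>(x, y). U x y - W x y) \<in> borel_measurable I01sq"
        using U(1) W(1) by (simp add: case_prod_beta)
      show "\<bar>U x y - W x y\<bar> \<le> 1" for x y using U(2)[of x y] W(2)[of x y] by (simp add: abs_le_iff)
      show "F \<in> borel_measurable ?M" "G \<in> borel_measurable ?M"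
        unfolding F_def[abs_def] G_def[abs_def] using wm by (auto intro!: borel_measurable_prod)
      show "0 \<le> F x \<and> F x \<le> 1" "0 \<le> G x \<and> G x \<le> 1" for x unfolding F_def G_def by (rule p01)+
      show "F (x(tgt d := y)) = F x" for x y
        unfolding F_def by (intro prod.cong refl upd) auto
      show "G (x(src d := y)) = G x" for x y
        unfolding G_def
      proof (intro prod.cong refl upd)
        fix e assume e: "e \<in> {e \<in> ?E - {d}. tgt d \<in> e}"
        then show "e \<in> ?E" by auto
        show "src d \<notin> e"
        proof
          assume "src d \<in> e"
          with e have "{src d, tgt d} \<subseteq> e" by auto
          then have "d \<subseteq> e" using ee[OF d] by simp
          moreover have "finite e" using simple_graph_edge(4)[OF P, of e] e by (auto intro: card_ge_0_finite)
          moreover have "card e = card d" using simple_graph_edge(4)[OF P] e d by auto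
          ultimately have "d = e" by (metis card_subset_eq)
          then show False using e by auto
        qed
      qed
    qed
    finally have "\<bar>(\<integral>x. (\<Prod>e\<in>?E. w (insert d D) e x) \<partial>?M) - (\<integral>x. (\<Prod>e\<in>?E. w D e x) \<partial>?M)\<bar> \<le> \<epsilon>" .
    moreover have "\<bar>(\<integral>x. (\<Prod>e\<in>?E. w D e x) \<partial>?M) - (\<integral>x. (\<Prod>e\<in>?E. w {} e x) \<partial>?M)\<bar> \<le> real (card D) * \<epsilon>"
      using insert by auto
    ultimately show ?case using insert.hyps by (simp add: algebra_simps)
  qed
  have "hom_density P U = (\<integral>x. (\<Prod>e\<in>?E. w ?E e x) \<partial>?M)"
    using hom_density_version[OF P U(1), of U] by (simp add: hom_prod_def w_def cong: prod.cong)
  moreover have "hom_density P W = (\<integral>x. (\<Prod>e\<in>?E. w {} e x) \<partial>?M)"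
    using hom_density_version[OF P W(1), of W] by (simp add: hom_prod_def w_def)
  ultimately show ?thesis using main[of ?E] simple_graph_finite(2)[OF P] by simp
qed

section \<open>Graphs and matrices as step kernels\<close>

text \<open>Cells are the intervals \<open>((i - 1)/n, i/n]\<close>; the point \<open>0\<close> of the unit
  interval is put into a cell of its own, numbered \<open>0\<close>, which is null.\<close>

definition cell :: "nat \<Rightarrow> real \<Rightarrow> nat" where "cell n x = nat \<lceil>real n * x\<rceil>"

definition step_kernel :: "nat \<Rightarrow> (nat \<Rightarrow> nat \<Rightarrow> real) \<Rightarrow> real \<Rightarrow> real \<Rightarrow> real" where
  "step_kernel n M x y = M (cell n x) (cell n y)"

definition matrix_density :: "'v sgraph \<Rightarrow> nat \<Rightarrow> (nat \<Rightarrow> nat \<Rightarrow> real) \<Rightarrow> real" where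
  "matrix_density P n M =
     (\<Sum>\<phi>\<in>verts P \<rightarrow>\<^sub>E {1..n}. \<Prod>e\<in>edges P. M (\<phi> (src e)) (\<phi> (tgt e))) / real n ^ card (verts P)"

definition adjacency :: "nat set set \<Rightarrow> nat \<Rightarrow> nat \<Rightarrow> real" where
  "adjacency X i j = (if {i, j} \<in> X then 1 else 0)"

lemma measurable_cell: "cell n \<in> borel \<rightarrow>\<^sub>M count_space UNIV"
  unfolding cell_def by measurable

lemma measurable_cell_I01 [measurable]: "cell n \<in> I01 \<rightarrow>\<^sub>M count_space UNIV"
  by (rule measurable_restrict_space1) (use measurable_cell in simp)

lemma cell_eq_iff:
  assumes "n > 0" "i \<ge> 1"
  shows "cell n x = i \<longleftrightarrow> (real i - 1) / real n < x \<and> x \<le> real i / real n"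
proof -
  have "cell n x = i \<longleftrightarrow> \<lceil>real n * x\<rceil> = int i" using assms by (auto simp: cell_def)
  also have "\<dots> \<longleftrightarrow> real i - 1 < real n * x \<and> real n * x \<le> real i" by (simp add: ceiling_eq_iff)
  also have "\<dots> \<longleftrightarrow> (real i - 1) / real n < x \<and> x \<le> real i / real n"
    using assms by (simp add: field_simps)
  finally show ?thesis .
qed

lemma cell_in_range: assumes "n > 0" "0 < x" "x \<le> 1" shows "cell n x \<in> {1..n}"
proof -
  have "0 < real n * x" "real n * x \<le> real n" using assms by (auto intro: mult_left_le)
  then have "0 < \<lceil>real n * x\<rceil>" "\<lceil>real n * x\<rceil> \<le> int n" by (auto simp: ceiling_le_iff)
  then show ?thesis unfolding cell_def atLeastAtMost_iff by linarith
qed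

lemma AE_I01_cell: assumes "n > 0" shows "AE x in I01. cell n x \<in> {1..n}"
proof -
  have "AE x in lborel. x \<noteq> (0::real)" by (rule AE_lborel_singleton)
  then have "AE x in lborel. x \<in> {0..1} \<longrightarrow> cell n x \<in> {1..n}"
    by eventually_elim (use cell_in_range[OF assms] in auto)
  then show ?thesis by (subst AE_restrict_space_iff) auto
qed

lemma integral_cell_indicator:
  assumes "n > 0" "i \<in> {1..n}"
  shows "(\<integral>x. (if cell n x = i then 1 else 0) \<partial>I01) = 1 / real n"
proof -
  have eq: "{x \<in> {0..1}. cell n x = i} = {(real i - 1) / real n <.. real i / real n}"
  proof -
    have "0 \<le> (real i - 1) / real n" "real i / real n \<le> 1" "i \<ge> 1" using assms by auto
    then show ?thesis
      unfolding set_eq_iff mem_Collect_eq cell_eq_iff[OF assms(1) \<open>i \<ge> 1\<close>] atLeastAtMost_iff greaterThanAtMost_iff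
      by (intro allI iffI conjI) linarith+
  qed
  have "(\<integral>x. (if cell n x = i then 1 else 0 :: real) \<partial>I01) = (\<integral>x. indicator {0..1} x *\<^sub>R (if cell n x = i then 1 else 0 :: real) \<partial>lborel)"
    by (subst integral_restrict_space) auto
  also have "\<dots> = (\<integral>x. indicator {x \<in> {0..1}. cell n x = i} x \<partial>lborel)"
    by (intro Bochner_Integration.integral_cong) (auto simp: indicator_def)
  also have "\<dots> = measure lborel {(real i - 1) / real n <.. real i / real n}"
    unfolding eq by simp
  also have "\<dots> = 1 / real n"
    using assms by (simp add: measure_lborel_Ioc divide_right_mono diff_divide_distrib)
  finally show ?thesis .
qed

text \<open>The cells of independent uniform points are independent and uniform on \<open>{1..n}\<close>, so
  a function of the cells has the mean of its values over all maps from \<open>V\<close> to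
  \<open>{1..n}\<close>.\<close>

lemma integral_PiM_cells:
  fixes F :: "('v \<Rightarrow> nat) \<Rightarrow> real"
  assumes n: "n > 0" and V: "finite V"
  shows "(\<integral>x. F (\<lambda>v\<in>V. cell n (x v)) \<partial>(\<Pi>\<^sub>M v\<in>V. I01)) = (\<Sum>\<phi>\<in>V \<rightarrow>\<^sub>E {1..n}. F \<phi>) / real n ^ card V"
proof -
  let ?M = "\<Pi>\<^sub>M v\<in>V. I01"
  let ?i = "\<lambda>\<phi> v y. if cell n y = \<phi> v then 1 else 0 :: real"
  have ae: "AE x in ?M. \<forall>v\<in>V. cell n (x v) \<in> {1..n}"
  proof (subst AE_finite_all[OF V], rule ballI)
    fix v assume v: "v \<in> V"
    have "distr ?M I01 (\<lambda>x. x v) = I01"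
      by (rule distr_PiM_component) (use v V prob_space_I01 in auto)
    then have "AE y in distr ?M I01 (\<lambda>x. x v). cell n y \<in> {1..n}" using AE_I01_cell[OF n] by metis
    from AE_distrD[OF _ this] v show "AE x in ?M. cell n (x v) \<in> {1..n}" by auto
  qed
  have fin: "finite (V \<rightarrow>\<^sub>E {1..n})" using V by (intro finite_PiE) auto
  have im: "integrable ?M (\<lambda>x. \<Prod>v\<in>V. ?i \<phi> v (x v))" for \<phi>
  proof -
    interpret VP: prob_space ?M by (rule prob_space_PiM) (rule prob_space_I01)
    show ?thesis
      by (rule VP.integrable_const_bound[where B=1]) (auto intro!: AE_I2 prod_le_1 simp: abs_prod)
  qed
  have "(\<integral>x. F (\<lambda>v\<in>V. cell n (x v)) \<partial>?M) = (\<integral>x. (\<Sum>\<phi>\<in>V \<rightarrow>\<^sub>E {1..n}. F \<phi> * (\<Prod>v\<in>V. ?i \<phi> v (x v))) \<partial>?M)"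
  proof (rule integral_cong_AE)
    have "(\<lambda>x. \<lambda>v\<in>V. cell n (x v)) \<in> ?M \<rightarrow>\<^sub>M (\<Pi>\<^sub>M v\<in>V. count_space UNIV)" by measurable
    then have "(\<lambda>x. \<lambda>v\<in>V. cell n (x v)) \<in> ?M \<rightarrow>\<^sub>M count_space (V \<rightarrow>\<^sub>E UNIV)"
      by (simp add: count_space_PiM_finite V)
    then show "(\<lambda>x. F (\<lambda>v\<in>V. cell n (x v))) \<in> borel_measurable ?M"
      by (rule measurable_compose) simp
    show "(\<lambda>x. \<Sum>\<phi>\<in>V \<rightarrow>\<^sub>E {1..n}. F \<phi> * (\<Prod>v\<in>V. ?i \<phi> v (x v))) \<in> borel_measurable ?M"
      using im by (intro borel_measurable_sum borel_measurable_times borel_measurable_const) auto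
    show "AE x in ?M. F (\<lambda>v\<in>V. cell n (x v)) = (\<Sum>\<phi>\<in>V \<rightarrow>\<^sub>E {1..n}. F \<phi> * (\<Prod>v\<in>V. ?i \<phi> v (x v)))"
      using ae
    proof eventually_elim
      case (elim x)
      let ?\<phi> = "\<lambda>v\<in>V. cell n (x v)"
      have "(\<Prod>v\<in>V. ?i \<phi> v (x v)) = (if \<phi> = ?\<phi> then 1 else 0)" if "\<phi> \<in> V \<rightarrow>\<^sub>E {1..n}" for \<phi>
      proof (cases "\<phi> = ?\<phi>")
        case False
        have "\<exists>v\<in>V. \<phi> v \<noteq> cell n (x v)"
        proof (rule ccontr)
          assume "\<not> (\<exists>v\<in>V. \<phi> v \<noteq> cell n (x v))"
          then have "\<phi> = ?\<phi>" using that by (intro extensionalityI[of _ V]) (auto simp: PiE_def)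
          with False show False ..
        qed
        then obtain v where "v \<in> V" "\<phi> v \<noteq> cell n (x v)" by blast
        then have "(\<Prod>v\<in>V. ?i \<phi> v (x v)) = 0" using V by (intro prod_zero bexI[of _ v]) auto
        then show ?thesis using False by simp
      qed simp
      then have "(\<Sum>\<phi>\<in>V \<rightarrow>\<^sub>E {1..n}. F \<phi> * (\<Prod>v\<in>V. ?i \<phi> v (x v))) = (\<Sum>\<phi>\<in>V \<rightarrow>\<^sub>E {1..n}. if \<phi> = ?\<phi> then F \<phi> else 0)"
        by (intro sum.cong) auto
      also have "\<dots> = F ?\<phi>" using fin elim by (subst sum.delta) auto
      finally show ?case by simp
    qed
  qed
  also have "\<dots> = (\<Sum>\<phi>\<in>V \<rightarrow>\<^sub>E {1..n}. F \<phi> * (\<integral>x. (\<Prod>v\<in>V. ?i \<phi> v (x v)) \<partial>?M))"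
    using im by (subst Bochner_Integration.integral_sum) auto
  also have "\<dots> = (\<Sum>\<phi>\<in>V \<rightarrow>\<^sub>E {1..n}. F \<phi> * (1 / real n) ^ card V)"
  proof (intro sum.cong refl arg_cong2[where f="(*)"])
    fix \<phi> assume \<phi>: "\<phi> \<in> V \<rightarrow>\<^sub>E {1..n}"
    have "(\<integral>x. (\<Prod>v\<in>V. ?i \<phi> v (x v)) \<partial>?M) = (\<Prod>v\<in>V. \<integral>y. ?i \<phi> v y \<partial>I01)"
      using V by (intro I01_product.product_integral_prod I01.integrable_const_bound[where B=1]) auto
    also have "\<dots> = (\<Prod>v\<in>V. 1 / real n)"
      using \<phi> by (intro prod.cong refl integral_cell_indicator[OF n]) auto
    finally show "(\<integral>x. (\<Prod>v\<in>V. ?i \<phi> v (x v)) \<partial>?M) = (1 / real n) ^ card V" by simp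
  qed
  finally show ?thesis by (simp add: sum_divide_distrib power_one_over)
qed

lemma step_kernel_measurable: "(\<lambda>(x,y). step_kernel n M x y) \<in> borel_measurable I01sq"
proof -
  have "(\<lambda>z. (cell n (fst z), cell n (snd z))) \<in> I01sq \<rightarrow>\<^sub>M count_space UNIV \<Otimes>\<^sub>M count_space UNIV"
    by (intro measurable_Pair measurable_compose[OF measurable_fst] measurable_compose[OF measurable_snd] measurable_cell_I01)
  also have "count_space UNIV \<Otimes>\<^sub>M count_space UNIV = count_space (UNIV :: (nat\<times>nat) set)"
    by (simp add: pair_measure_countable)
  finally have "(\<lambda>z. (cell n (fst z), cell n (snd z))) \<in> I01sq \<rightarrow>\<^sub>M count_space UNIV" .
  from measurable_compose[OF this, of "\<lambda>p. M (fst p) (snd p)" borel]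
  show ?thesis by (simp add: step_kernel_def case_prod_beta)
qed

lemma hom_density_step:
  assumes P: "simple_graph P" and n: "n > 0"
    and ae: "AE z in I01sq. g (fst z) (snd z) = step_kernel n M (fst z) (snd z)"
  shows "hom_density P g = matrix_density P n M"
proof -
  have "hom_density P g = (\<integral>x. hom_prod P (step_kernel n M) x \<partial>(\<Pi>\<^sub>M v\<in>verts P. I01))"
    by (rule hom_density_version[OF P step_kernel_measurable ae])
  also have "\<dots> = (\<integral>x. (\<lambda>\<phi>. \<Prod>e\<in>edges P. M (\<phi> (src e)) (\<phi> (tgt e))) (\<lambda>v\<in>verts P. cell n (x v)) \<partial>(\<Pi>\<^sub>M v\<in>verts P. I01))"
    unfolding hom_prod_def step_kernel_def using simple_graph_edge[OF P]
    by (intro Bochner_Integration.integral_cong refl) (auto intro!: prod.cong)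
  also have "\<dots> = matrix_density P n M"
    unfolding matrix_density_def by (rule integral_PiM_cells[OF n simple_graph_finite(1)[OF P]])
  finally show ?thesis .
qed

lemma AE_I01_pair:
  assumes "AE x in I01. Q x"
  shows "AE z in I01sq. Q (fst z) \<and> Q (snd z)"
proof -
  have "distr I01sq I01 fst = I01"
    by (rule I01.distr_pair_fst)
  then have "AE x in distr I01sq I01 fst. Q x" using assms by metis
  from AE_distrD[OF measurable_fst this] have 1: "AE z in I01sq. Q (fst z)" .
  then have "AE z in distr I01sq I01sq (\<lambda>(x, y). (y, x)). Q (fst z)"
    by (subst I01_pair.distr_pair_swap[symmetric])
  from AE_distrD[OF measurable_pair_swap' this]
  have "AE z in I01sq. Q (snd z)" by (simp add: case_prod_beta)
  with 1 show ?thesis by eventually_elim simp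
qed

lemma checkerboard_step:
  assumes n: "n > 0" and G: "simple_graph G" "verts G = {1..n}"
  shows "AE z in I01sq. checkerboard n G (fst z) (snd z) = step_kernel n (adjacency (edges G)) (fst z) (snd z)"
proof -
  let ?N = "(\<lambda>i. real i / real n) ` {0..n}"
  have "AE x in lborel. \<forall>a\<in>?N. x \<noteq> a" by (subst AE_finite_all) (auto intro: AE_lborel_singleton)
  then have "AE x in lborel. x \<in> {0..1} \<longrightarrow> x \<notin> ?N \<and> 0 < x \<and> x \<le> 1"
  proof eventually_elim
    case (elim x)
    have N: "x \<notin> ?N" using bspec[OF elim, of x] by metis
    have "real 0 / real n \<in> ?N" by (rule imageI) simp
    then have "x \<noteq> 0" using N by (metis div_0 of_nat_0)
    then show ?case using N by (intro impI conjI) (assumption, simp_all only: atLeastAtMost_iff, linarith+)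
  qed
  then have "AE x in I01. x \<notin> ?N \<and> 0 < x \<and> x \<le> 1" by (subst AE_restrict_space_iff) auto
  from AE_I01_pair[OF this] show ?thesis
  proof eventually_elim
    case (elim z)
    have *: "x \<in> {(real i - 1) / real n <..< real i / real n} \<longleftrightarrow> i = cell n x"
      if "x \<notin> ?N" "0 < x" "x \<le> 1" "i \<in> {1..n}" for x i
    proof -
      have "x \<noteq> real i / real n" using that by auto
      then show ?thesis using cell_eq_iff[OF n, of i x] that by auto
    qed
    let ?a = "cell n (fst z)" and ?b = "cell n (snd z)"
    have ab: "?a \<in> {1..n}" "?b \<in> {1..n}" using cell_in_range[OF n] elim by blast+
    have "(\<exists>i\<in>{1..n}. \<exists>j\<in>{1..n}. {i, j} \<in> edges G \<and>
           fst z \<in> {(real i - 1) / real n <..< real i / real n} \<and>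
           snd z \<in> {(real j - 1) / real n <..< real j / real n})
        \<longleftrightarrow> (\<exists>i\<in>{1..n}. \<exists>j\<in>{1..n}. {i, j} \<in> edges G \<and> i = ?a \<and> j = ?b)"
      using elim by (intro bex_cong refl arg_cong2[where f="(\<and>)"] *) blast+
    also have "\<dots> \<longleftrightarrow> {?a, ?b} \<in> edges G" using ab by blast
    finally show ?case unfolding checkerboard_def step_kernel_def adjacency_def by simp
  qed
qed

lemma hom_density_checkerboard:
  assumes "simple_graph P" "n > 0" "simple_graph G" "verts G = {1..n}"
  shows "hom_density P (checkerboard n G) = matrix_density P n (adjacency (edges G))"
  using hom_density_step[OF assms(1,2) checkerboard_step[OF assms(2-4)]] .

text \<open>Integrating a step kernel against \<open>f\<close> and \<open>h\<close> amounts to evaluating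
  the bilinear form of its matrix at the integrals of \<open>f\<close> and \<open>h\<close> over
  the cells.\<close>

lemma integral_pair_step:
  fixes f h :: "real \<Rightarrow> real"
  assumes n: "n > 0" and f: "f \<in> borel_measurable I01" "\<And>x. \<bar>f x\<bar> \<le> 1"
    and h: "h \<in> borel_measurable I01" "\<And>x. \<bar>h x\<bar> \<le> 1"
  shows "(\<integral>z. f (fst z) * step_kernel n M (fst z) (snd z) * h (snd z) \<partial>I01sq)
    = (\<Sum>i\<in>{1..n}. \<Sum>j\<in>{1..n}. (\<integral>x. f x * (if cell n x = i then 1 else 0) \<partial>I01) * M i j
         * (\<integral>y. h y * (if cell n y = j then 1 else 0) \<partial>I01))"
proof -
  let ?f = "\<lambda>i x. f x * (if cell n x = i then 1 else 0)" and ?h = "\<lambda>j x. h x * (if cell n x = j then 1 else 0)"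
  have fi: "integrable I01 (?f i)" "integrable I01 (?h i)" for i
    using f h by (auto intro!: I01.integrable_const_bound[where B=1] AE_I2 simp: abs_mult)
  have fh: "integrable I01sq (\<lambda>z. ?f i (fst z) * ?h j (snd z))" for i j
  proof (rule I01_pair.integrable_const_bound[where B=1])
    have "norm (?f i (fst z) * ?h j (snd z)) \<le> 1" for z
      using f(2)[of "fst z"] h(2)[of "snd z"] by (auto simp: abs_mult intro!: mult_le_one)
    then show "AE z in I01sq. norm (?f i (fst z) * ?h j (snd z)) \<le> 1" by simp
    show "(\<lambda>z. ?f i (fst z) * ?h j (snd z)) \<in> borel_measurable I01sq"
      by (intro borel_measurable_times measurable_compose[OF measurable_fst borel_measurable_integrable[OF fi(1)]]
          measurable_compose[OF measurable_snd borel_measurable_integrable[OF fi(2)]])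
  qed
  have "(\<integral>z. f (fst z) * step_kernel n M (fst z) (snd z) * h (snd z) \<partial>I01sq)
    = (\<integral>z. (\<Sum>i\<in>{1..n}. \<Sum>j\<in>{1..n}. M i j * (?f i (fst z) * ?h j (snd z))) \<partial>I01sq)"
  proof (rule integral_cong_AE)
    show "(\<lambda>z. f (fst z) * step_kernel n M (fst z) (snd z) * h (snd z)) \<in> borel_measurable I01sq"
      using measurable_compose[OF measurable_fst f(1)] measurable_compose[OF measurable_snd h(1)] step_kernel_measurable[of n M]
      by (intro borel_measurable_times) (auto simp: case_prod_beta)
    show "(\<lambda>z. \<Sum>i\<in>{1..n}. \<Sum>j\<in>{1..n}. M i j * (?f i (fst z) * ?h j (snd z))) \<in> borel_measurable I01sq"
      using fh by (intro borel_measurable_sum borel_measurable_times[OF borel_measurable_const]) auto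
    show "AE z in I01sq. f (fst z) * step_kernel n M (fst z) (snd z) * h (snd z)
        = (\<Sum>i\<in>{1..n}. \<Sum>j\<in>{1..n}. M i j * (?f i (fst z) * ?h j (snd z)))"
      using AE_I01_pair[OF AE_I01_cell[OF n]]
    proof eventually_elim
      case (elim z)
      have "(\<Sum>j\<in>{1..n}. M i j * (?f i (fst z) * ?h j (snd z))) = (if i = cell n (fst z) then f (fst z) * M i (cell n (snd z)) * h (snd z) else 0)" for i
      proof -
        have "(\<Sum>j\<in>{1..n}. M i j * (?f i (fst z) * ?h j (snd z)))
            = (\<Sum>j\<in>{1..n}. if j = cell n (snd z) then M i j * (?f i (fst z) * h (snd z)) else 0)"
          by (intro sum.cong) auto
        also have "\<dots> = M i (cell n (snd z)) * (?f i (fst z) * h (snd z))"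
          using elim by (subst sum.delta) auto
        finally show ?thesis by (auto simp: mult_ac)
      qed
      then have "(\<Sum>i\<in>{1..n}. \<Sum>j\<in>{1..n}. M i j * (?f i (fst z) * ?h j (snd z)))
          = (\<Sum>i\<in>{1..n}. if i = cell n (fst z) then f (fst z) * M i (cell n (snd z)) * h (snd z) else 0)" by simp
      also have "\<dots> = f (fst z) * M (cell n (fst z)) (cell n (snd z)) * h (snd z)"
        using elim by (subst sum.delta) auto
      finally show ?case by (simp add: step_kernel_def)
    qed
  qed
  also have "\<dots> = (\<Sum>i\<in>{1..n}. \<Sum>j\<in>{1..n}. M i j * (\<integral>z. ?f i (fst z) * ?h j (snd z) \<partial>I01sq))"
    (is "?l = ?r")
  proof -
    have "?l = (\<Sum>i\<in>{1..n}. \<integral>z. (\<Sum>j\<in>{1..n}. M i j * (?f i (fst z) * ?h j (snd z))) \<partial>I01sq)"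
      by (intro Bochner_Integration.integral_sum Bochner_Integration.integrable_sum integrable_mult_right fh)
    also have "\<dots> = (\<Sum>i\<in>{1..n}. \<Sum>j\<in>{1..n}. \<integral>z. M i j * (?f i (fst z) * ?h j (snd z)) \<partial>I01sq)"
      by (intro sum.cong refl Bochner_Integration.integral_sum integrable_mult_right fh)
    finally show ?thesis by simp
  qed
  also have "\<dots> = (\<Sum>i\<in>{1..n}. \<Sum>j\<in>{1..n}. M i j * ((\<integral>x. ?f i x \<partial>I01) * (\<integral>y. ?h j y \<partial>I01)))"
  proof -
    have "(\<integral>z. ?f i (fst z) * ?h j (snd z) \<partial>I01sq) = (\<integral>x. ?f i x \<partial>I01) * (\<integral>y. ?h j y \<partial>I01)" for i j
      using fh[of i j] by (subst I01_pair.integral_fst'[symmetric]) auto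
    then show ?thesis by simp
  qed
  finally show ?thesis by (simp add: mult_ac)
qed

section \<open>Weak regularity\<close>

text \<open>The matrix form of the cut norm is stated with test sets, as the weak regularity lemma needs
  sets; \<open>matrix_cut_bounded_functions\<close> passes to test functions.\<close>

definition matrix_cut_bounded :: "nat \<Rightarrow> real \<Rightarrow> (nat \<Rightarrow> nat \<Rightarrow> real) \<Rightarrow> bool" where
  "matrix_cut_bounded n \<epsilon> U \<longleftrightarrow>
     (\<forall>S\<subseteq>{1..n}. \<forall>T\<subseteq>{1..n}. \<bar>\<Sum>i\<in>S. \<Sum>j\<in>T. U i j\<bar> \<le> \<epsilon> * (real n)\<^sup>2)"

lemma matrix_cut_bounded_cong:
  assumes "\<And>i j. i \<in> {1..n} \<Longrightarrow> j \<in> {1..n} \<Longrightarrow> U i j = U' i j"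
  shows "matrix_cut_bounded n \<epsilon> U \<longleftrightarrow> matrix_cut_bounded n \<epsilon> U'"
proof -
  have "(\<Sum>i\<in>S. \<Sum>j\<in>T. U i j) = (\<Sum>i\<in>S. \<Sum>j\<in>T. U' i j)" if "S \<subseteq> {1..n}" "T \<subseteq> {1..n}" for S T
    using that by (intro sum.cong refl assms) auto
  then show ?thesis by (simp add: matrix_cut_bounded_def)
qed

lemma matrix_cut_bounded_triangle:
  assumes "matrix_cut_bounded n \<epsilon> (\<lambda>i j. U i j - W i j)" "matrix_cut_bounded n \<delta> (\<lambda>i j. V i j - W i j)"
  shows "matrix_cut_bounded n (\<epsilon> + \<delta>) (\<lambda>i j. U i j - V i j)"
  unfolding matrix_cut_bounded_def
proof (intro allI impI)
  fix S T assume ST: "S \<subseteq> {1..n}" "T \<subseteq> {1..n}"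
  have "(\<Sum>i\<in>S. \<Sum>j\<in>T. U i j - V i j) = (\<Sum>i\<in>S. \<Sum>j\<in>T. U i j - W i j) - (\<Sum>i\<in>S. \<Sum>j\<in>T. V i j - W i j)"
    by (simp add: sum_subtractf)
  moreover have "\<bar>\<Sum>i\<in>S. \<Sum>j\<in>T. U i j - W i j\<bar> \<le> \<epsilon> * (real n)\<^sup>2" "\<bar>\<Sum>i\<in>S. \<Sum>j\<in>T. V i j - W i j\<bar> \<le> \<delta> * (real n)\<^sup>2"
    using assms ST by (auto simp: matrix_cut_bounded_def)
  ultimately show "\<bar>\<Sum>i\<in>S. \<Sum>j\<in>T. U i j - V i j\<bar> \<le> (\<epsilon> + \<delta>) * (real n)\<^sup>2"
    by (simp add: ring_distribs)
qed

lemma matrix_cut_bounded_average: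
  fixes M :: "'x \<Rightarrow> nat \<Rightarrow> nat \<Rightarrow> real"
  assumes "finite \<A>" "\<A> \<noteq> {}" "\<And>X. X \<in> \<A> \<Longrightarrow> matrix_cut_bounded n \<epsilon> (\<lambda>i j. M X i j - W i j)"
  shows "matrix_cut_bounded n \<epsilon> (\<lambda>i j. (\<Sum>X\<in>\<A>. M X i j) / real (card \<A>) - W i j)"
  unfolding matrix_cut_bounded_def
proof (intro allI impI)
  fix S T assume ST: "S \<subseteq> {1..n}" "T \<subseteq> {1..n}"
  have c: "0 < real (card \<A>)" using assms by (simp add: card_gt_0_iff)
  have "(\<Sum>i\<in>S. \<Sum>j\<in>T. (\<Sum>X\<in>\<A>. M X i j) / real (card \<A>) - W i j)
      = (\<Sum>i\<in>S. \<Sum>j\<in>T. \<Sum>X\<in>\<A>. (M X i j - W i j) / real (card \<A>))"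
  proof (intro sum.cong refl)
    fix i j
    show "(\<Sum>X\<in>\<A>. M X i j) / real (card \<A>) - W i j = (\<Sum>X\<in>\<A>. (M X i j - W i j) / real (card \<A>))"
      using c by (simp add: sum_divide_distrib[symmetric] sum_subtractf diff_divide_distrib)
  qed
  also have "\<dots> = (\<Sum>X\<in>\<A>. (\<Sum>i\<in>S. \<Sum>j\<in>T. M X i j - W i j) / real (card \<A>))"
    by (subst sum.swap, subst (2) sum.swap) (simp add: sum_divide_distrib sum.swap[of _ \<A>])
  also have "\<bar>\<dots>\<bar> \<le> (\<Sum>X\<in>\<A>. \<epsilon> * (real n)\<^sup>2 / real (card \<A>))"
  proof (rule order_trans[OF sum_abs sum_mono])
    fix X assume "X \<in> \<A>"
    then have "\<bar>\<Sum>i\<in>S. \<Sum>j\<in>T. M X i j - W i j\<bar> \<le> \<epsilon> * (real n)\<^sup>2"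
      using assms(3) ST by (simp add: matrix_cut_bounded_def)
    then show "\<bar>(\<Sum>i\<in>S. \<Sum>j\<in>T. M X i j - W i j) / real (card \<A>)\<bar> \<le> \<epsilon> * (real n)\<^sup>2 / real (card \<A>)"
      by (simp add: divide_right_mono abs_divide)
  qed
  also have "\<dots> = \<epsilon> * (real n)\<^sup>2" using c by simp
  finally show "\<bar>\<Sum>i\<in>S. \<Sum>j\<in>T. (\<Sum>X\<in>\<A>. M X i j) / real (card \<A>) - W i j\<bar> \<le> \<epsilon> * (real n)\<^sup>2" .
qed

lemma matrix_cut_bounded_permute:
  assumes "matrix_cut_bounded n \<epsilon> U" "bij_betw \<pi> {1..n} {1..n}"
  shows "matrix_cut_bounded n \<epsilon> (\<lambda>i j. U (\<pi> i) (\<pi> j))"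
  unfolding matrix_cut_bounded_def
proof (intro allI impI)
  fix S T assume ST: "S \<subseteq> {1..n}" "T \<subseteq> {1..n}"
  have inj: "inj_on \<pi> S" "inj_on \<pi> T" using assms(2) ST by (auto simp: bij_betw_def intro: inj_on_subset)
  have im: "\<pi> ` S \<subseteq> {1..n}" "\<pi> ` T \<subseteq> {1..n}" using assms(2) ST by (auto simp: bij_betw_def)
  have "(\<Sum>i\<in>S. \<Sum>j\<in>T. U (\<pi> i) (\<pi> j)) = (\<Sum>i\<in>\<pi> ` S. \<Sum>j\<in>\<pi> ` T. U i j)"
    using inj by (simp add: sum.reindex)
  then show "\<bar>\<Sum>i\<in>S. \<Sum>j\<in>T. U (\<pi> i) (\<pi> j)\<bar> \<le> \<epsilon> * (real n)\<^sup>2"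
    using assms(1) im by (simp add: matrix_cut_bounded_def)
qed

lemma sum_le_subset_sum:
  fixes c u :: "'a \<Rightarrow> real"
  assumes "finite A" "\<And>i. i \<in> A \<Longrightarrow> 0 \<le> u i \<and> u i \<le> 1"
  shows "\<exists>S\<subseteq>A. (\<Sum>i\<in>A. u i * c i) \<le> (\<Sum>i\<in>S. c i)"
proof (intro exI conjI)
  show "{i\<in>A. 0 < c i} \<subseteq> A" by auto
  have "(\<Sum>i\<in>A. u i * c i) \<le> (\<Sum>i\<in>A. if 0 < c i then c i else 0)"
    using assms(2) by (intro sum_mono) (auto simp: mult_le_cancel_right1 mult_nonneg_nonpos not_less)
  also have "\<dots> = (\<Sum>i\<in>{i\<in>A. 0 < c i}. c i)" using assms(1) by (simp add: sum.inter_filter)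
  finally show "(\<Sum>i\<in>A. u i * c i) \<le> (\<Sum>i\<in>{i\<in>A. 0 < c i}. c i)" .
qed

text \<open>A bilinear form on a product of cubes attains its maximum at a pair of vertices, that is, at a
  pair of sets.\<close>

lemma matrix_cut_bounded_functions:
  assumes U: "matrix_cut_bounded n \<epsilon> U"
    and u: "\<And>i. i \<in> {1..n} \<Longrightarrow> 0 \<le> u i \<and> u i \<le> 1" and v: "\<And>i. i \<in> {1..n} \<Longrightarrow> 0 \<le> v i \<and> v i \<le> 1"
  shows "\<bar>\<Sum>i\<in>{1..n}. \<Sum>j\<in>{1..n}. u i * U i j * v j\<bar> \<le> \<epsilon> * (real n)\<^sup>2"
proof -
  have up: "(\<Sum>i\<in>{1..n}. \<Sum>j\<in>{1..n}. u i * U i j * v j) \<le> \<epsilon> * (real n)\<^sup>2" if U: "matrix_cut_bounded n \<epsilon> U" for U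
  proof -
    obtain S where S: "S \<subseteq> {1..n}" "(\<Sum>i\<in>{1..n}. u i * (\<Sum>j\<in>{1..n}. U i j * v j)) \<le> (\<Sum>i\<in>S. \<Sum>j\<in>{1..n}. U i j * v j)"
      using sum_le_subset_sum[of "{1..n}" u "\<lambda>i. \<Sum>j\<in>{1..n}. U i j * v j"] u by auto
    obtain T where T: "T \<subseteq> {1..n}" "(\<Sum>j\<in>{1..n}. v j * (\<Sum>i\<in>S. U i j)) \<le> (\<Sum>j\<in>T. \<Sum>i\<in>S. U i j)"
      using sum_le_subset_sum[of "{1..n}" v "\<lambda>j. \<Sum>i\<in>S. U i j"] v by auto
    have "(\<Sum>i\<in>{1..n}. \<Sum>j\<in>{1..n}. u i * U i j * v j) = (\<Sum>i\<in>{1..n}. u i * (\<Sum>j\<in>{1..n}. U i j * v j))"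
      by (simp add: sum_distrib_left mult.assoc)
    also note S(2)
    also have "(\<Sum>i\<in>S. \<Sum>j\<in>{1..n}. U i j * v j) = (\<Sum>j\<in>{1..n}. v j * (\<Sum>i\<in>S. U i j))"
      by (subst sum.swap) (simp add: sum_distrib_left mult.commute)
    also note T(2)
    also have "(\<Sum>j\<in>T. \<Sum>i\<in>S. U i j) = (\<Sum>i\<in>S. \<Sum>j\<in>T. U i j)" by (rule sum.swap)
    also have "\<dots> \<le> \<epsilon> * (real n)\<^sup>2" using U S(1) T(1) by (auto simp: matrix_cut_bounded_def abs_le_iff)
    finally show ?thesis .
  qed
  have "matrix_cut_bounded n \<epsilon> (\<lambda>i j. - U i j)"
    using U by (simp add: matrix_cut_bounded_def sum_negf)
  from up[OF this] up[OF U] show ?thesis by (simp add: sum_negf abs_le_iff)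
qed

text \<open>Greedy argument: as long as the remainder \<open>U\<close> is not small in cut norm, some
  rectangle \<open>A \<times> B\<close> has
  \<open>\<bar>\<Sum> U\<bar> > \<epsilon> n\<^sup>2\<close>. Subtracting
  \<open>\<epsilon>\<close> times the indicator of the rectangle, with the sign of this sum,
  lowers the sum of squares of \<open>U\<close> by more than
  \<open>2 \<epsilon> (\<epsilon> n\<^sup>2) - \<epsilon>\<^sup>2 n\<^sup>2 = \<epsilon>\<^sup>2 n\<^sup>2\<close>.
  As it is at most \<open>n\<^sup>2\<close> at first, this happens fewer than \<open>R\<close>
  times. All coefficients are \<open>\<epsilon>\<close>, \<open>0\<close> or
  \<open>- \<epsilon>\<close>, so that the approximation is described by finitely many data, and
  the value \<open>0\<close> pads the sum to exactly \<open>R\<close> terms.\<close>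

lemma frieze_kannan:
  fixes M :: "nat \<Rightarrow> nat \<Rightarrow> real"
  assumes n: "n > 0" and \<epsilon>: "\<epsilon> > 0" and R: "real R * \<epsilon>\<^sup>2 > 1" and M: "\<And>i j. \<bar>M i j\<bar> \<le> 1"
  shows "\<exists>\<sigma> S T. (\<forall>q. \<sigma> q \<in> {-1, 0, 1} \<and> S q \<subseteq> {1..n} \<and> T q \<subseteq> {1..n}) \<and>
    matrix_cut_bounded n \<epsilon> (\<lambda>i j. M i j - \<epsilon> * (\<Sum>q<R. \<sigma> q * of_bool (i \<in> S q) * of_bool (j \<in> T q)))"
proof -
  define rest where "rest r \<sigma> S T i j = M i j - \<epsilon> * (\<Sum>q<r. \<sigma> q * of_bool (i \<in> S q) * of_bool (j \<in> T q))"
    for r and \<sigma> :: "nat \<Rightarrow> real" and S T :: "nat \<Rightarrow> nat set" and i j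
  define energy where "energy U = (\<Sum>i\<in>{1..n}. \<Sum>j\<in>{1..n}. (U i j)\<^sup>2)" for U :: "nat \<Rightarrow> nat \<Rightarrow> real"
  have "\<exists>\<sigma> S T. (\<forall>q. \<sigma> q \<in> {-1, 0, 1::real} \<and> S q \<subseteq> {1..n} \<and> T q \<subseteq> {1..n}) \<and>
    (matrix_cut_bounded n \<epsilon> (rest r \<sigma> S T) \<or> energy (rest r \<sigma> S T) \<le> (real n)\<^sup>2 * (1 - real r * \<epsilon>\<^sup>2))" for r
  proof (induction r)
    case 0
    have "energy (rest 0 (\<lambda>_. 0) (\<lambda>_. {}) (\<lambda>_. {})) \<le> (\<Sum>i\<in>{1..n}. \<Sum>j\<in>{1..n}. 1)"
      unfolding energy_def rest_def using M by (intro sum_mono) (simp add: abs_square_le_1)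
    then show ?case
      by (intro exI[of _ "\<lambda>_. 0"] exI[of _ "\<lambda>_. {}"]) (auto simp: power2_eq_square)
  next
    case (Suc r)
    then obtain \<sigma> S T where *: "\<forall>q. \<sigma> q \<in> {-1, 0, 1::real} \<and> S q \<subseteq> {1..n} \<and> T q \<subseteq> {1..n}"
      "matrix_cut_bounded n \<epsilon> (rest r \<sigma> S T) \<or> energy (rest r \<sigma> S T) \<le> (real n)\<^sup>2 * (1 - real r * \<epsilon>\<^sup>2)" by blast
    have upd: "rest (Suc r) (\<sigma>(r := a)) (S(r := A)) (T(r := B)) i j
        = rest r \<sigma> S T i j - \<epsilon> * a * of_bool (i \<in> A) * of_bool (j \<in> B)" for a A B i j
      by (simp add: rest_def algebra_simps)
    show ?case
    proof (cases "matrix_cut_bounded n \<epsilon> (rest r \<sigma> S T)")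
      case True
      have "rest (Suc r) (\<sigma>(r := 0)) (S(r := {})) (T(r := {})) = rest r \<sigma> S T"
      proof (intro ext)
        fix i j
        show "rest (Suc r) (\<sigma>(r := 0)) (S(r := {})) (T(r := {})) i j = rest r \<sigma> S T i j"
          using upd[of 0 "{}" "{}" i j] by simp
      qed
      then have "matrix_cut_bounded n \<epsilon> (rest (Suc r) (\<sigma>(r := 0)) (S(r := {})) (T(r := {})))" using True by metis
      moreover have "\<forall>q. (\<sigma>(r := 0)) q \<in> {-1, 0, 1} \<and> (S(r := {})) q \<subseteq> {1..n} \<and> (T(r := {})) q \<subseteq> {1..n}"
        using * by auto
      ultimately show ?thesis by blast
    next
      case False
      let ?U = "rest r \<sigma> S T"
      obtain A B where AB: "A \<subseteq> {1..n}" "B \<subseteq> {1..n}" "\<epsilon> * (real n)\<^sup>2 < \<bar>\<Sum>i\<in>A. \<Sum>j\<in>B. ?U i j\<bar>"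
        using False by (auto simp: matrix_cut_bounded_def not_le)
      define I where "I = (\<Sum>i\<in>A. \<Sum>j\<in>B. ?U i j)"
      define a where "a = sgn I"
      have "0 < \<epsilon> * (real n)\<^sup>2" using \<epsilon> n by simp
      then have I0: "I \<noteq> 0" using AB(3) unfolding I_def[symmetric] by auto
      have a: "a * I = \<bar>I\<bar>" "a\<^sup>2 = 1" "a \<in> {-1,0,1}" using I0 by (auto simp: a_def sgn_if)
      have fin: "finite A" "finite B" using AB by (auto intro: finite_subset)
      have ind: "(\<Sum>i\<in>{1..n}. \<Sum>j\<in>{1..n}. f i j * of_bool (i \<in> A) * of_bool (j \<in> B)) = (\<Sum>i\<in>A. \<Sum>j\<in>B. f i j)" for f :: "nat \<Rightarrow> nat \<Rightarrow> real"
      proof -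
        have "(\<Sum>i\<in>{1..n}. \<Sum>j\<in>{1..n}. f i j * of_bool (i \<in> A) * of_bool (j \<in> B))
            = (\<Sum>i\<in>A. \<Sum>j\<in>{1..n}. f i j * of_bool (i \<in> A) * of_bool (j \<in> B))"
          using AB(1) by (intro sum.mono_neutral_right) auto
        also have "\<dots> = (\<Sum>i\<in>A. \<Sum>j\<in>B. f i j * of_bool (i \<in> A) * of_bool (j \<in> B))"
          using AB(2) by (intro sum.cong refl sum.mono_neutral_right) auto
        finally show ?thesis by simp
      qed
      have "energy (\<lambda>i j. ?U i j - \<epsilon> * a * of_bool (i \<in> A) * of_bool (j \<in> B))
          = (\<Sum>i\<in>{1..n}. \<Sum>j\<in>{1..n}. (?U i j)\<^sup>2 + (\<epsilon>\<^sup>2 - 2 * \<epsilon> * a * ?U i j) * of_bool (i \<in> A) * of_bool (j \<in> B))"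
        unfolding energy_def using a(2) by (intro sum.cong refl) (auto simp: power2_diff power_mult_distrib)
      also have "\<dots> = energy ?U + (\<Sum>i\<in>A. \<Sum>j\<in>B. \<epsilon>\<^sup>2 - 2 * \<epsilon> * a * ?U i j)"
        by (simp only: sum.distrib energy_def ind)
      also have "(\<Sum>i\<in>A. \<Sum>j\<in>B. \<epsilon>\<^sup>2 - 2 * \<epsilon> * a * ?U i j) = real (card A) * real (card B) * \<epsilon>\<^sup>2 - 2 * \<epsilon> * (a * I)"
        by (simp add: sum_subtractf I_def sum_distrib_left algebra_simps)
      also have "\<dots> \<le> (real n)\<^sup>2 * \<epsilon>\<^sup>2 - 2 * \<epsilon> * (\<epsilon> * (real n)\<^sup>2)"
      proof -
        have "card A \<le> n" "card B \<le> n" using card_mono[OF _ AB(1)] card_mono[OF _ AB(2)] by auto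
        then have "real (card A) * real (card B) \<le> (real n)\<^sup>2" unfolding power2_eq_square by (intro mult_mono) auto
        then have "real (card A) * real (card B) * \<epsilon>\<^sup>2 \<le> (real n)\<^sup>2 * \<epsilon>\<^sup>2" by (intro mult_right_mono) auto
        moreover have "2 * \<epsilon> * (\<epsilon> * (real n)\<^sup>2) \<le> 2 * \<epsilon> * (a * I)"
          using AB(3) \<epsilon> unfolding a(1) by (intro mult_left_mono) (auto simp: I_def)
        ultimately show ?thesis by linarith
      qed
      finally have le: "energy (\<lambda>i j. ?U i j - \<epsilon> * a * of_bool (i \<in> A) * of_bool (j \<in> B)) \<le> energy ?U - (real n)\<^sup>2 * \<epsilon>\<^sup>2"
        by (simp add: power2_eq_square algebra_simps)
      have "rest (Suc r) (\<sigma>(r := a)) (S(r := A)) (T(r := B)) = (\<lambda>i j. ?U i j - \<epsilon> * a * of_bool (i \<in> A) * of_bool (j \<in> B))"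
        by (intro ext) (rule upd)
      then have "energy (rest (Suc r) (\<sigma>(r := a)) (S(r := A)) (T(r := B))) \<le> energy ?U - (real n)\<^sup>2 * \<epsilon>\<^sup>2"
        using le by simp
      also have "\<dots> \<le> (real n)\<^sup>2 * (1 - real (Suc r) * \<epsilon>\<^sup>2)" using *(2) False by (simp add: algebra_simps)
      finally have "energy (rest (Suc r) (\<sigma>(r := a)) (S(r := A)) (T(r := B))) \<le> (real n)\<^sup>2 * (1 - real (Suc r) * \<epsilon>\<^sup>2)" .
      moreover have "\<forall>q. (\<sigma>(r := a)) q \<in> {-1, 0, 1} \<and> (S(r := A)) q \<subseteq> {1..n} \<and> (T(r := B)) q \<subseteq> {1..n}"
        using * a(3) AB(1,2) by auto
      ultimately show ?thesis by blast
    qed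
  qed
  from this[of R] obtain \<sigma> S T where *: "\<forall>q. \<sigma> q \<in> {-1, 0, 1::real} \<and> S q \<subseteq> {1..n} \<and> T q \<subseteq> {1..n}"
      "matrix_cut_bounded n \<epsilon> (rest R \<sigma> S T) \<or> energy (rest R \<sigma> S T) \<le> (real n)\<^sup>2 * (1 - real R * \<epsilon>\<^sup>2)" by blast
  have "0 \<le> energy (rest R \<sigma> S T)" unfolding energy_def by (intro sum_nonneg) auto
  moreover have "(real n)\<^sup>2 * (1 - real R * \<epsilon>\<^sup>2) < 0" using n R by (intro mult_pos_neg) auto
  ultimately have "matrix_cut_bounded n \<epsilon> (rest R \<sigma> S T)" using *(2) by linarith
  then show ?thesis using *(1) unfolding rest_def[abs_def] by blast
qed

text \<open>Level \<open>l\<close> has precision \<open>1 / (l + 1)\<close> and uses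
  \<open>(l + 1)\<^sup>2 + 1\<close> rectangles, one more than the reciprocal square of the
  precision. The rectangles of all levels are numbered consecutively, so that their order is the
  same for every number of levels in use.\<close>

definition level_start :: "nat \<Rightarrow> nat" where
  "level_start j = (\<Sum>l<j. (l + 1)\<^sup>2 + 1)"

lemma level_start_Suc: "level_start (Suc j) = level_start j + ((j + 1)\<^sup>2 + 1)"
  by (simp add: level_start_def)

lemma level_start_mono: "j \<le> k \<Longrightarrow> level_start j \<le> level_start k"
  by (auto simp: level_start_def intro!: sum_mono2)

definition rectangle_sum ::
    "nat \<Rightarrow> (nat \<Rightarrow> real) \<Rightarrow> (nat \<Rightarrow> nat set) \<Rightarrow> (nat \<Rightarrow> nat set) \<Rightarrow> nat \<Rightarrow> nat \<Rightarrow> real" where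
  "rectangle_sum l \<sigma> S T i j = 1 / real (Suc l) *
     (\<Sum>q\<in>{level_start l..<level_start (Suc l)}. \<sigma> q * of_bool (i \<in> S q) * of_bool (j \<in> T q))"

lemma frieze_kannan_levels:
  fixes M :: "nat \<Rightarrow> nat \<Rightarrow> real"
  assumes n: "n > 0" and M: "\<And>i j. \<bar>M i j\<bar> \<le> 1"
  shows "\<exists>\<sigma> S T. (\<forall>q. \<sigma> q \<in> {-1, 0, 1} \<and> S q \<subseteq> {1..n} \<and> T q \<subseteq> {1..n}) \<and>
    (\<forall>l<J. matrix_cut_bounded n (1 / real (Suc l)) (\<lambda>i j. M i j - rectangle_sum l \<sigma> S T i j))"
proof (induction J)
  case 0
  show ?case by (intro exI[of _ "\<lambda>_. 0"] exI[of _ "\<lambda>_. {}"]) auto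
next
  case (Suc J)
  then obtain \<sigma> S T where 1: "\<forall>q. \<sigma> q \<in> {-1, 0, 1::real} \<and> S q \<subseteq> {1..n} \<and> T q \<subseteq> {1..n}"
    "\<forall>l<J. matrix_cut_bounded n (1 / real (Suc l)) (\<lambda>i j. M i j - rectangle_sum l \<sigma> S T i j)" by blast
  let ?R = "(J + 1)\<^sup>2 + 1" and ?e = "1 / real (Suc J)"
  have R: "real ?R * ?e\<^sup>2 > 1"
  proof -
    have "real ?R * ?e\<^sup>2 = ((real (Suc J))\<^sup>2 + 1) / (real (Suc J))\<^sup>2"
      by (simp add: power_divide add.commute)
    also have "\<dots> > 1" by (subst less_divide_eq_1_pos) (auto simp: zero_less_power2)
    finally show ?thesis .
  qed
  have "0 < ?e" by simp
  from frieze_kannan[OF n this R, of M, OF M] obtain \<sigma>' S' T' where 2: "\<forall>q. \<sigma>' q \<in> {-1, 0, 1::real} \<and> S' q \<subseteq> {1..n} \<and> T' q \<subseteq> {1..n}"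
    "matrix_cut_bounded n ?e (\<lambda>i j. M i j - ?e * (\<Sum>q<?R. \<sigma>' q * of_bool (i \<in> S' q) * of_bool (j \<in> T' q)))"
    by blast
  let ?k = "level_start J"
  define \<tau> where "\<tau> q = (if q < ?k then \<sigma> q else \<sigma>' (q - ?k))" for q
  define A where "A q = (if q < ?k then S q else S' (q - ?k))" for q
  define B where "B q = (if q < ?k then T q else T' (q - ?k))" for q
  have "rectangle_sum l \<tau> A B = rectangle_sum l \<sigma> S T" if "l < J" for l
  proof -
    have "q < ?k" if "q < level_start (Suc l)" for q
      using level_start_mono[of "Suc l" J] \<open>l < J\<close> that by simp
    then show ?thesis by (intro ext) (simp add: rectangle_sum_def \<tau>_def A_def B_def)
  qed
  moreover have "rectangle_sum J \<tau> A B = (\<lambda>i j. ?e * (\<Sum>q<?R. \<sigma>' q * of_bool (i \<in> S' q) * of_bool (j \<in> T' q)))"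
  proof (intro ext)
    fix i j
    have "(\<Sum>q\<in>{?k..<level_start (Suc J)}. \<tau> q * of_bool (i \<in> A q) * of_bool (j \<in> B q))
        = (\<Sum>q\<in>{0..<?R}. \<tau> (q + ?k) * of_bool (i \<in> A (q + ?k)) * of_bool (j \<in> B (q + ?k)))"
      unfolding level_start_Suc using sum.shift_bounds_nat_ivl[of "\<lambda>q. \<tau> q * of_bool (i \<in> A q) * of_bool (j \<in> B q)" 0 ?k ?R]
      by (simp add: add.commute)
    then show "rectangle_sum J \<tau> A B i j = ?e * (\<Sum>q<?R. \<sigma>' q * of_bool (i \<in> S' q) * of_bool (j \<in> T' q))"
      by (simp add: rectangle_sum_def \<tau>_def A_def B_def lessThan_atLeast0)
  qed
  ultimately have "\<forall>l<Suc J. matrix_cut_bounded n (1 / real (Suc l)) (\<lambda>i j. M i j - rectangle_sum l \<tau> A B i j)"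
    using 1(2) 2(2) by (auto simp: less_Suc_eq)
  moreover have "\<forall>q. \<tau> q \<in> {-1, 0, 1} \<and> A q \<subseteq> {1..n} \<and> B q \<subseteq> {1..n}"
    using 1(1) 2(1) by (simp add: \<tau>_def A_def B_def)
  ultimately show ?case by blast
qed

text \<open>Pigeonhole: there are \<open>3 \<cdot> 2\<^sup>n \<cdot> 2\<^sup>n\<close> choices for the
  coefficient and the two sets of a rectangle, and \<open>level_start J\<close> rectangles in
  total.\<close>

lemma common_rectangle_sums:
  fixes M :: "'x \<Rightarrow> nat \<Rightarrow> nat \<Rightarrow> real"
  assumes n: "n > 0" and M: "\<And>X i j. \<bar>M X i j\<bar> \<le> 1" and A: "finite \<A>"
  shows "\<exists>\<A>' \<sigma> S T. \<A>' \<subseteq> \<A> \<and> card \<A> \<le> card \<A>' * (3 * 4 ^ n) ^ level_start J \<and>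
    (\<forall>q. \<sigma> q \<in> {-1, 0, 1} \<and> S q \<subseteq> {1..n} \<and> T q \<subseteq> {1..n}) \<and>
    (\<forall>X\<in>\<A>'. \<forall>l<J. matrix_cut_bounded n (1 / real (Suc l)) (\<lambda>i j. M X i j - rectangle_sum l \<sigma> S T i j))"
proof -
  define good where "good X \<sigma> S T \<longleftrightarrow> (\<forall>q. \<sigma> q \<in> {-1, 0, 1} \<and> S q \<subseteq> {1..n} \<and> T q \<subseteq> {1..n}) \<and>
    (\<forall>l<J. matrix_cut_bounded n (1 / real (Suc l)) (\<lambda>i j. M X i j - rectangle_sum l \<sigma> S T i j))" for X \<sigma> S T
  have "\<exists>\<sigma> S T. good X \<sigma> S T" for X
    unfolding good_def by (rule frieze_kannan_levels[OF n M])
  then obtain \<sigma> S T where good: "\<And>X. good X (\<sigma> X) (S X) (T X)" by metis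
  let ?Q = "level_start J"
  let ?C = "{-1, 0, 1::real} \<times> Pow {1..n} \<times> Pow {1..n}"
  let ?D = "{..<?Q} \<rightarrow>\<^sub>E ?C"
  define d where "d X = (\<lambda>q\<in>{..<?Q}. (\<sigma> X q, S X q, T X q))" for X
  have dD: "d \<in> \<A> \<rightarrow> ?D"
  proof (rule funcsetI)
    fix X
    have "\<forall>q. \<sigma> X q \<in> {-1, 0, 1} \<and> S X q \<subseteq> {1..n} \<and> T X q \<subseteq> {1..n}"
      using good[of X] unfolding good_def by blast
    then show "d X \<in> ?D" unfolding d_def restrict_PiE_iff by auto
  qed
  have cD: "card ?D = (3 * 4 ^ n) ^ ?Q"
  proof -
    have "card ?C = 3 * (2 ^ n * 2 ^ n)" by (simp add: card_cartesian_product card_Pow)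
    also have "2 ^ n * 2 ^ n = (4 ^ n :: nat)" by (simp flip: power_mult_distrib)
    finally have "card ?C = 3 * 4 ^ n" .
    then show ?thesis by (subst card_PiE) auto
  qed
  have finD: "finite ?D" by (intro finite_PiE) auto
  have "?D \<noteq> {}" by (auto simp: PiE_eq_empty_iff)
  then obtain y where y: "y \<in> ?D" "card \<A> \<le> card (d -` {y} \<inter> \<A>) * card ?D"
    using pigeonhole_card[OF dD A finD] by auto
  show ?thesis
  proof (cases "d -` {y} \<inter> \<A> = {}")
    case True
    then show ?thesis using y
      by (intro exI[of _ "{}"] exI[of _ "\<lambda>_. 0"] exI[of _ "\<lambda>_. {}"]) auto
  next
    case False
    then obtain X0 where X0: "d X0 = y" "X0 \<in> \<A>" by auto
    show ?thesis
    proof (intro exI conjI ballI)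
      show "d -` {y} \<inter> \<A> \<subseteq> \<A>" by auto
      show "card \<A> \<le> card (d -` {y} \<inter> \<A>) * (3 * 4 ^ n) ^ ?Q" using y cD by simp
      show "\<forall>q. \<sigma> X0 q \<in> {-1, 0, 1} \<and> S X0 q \<subseteq> {1..n} \<and> T X0 q \<subseteq> {1..n}"
        using good[of X0] by (simp add: good_def)
      fix X assume "X \<in> d -` {y} \<inter> \<A>"
      then have "d X = d X0" using X0 by auto
      then have eq: "\<sigma> X q = \<sigma> X0 q \<and> S X q = S X0 q \<and> T X q = T X0 q" if "q < ?Q" for q
        using that by (auto simp: d_def dest!: fun_cong[of _ _ q])
      have "rectangle_sum l (\<sigma> X) (S X) (T X) = rectangle_sum l (\<sigma> X0) (S X0) (T X0)" if "l < J" for l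
      proof -
        have "q < ?Q" if "q < level_start (Suc l)" for q
          using level_start_mono[of "Suc l" J] \<open>l < J\<close> that by simp
        then show ?thesis using eq by (intro ext) (simp add: rectangle_sum_def)
      qed
      then show "\<forall>l<J. matrix_cut_bounded n (1 / real (Suc l)) (\<lambda>i j. M X i j - rectangle_sum l (\<sigma> X0) (S X0) (T X0) i j)"
        using good[of X] by (auto simp: good_def)
    qed
  qed
qed

section \<open>Sorting vertices\<close>

text \<open>The membership bits of \<open>i\<close> in \<open>B 0, \<dots>, B (q - 1)\<close>, read as a
  binary number with \<open>B 0\<close> as the most significant bit. Sorting by this number
  sorts lexicographically, so it sorts by every initial segment of the bits as well
  (\<open>address_div\<close>).\<close>

fun address :: "(nat \<Rightarrow> 'a set) \<Rightarrow> nat \<Rightarrow> 'a \<Rightarrow> nat" where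
  "address B 0 i = 0"
| "address B (Suc q) i = 2 * address B q i + of_bool (i \<in> B q)"

lemma address_less: "address B q i < 2 ^ q"
  by (induction q) (auto simp: of_bool_def)

lemma address_div: "address B q i = address B (q + k) i div 2 ^ k"
proof (induction k)
  case (Suc k)
  have "address B (q + Suc k) i div 2 ^ Suc k = address B (q + Suc k) i div 2 div 2 ^ k"
    by (simp add: div_mult2_eq)
  also have "address B (q + Suc k) i div 2 = address B (q + k) i" by simp
  finally show ?case using Suc by simp
qed simp

declare address.simps(2) [simp del]

text \<open>The summands with \<open>c \<ge> k\<close> have alternating signs and end with a positive one.
  They cancel in pairs, except for one summand if \<open>k\<close> is odd.\<close>

lemma alternating_sum_odd:
  "(\<Sum>c<2 * m. (-1) ^ Suc c * of_bool (k \<le> c)) = (of_bool (odd k \<and> k < 2 * m) :: real)"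
proof (induction m)
  case (Suc m)
  have "(\<Sum>c<2 * Suc m. (-1) ^ Suc c * of_bool (k \<le> c))
      = (\<Sum>c<2 * m. (-1) ^ Suc c * of_bool (k \<le> c)) - of_bool (k \<le> 2 * m) + (of_bool (k \<le> Suc (2 * m)) :: real)"
    by simp
  also have "\<dots> = of_bool (odd k \<and> k < 2 * m) - of_bool (k \<le> 2 * m) + of_bool (k \<le> Suc (2 * m))"
    unfolding Suc ..
  also have "\<dots> = of_bool (odd k \<and> k < 2 * Suc m)"
  proof (cases "k = Suc (2 * m)")
    case False
    then have "k \<le> 2 * m \<longleftrightarrow> k \<le> Suc (2 * m)" "odd k \<Longrightarrow> k < 2 * m \<longleftrightarrow> k < 2 * Suc m"
      by (auto simp: less_Suc_eq)
    then show ?thesis by auto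
  qed auto
  finally show ?case .
qed simp

text \<open>With suitable end points \<open>s q\<close>, this is the indicator of a set of sorted vertices
  that is described by \<open>q + 1\<close> bits of their addresses. The type of the end points
  is left open, since staircases are functions of vertices at first and of points of the unit
  interval later.\<close>

definition staircase :: "(nat \<Rightarrow> nat \<Rightarrow> 'a::linorder) \<Rightarrow> nat \<Rightarrow> 'a \<Rightarrow> real" where
  "staircase s q x = (\<Sum>c<2 ^ Suc q. (-1) ^ Suc c * of_bool (x \<le> s q c))"

text \<open>After sorting by addresses, the vertices whose address of length \<open>q + 1\<close> is at most
  \<open>c\<close> form an initial segment, of length \<open>s q c\<close> say. A vertex belongs
  to \<open>B q\<close> iff this address is odd. Hence \<open>B q\<close> has a description by
  \<open>2 ^ (q + 1)\<close> numbers, whatever the number of vertices and the number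
  \<open>Q\<close> of sets.\<close>

lemma sort_to_staircases:
  fixes B :: "nat \<Rightarrow> nat set"
  shows "\<exists>\<pi> s. bij_betw \<pi> {1..n} {1..n} \<and> (\<forall>q c. s q c \<le> n) \<and>
    (\<forall>q<Q. \<forall>i\<in>{1..n}. of_bool (\<pi> i \<in> B q) = staircase s q i)"
proof -
  let ?a = "address B Q"
  define xs where "xs = sort_key ?a [1..<Suc n]"
  have xs: "length xs = n" "distinct xs" "set xs = {1..n}" "sorted (map ?a xs)"
    by (auto simp: xs_def)
  define \<pi> where "\<pi> i = xs ! (i - 1)" for i
  have bij: "bij_betw \<pi> {1..n} {1..n}"
  proof -
    have "bij_betw (\<lambda>i. i - 1) {1..n} {..<n}"
      by (rule bij_betw_byWitness[where f'=Suc]) auto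
    moreover have "bij_betw ((!) xs) {..<n} {1..n}"
      by (rule bij_betw_nth) (use xs in auto)
    ultimately have "bij_betw ((!) xs \<circ> (\<lambda>i. i - 1)) {1..n} {1..n}" by (rule bij_betw_trans)
    then show ?thesis by (simp add: \<pi>_def[abs_def] comp_def)
  qed
  have monoQ: "?a (\<pi> i) \<le> ?a (\<pi> j)" if "1 \<le> i" "i \<le> j" "j \<le> n" for i j
    using sorted_nth_mono[OF xs(4), of "i - 1" "j - 1"] that xs(1) by (simp add: \<pi>_def)
  have mono: "address B q (\<pi> i) \<le> address B q (\<pi> j)" if "1 \<le> i" "i \<le> j" "j \<le> n" "q \<le> Q" for i j q
  proof -
    have "address B q x = ?a x div 2 ^ (Q - q)" for x using address_div[of B q x "Q - q"] that by simp
    then show ?thesis using monoQ[OF that(1-3)] by (simp add: div_le_mono)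
  qed
  define s where "s q c = card {i\<in>{1..n}. address B (Suc q) (\<pi> i) \<le> c}" for q c
  have s: "i \<le> s q c \<longleftrightarrow> address B (Suc q) (\<pi> i) \<le> c" if "i \<in> {1..n}" "q < Q" for i q c
  proof
    assume a: "address B (Suc q) (\<pi> i) \<le> c"
    have "{1..i} \<subseteq> {i\<in>{1..n}. address B (Suc q) (\<pi> i) \<le> c}"
    proof
      fix j assume j: "j \<in> {1..i}"
      then have "address B (Suc q) (\<pi> j) \<le> address B (Suc q) (\<pi> i)" using that by (intro mono) auto
      then show "j \<in> {i\<in>{1..n}. address B (Suc q) (\<pi> i) \<le> c}" using a j that by auto
    qed
    from card_mono[OF _ this] show "i \<le> s q c" by (simp add: s_def)
  next
    assume a: "i \<le> s q c"
    show "address B (Suc q) (\<pi> i) \<le> c"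
    proof (rule ccontr)
      assume b: "\<not> address B (Suc q) (\<pi> i) \<le> c"
      have "{i\<in>{1..n}. address B (Suc q) (\<pi> i) \<le> c} \<subseteq> {1..<i}"
      proof
        fix j assume j: "j \<in> {i\<in>{1..n}. address B (Suc q) (\<pi> i) \<le> c}"
        show "j \<in> {1..<i}"
        proof (rule ccontr)
          assume "j \<notin> {1..<i}"
          then have "address B (Suc q) (\<pi> i) \<le> address B (Suc q) (\<pi> j)" using j that by (intro mono) auto
          then show False using b j by auto
        qed
      qed
      from card_mono[OF _ this] have "s q c \<le> i - 1" by (simp add: s_def)
      then show False using a that by auto
    qed
  qed
  have "s q c \<le> n" for q c
  proof -
    have "s q c \<le> card {1..n}" unfolding s_def by (intro card_mono) auto
    then show ?thesis by simp
  qed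
  moreover have "of_bool (\<pi> i \<in> B q) = staircase s q i" if "q < Q" "i \<in> {1..n}" for q i
  proof -
    have "staircase s q i = (\<Sum>c<2 * 2 ^ q. (-1) ^ Suc c * of_bool (address B (Suc q) (\<pi> i) \<le> c))"
      unfolding staircase_def using s[OF that(2,1)] by simp
    also have "\<dots> = of_bool (odd (address B (Suc q) (\<pi> i)))"
      using address_less[of B "Suc q" "\<pi> i"] by (subst alternating_sum_odd) simp
    finally show ?thesis by (simp add: address.simps(2))
  qed
  ultimately show ?thesis using bij by blast
qed

text \<open>The two sets of rectangle \<open>q\<close> are described by the staircases \<open>2 q\<close>
  and \<open>2 q + 1\<close>, because all sets of all rectangles are sorted together, as one
  sequence.\<close>

definition staircase_sum ::
    "nat \<Rightarrow> (nat \<Rightarrow> real) \<Rightarrow> (nat \<Rightarrow> nat \<Rightarrow> 'a::linorder) \<Rightarrow> 'a \<Rightarrow> 'a \<Rightarrow> real" where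
  "staircase_sum l \<sigma> s x y = 1 / real (Suc l) *
     (\<Sum>q\<in>{level_start l..<level_start (Suc l)}. \<sigma> q * staircase s (2 * q) x * staircase s (2 * q + 1) y)"

lemma common_staircase_sums:
  fixes M :: "'x \<Rightarrow> nat \<Rightarrow> nat \<Rightarrow> real"
  assumes n: "n > 0" and M: "\<And>X i j. \<bar>M X i j\<bar> \<le> 1" and A: "finite \<A>"
  obtains \<A>' \<sigma> s \<pi> where "\<A>' \<subseteq> \<A>" "card \<A> \<le> card \<A>' * (3 * 4 ^ n) ^ level_start J"
    "\<And>q. \<bar>\<sigma> q\<bar> \<le> 1" "\<And>q c. s q c \<le> n" "bij_betw \<pi> {1..n} {1..n}"
    "\<And>X l. X \<in> \<A>' \<Longrightarrow> l < J \<Longrightarrow> matrix_cut_bounded n (1 / real (Suc l))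
       (\<lambda>i j. M X (\<pi> i) (\<pi> j) - staircase_sum l \<sigma> s i j)"
proof -
  obtain \<A>' \<sigma> S T where *: "\<A>' \<subseteq> \<A>" "card \<A> \<le> card \<A>' * (3 * 4 ^ n) ^ level_start J"
    "\<forall>q. \<sigma> q \<in> {-1, 0, 1} \<and> S q \<subseteq> {1..n} \<and> T q \<subseteq> {1..n}"
    "\<forall>X\<in>\<A>'. \<forall>l<J. matrix_cut_bounded n (1 / real (Suc l)) (\<lambda>i j. M X i j - rectangle_sum l \<sigma> S T i j)"
    using common_rectangle_sums[OF n, of M \<A> J, OF M A] by (elim exE conjE)
  define B where "B q = (if even q then S (q div 2) else T (q div 2))" for q
  obtain \<pi> s where \<pi>: "bij_betw \<pi> {1..n} {1..n}" "\<forall>q c. s q c \<le> n"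
    "\<forall>q<2 * level_start J. \<forall>i\<in>{1..n}. of_bool (\<pi> i \<in> B q) = staircase s q i"
    using sort_to_staircases[of n "2 * level_start J" B] by blast
  have eq: "rectangle_sum l \<sigma> S T (\<pi> i) (\<pi> j) = staircase_sum l \<sigma> s i j"
    if "l < J" "i \<in> {1..n}" "j \<in> {1..n}" for l i j
  proof -
    have "of_bool (\<pi> i \<in> S q) = staircase s (2 * q) i" "of_bool (\<pi> j \<in> T q) = staircase s (2 * q + 1) j"
      if "q < level_start (Suc l)" for q
    proof -
      have "q < level_start J" using level_start_mono[of "Suc l" J] \<open>l < J\<close> that by simp
      then have "2 * q < 2 * level_start J" "2 * q + 1 < 2 * level_start J" by auto
      then have "of_bool (\<pi> i \<in> B (2 * q)) = staircase s (2 * q) i" "of_bool (\<pi> j \<in> B (2 * q + 1)) = staircase s (2 * q + 1) j"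
        using \<pi>(3) \<open>i \<in> {1..n}\<close> \<open>j \<in> {1..n}\<close> by blast+
      then show "of_bool (\<pi> i \<in> S q) = staircase s (2 * q) i" "of_bool (\<pi> j \<in> T q) = staircase s (2 * q + 1) j"
        by (simp_all add: B_def)
    qed
    then show ?thesis unfolding rectangle_sum_def staircase_sum_def
      by (intro arg_cong2[where f="(*)"] refl sum.cong) auto
  qed
  show ?thesis
  proof (rule that[OF *(1,2) _ _ \<pi>(1)])
    show "\<bar>\<sigma> q\<bar> \<le> 1" for q using *(3)[rule_format, of q] by auto
    show "s q c \<le> n" for q c using \<pi>(2) by blast
    fix X l assume X: "X \<in> \<A>'" "l < J"
    have "matrix_cut_bounded n (1 / real (Suc l)) (\<lambda>i j. M X (\<pi> i) (\<pi> j) - rectangle_sum l \<sigma> S T (\<pi> i) (\<pi> j))"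
      using matrix_cut_bounded_permute[OF *(4)[rule_format, OF X] \<pi>(1)] .
    then show "matrix_cut_bounded n (1 / real (Suc l)) (\<lambda>i j. M X (\<pi> i) (\<pi> j) - staircase_sum l \<sigma> s i j)"
      by (rule matrix_cut_bounded_cong[THEN iffD1, rotated]) (simp add: eq[OF X(2)])
  qed
qed

section \<open>Entropy\<close>

text \<open>The right-hand side is the tangent line of \<open>H\<close> at \<open>v\<close>, evaluated at
  \<open>u\<close>; so this is the concavity of \<open>H\<close>.\<close>

lemma binary_cross_entropy:
  assumes u: "0 \<le> u" "u \<le> 1" and v: "0 < v" "v < 1"
  shows "H u \<le> - (1 / 2) * (u * ln v + (1 - u) * ln (1 - v))"
proof -
  have *: "a * ln b - a * ln a \<le> b - a" if "0 \<le> a" "0 < b" for a b :: real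
  proof (cases "a = 0")
    case False
    then have a: "0 < a" using that by simp
    have "a * ln b - a * ln a = a * ln (b / a)" using a that by (simp add: ln_div algebra_simps)
    also have "\<dots> \<le> a * (b / a - 1)" using a that by (intro mult_left_mono ln_le_minus_one) auto
    also have "\<dots> = b - a" using a by (simp add: field_simps)
    finally show ?thesis .
  qed (use that in simp)
  show ?thesis using *[of u v] *[of "1 - u" "1 - v"] u v unfolding H_def by (simp add: field_simps)
qed

lemma H_nonneg: assumes "0 \<le> u" "u \<le> 1" shows "0 \<le> H u"
proof -
  have "x * ln x \<le> 0" if "0 \<le> x" "x \<le> 1" for x :: real
    using that by (cases "x = 0") (auto simp: mult_nonneg_nonpos)
  from this[of u] this[of "1 - u"] show ?thesis using assms by (simp add: H_def)
qed

text \<open>Any bound that vanishes with \<open>\<eta>\<close> would do; it quantifies the continuity of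
  \<open>H\<close> at \<open>0\<close>.\<close>

lemma H_le_sqrt: assumes "0 < \<eta>" "\<eta> \<le> 1 / 2" shows "H \<eta> \<le> 2 * sqrt \<eta>"
proof -
  have s: "0 < sqrt \<eta>" "\<eta> = sqrt \<eta> * sqrt \<eta>" "sqrt \<eta> \<le> 1" using assms by auto
  have "ln \<eta> = 2 * ln (sqrt \<eta>)" using assms by (simp add: ln_sqrt)
  moreover have "- ln (sqrt \<eta>) \<le> 1 / sqrt \<eta> - 1"
    using ln_le_minus_one[of "1 / sqrt \<eta>"] s(1) by (simp add: ln_div)
  ultimately have "- ln \<eta> \<le> 2 * (1 / sqrt \<eta>)" by simp
  then have "\<eta> * - ln \<eta> \<le> \<eta> * (2 * (1 / sqrt \<eta>))" using assms by (intro mult_left_mono) auto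
  also have "\<dots> = 2 * sqrt \<eta>" using s by (simp add: field_simps)
  finally have 1: "\<eta> * - ln \<eta> \<le> 2 * sqrt \<eta>" .
  have "- ln (1 - \<eta>) \<le> 1 / (1 - \<eta>) - 1" using ln_le_minus_one[of "1 / (1 - \<eta>)"] assms by (simp add: ln_div)
  then have "(1 - \<eta>) * - ln (1 - \<eta>) \<le> (1 - \<eta>) * (1 / (1 - \<eta>) - 1)" using assms by (intro mult_left_mono) auto
  also have "\<dots> = \<eta>" using assms by (simp add: right_diff_distrib)
  also have "\<dots> \<le> sqrt \<eta>" using mult_right_mono[OF s(3), of "sqrt \<eta>"] s by simp
  finally have 2: "(1 - \<eta>) * - ln (1 - \<eta>) \<le> sqrt \<eta>" .
  have "H \<eta> = (\<eta> * - ln \<eta>) / 2 + ((1 - \<eta>) * - ln (1 - \<eta>)) / 2" by (simp add: H_def field_simps)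
  then show ?thesis using 1 2 s(1) by linarith
qed

lemma H_bound: assumes "0 \<le> u" "u \<le> 1" shows "\<bar>H u\<bar> \<le> 1"
proof -
  have "H u \<le> - (1 / 2) * (u * ln (1/2) + (1 - u) * ln (1 - 1/2))"
    using assms by (intro binary_cross_entropy) auto
  also have "\<dots> = ln 2 / 2" by (simp add: ln_div field_simps)
  also have "\<dots> \<le> 1" using ln_le_minus_one[of 2] by simp
  finally show ?thesis using H_nonneg[OF assms] by simp
qed

lemma H_measurable: "H \<in> borel_measurable borel"
  unfolding H_def[abs_def] by measurable

definition binary_entropy :: "real \<Rightarrow> real" where
  "binary_entropy p = - (p * ln p + (1 - p) * ln (1 - p))"

lemma binary_entropy_eq_H: "binary_entropy p = 2 * H p"
  by (simp add: binary_entropy_def H_def field_simps)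

lemma binary_entropy_bounds:
  assumes "0 \<le> p" "p \<le> 1" shows "0 \<le> binary_entropy p" "binary_entropy p \<le> 2"
  using H_nonneg[OF assms] H_bound[OF assms] by (simp_all add: binary_entropy_eq_H)

text \<open>The probability of \<open>X\<close> when each \<open>e\<close> in \<open>E\<close> is selected
  independently with probability \<open>p e\<close>.\<close>

definition edge_weight :: "'e set \<Rightarrow> ('e \<Rightarrow> real) \<Rightarrow> 'e set \<Rightarrow> real" where
  "edge_weight E p X = (\<Prod>e\<in>X. p e) * (\<Prod>e\<in>E - X. 1 - p e)"

lemma edge_weight_nonneg:
  assumes "\<And>e. e \<in> E \<Longrightarrow> 0 \<le> p e \<and> p e \<le> 1" "X \<subseteq> E"
  shows "0 \<le> edge_weight E p X"
  unfolding edge_weight_def using assms by (intro mult_nonneg_nonneg prod_nonneg) auto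

lemma sum_edge_weight:
  assumes "finite E" shows "(\<Sum>X\<in>Pow E. edge_weight E p X) = 1"
  using prod_add[OF assms, of p "\<lambda>e. 1 - p e"] by (simp add: edge_weight_def)

lemma sum_edge_weight_superset:
  assumes "finite E" "F \<subseteq> E"
  shows "(\<Sum>X\<in>Pow E. edge_weight E p X * (if F \<subseteq> X then 1 else 0)) = (\<Prod>e\<in>F. p e)"
proof -
  let ?q = "\<lambda>e. if e \<in> F then 0 else 1 - p e"
  have "edge_weight E p X * (if F \<subseteq> X then 1 else 0) = (\<Prod>e\<in>X. p e) * (\<Prod>e\<in>E - X. ?q e)" if "X \<subseteq> E" for X
  proof (cases "F \<subseteq> X")
    case True
    then have "(\<Prod>e\<in>E - X. ?q e) = (\<Prod>e\<in>E - X. 1 - p e)" by (intro prod.cong) auto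
    then show ?thesis using True by (simp add: edge_weight_def)
  next
    case False
    then obtain e where "e \<in> F" "e \<notin> X" by auto
    then have "(\<Prod>e\<in>E - X. ?q e) = 0" using assms by (intro prod_zero) auto
    then show ?thesis using False by simp
  qed
  then have "(\<Sum>X\<in>Pow E. edge_weight E p X * (if F \<subseteq> X then 1 else 0)) = (\<Sum>X\<in>Pow E. (\<Prod>e\<in>X. p e) * (\<Prod>e\<in>E - X. ?q e))"
    by (intro sum.cong) auto
  also have "\<dots> = (\<Prod>e\<in>E. p e + ?q e)" by (rule prod_add[OF assms(1), symmetric])
  also have "\<dots> = (\<Prod>e\<in>F. p e + ?q e)" using assms by (intro prod.mono_neutral_right) auto
  also have "\<dots> = (\<Prod>e\<in>F. p e)" by (intro prod.cong) auto
  finally show ?thesis .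
qed

text \<open>Additivity of entropy for independent choices, by induction on \<open>E\<close>. The identity
  \<open>(u v) ln (u v) = v (u ln u) + u (v ln v)\<close> holds for \<open>u\<close> or
  \<open>v\<close> equal to \<open>0\<close> too, so degenerate probabilities need no separate
  treatment.\<close>

lemma edge_weight_entropy:
  assumes "finite E" "\<And>e. e \<in> E \<Longrightarrow> 0 \<le> p e \<and> p e \<le> 1"
  shows "(\<Sum>X\<in>Pow E. - (edge_weight E p X * ln (edge_weight E p X))) = (\<Sum>e\<in>E. binary_entropy (p e))"
  using assms
proof (induction E rule: finite_induct)
  case empty
  then show ?case by (simp add: edge_weight_def)
next
  case (insert a E)
  let ?w = "edge_weight E p" and ?w' = "edge_weight (insert a E) p"
  have w1: "?w' X = (1 - p a) * ?w X" if "X \<subseteq> E" for X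
  proof -
    have "insert a E - X = insert a (E - X)" using that insert.hyps by auto
    then show ?thesis using insert.hyps that by (simp add: edge_weight_def)
  qed
  have w2: "?w' (insert a X) = p a * ?w X" if "X \<subseteq> E" for X
  proof -
    have "insert a E - insert a X = E - X" "a \<notin> X" "finite X"
      using that insert.hyps by (auto intro: finite_subset)
    then show ?thesis by (simp add: edge_weight_def)
  qed
  have xlogx: "(u * v) * ln (u * v) = v * (u * ln u) + u * (v * ln v)" if "0 \<le> u" "0 \<le> v" for u v :: real
    using that by (cases "u = 0 \<or> v = 0") (auto simp: ln_mult algebra_simps)
  have p: "0 \<le> p a" "p a \<le> 1" using insert.prems by auto
  have "(\<Sum>X\<in>Pow (insert a E). - (?w' X * ln (?w' X)))
      = (\<Sum>X\<in>Pow E. - (?w' X * ln (?w' X))) + (\<Sum>X\<in>insert a ` Pow E. - (?w' X * ln (?w' X)))"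
    unfolding Pow_insert using insert.hyps by (intro sum.union_disjoint) auto
  also have "(\<Sum>X\<in>insert a ` Pow E. - (?w' X * ln (?w' X))) = (\<Sum>X\<in>Pow E. - (?w' (insert a X) * ln (?w' (insert a X))))"
    using insert.hyps by (subst sum.reindex) (auto simp: inj_on_def)
  also have "(\<Sum>X\<in>Pow E. - (?w' X * ln (?w' X))) + \<dots>
      = (\<Sum>X\<in>Pow E. - (?w X * ln (?w X)) + ?w X * binary_entropy (p a))"
    unfolding sum.distrib[symmetric]
  proof (rule sum.cong[OF refl])
    fix X assume "X \<in> Pow E"
    then have X: "X \<subseteq> E" by simp
    have "0 \<le> ?w X" using insert.prems X by (intro edge_weight_nonneg) auto
    then show "- (?w' X * ln (?w' X)) + - (?w' (insert a X) * ln (?w' (insert a X))) = - (?w X * ln (?w X)) + ?w X * binary_entropy (p a)"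
      using p xlogx[of "1 - p a" "?w X"] xlogx[of "p a" "?w X"]
      unfolding w1[OF X] w2[OF X] by (simp add: binary_entropy_def ring_distribs)
  qed
  also have "\<dots> = (\<Sum>X\<in>Pow E. - (?w X * ln (?w X))) + binary_entropy (p a)"
    using sum_edge_weight[OF insert.hyps(1), of p]
    by (simp only: sum.distrib sum_distrib_right[symmetric] mult_1_left)
  also have "(\<Sum>X\<in>Pow E. - (?w X * ln (?w X))) = (\<Sum>e\<in>E. binary_entropy (p e))"
    using insert.IH insert.prems by auto
  finally show ?case using insert.hyps by simp
qed

lemma gibbs_inequality:
  fixes w q :: "'a \<Rightarrow> real"
  assumes "finite A" "\<And>x. x \<in> A \<Longrightarrow> 0 \<le> w x" "\<And>x. x \<in> A \<Longrightarrow> 0 < q x"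
    and "(\<Sum>x\<in>A. q x) \<le> (\<Sum>x\<in>A. w x)"
  shows "(\<Sum>x\<in>A. - (w x * ln (w x))) \<le> (\<Sum>x\<in>A. - (w x * ln (q x)))"
proof -
  have "- (w x * ln (w x)) + w x * ln (q x) \<le> q x - w x" if "x \<in> A" for x
  proof (cases "w x = 0")
    case True then show ?thesis using assms(3)[OF that] by simp
  next
    case False
    then have w: "0 < w x" using assms(2)[OF that] by simp
    have "- (w x * ln (w x)) + w x * ln (q x) = w x * ln (q x / w x)"
      using w assms(3)[OF that] by (simp add: ln_div algebra_simps)
    also have "\<dots> \<le> w x * (q x / w x - 1)"
      using w assms(3)[OF that] by (intro mult_left_mono ln_le_minus_one) auto
    also have "\<dots> = q x - w x" using w by (simp add: field_simps)
    finally show ?thesis .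
  qed
  then have "(\<Sum>x\<in>A. - (w x * ln (w x)) + w x * ln (q x)) \<le> (\<Sum>x\<in>A. q x - w x)" by (intro sum_mono)
  also have "\<dots> \<le> 0" using assms(4) by (simp add: sum_subtractf)
  finally show ?thesis by (simp add: sum.distrib sum_negf sum_subtractf)
qed

text \<open>Subadditivity of entropy: the uniform distribution on \<open>\<A>\<close> has entropy
  \<open>ln (card \<A>)\<close>, and Gibbs' inequality compares it with the product distribution
  that has the same marginals \<open>p\<close>, whose cross entropy is the right-hand side.\<close>

lemma ln_card_le_binary_entropy:
  fixes \<A> :: "'e set set"
  assumes E: "finite E" and A: "\<A> \<subseteq> Pow E" "\<A> \<noteq> {}"
  defines "p \<equiv> \<lambda>e. real (card {X \<in> \<A>. e \<in> X}) / real (card \<A>)"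
  shows "ln (real (card \<A>)) \<le> (\<Sum>e\<in>E. binary_entropy (p e))"
proof -
  have fA: "finite \<A>" using A E by (meson finite_Pow_iff finite_subset)
  then have c: "0 < real (card \<A>)" using A by (simp add: card_gt_0_iff)
  have p: "0 \<le> p e" "p e \<le> 1" for e
    using c fA by (auto simp: p_def divide_le_eq intro!: card_mono)
  have pos: "0 < p e" if "X \<in> \<A>" "e \<in> X" for X e
  proof -
    have "0 < card {X \<in> \<A>. e \<in> X}" using that fA by (auto simp: card_gt_0_iff)
    then show ?thesis using c by (simp add: p_def)
  qed
  have 1: "1 - p e = real (card {X \<in> \<A>. e \<notin> X}) / real (card \<A>)" for e
  proof -
    have "\<A> = {X \<in> \<A>. e \<in> X} \<union> {X \<in> \<A>. e \<notin> X}" by auto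
    then have "card \<A> = card {X \<in> \<A>. e \<in> X} + card {X \<in> \<A>. e \<notin> X}"
      using fA by (subst card_Un_disjoint[symmetric]) auto
    then show ?thesis using c by (simp add: p_def field_simps)
  qed
  have neg: "0 < 1 - p e" if "X \<in> \<A>" "e \<notin> X" for X e
  proof -
    have "0 < card {X \<in> \<A>. e \<notin> X}" using that fA by (auto simp: card_gt_0_iff)
    then show ?thesis using c unfolding 1 by simp
  qed
  have wpos: "0 < edge_weight E p X" if "X \<in> \<A>" for X
    unfolding edge_weight_def using pos[OF that] neg[OF that] by (intro mult_pos_pos prod_pos) auto
  have "(\<Sum>X\<in>\<A>. edge_weight E p X) \<le> (\<Sum>X\<in>Pow E. edge_weight E p X)"
    using E A p by (intro sum_mono2 edge_weight_nonneg) auto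
  also have "\<dots> = (\<Sum>X\<in>\<A>. 1 / real (card \<A>))" using c E by (simp add: sum_edge_weight)
  finally have "(\<Sum>X\<in>\<A>. - (1 / real (card \<A>) * ln (1 / real (card \<A>))))
      \<le> (\<Sum>X\<in>\<A>. - (1 / real (card \<A>) * ln (edge_weight E p X)))"
    using fA c wpos by (intro gibbs_inequality) auto
  then have "ln (real (card \<A>)) \<le> (\<Sum>X\<in>\<A>. - ln (edge_weight E p X)) / real (card \<A>)"
    using c by (simp add: ln_div sum_divide_distrib sum_negf)
  also have "(\<Sum>X\<in>\<A>. - ln (edge_weight E p X))
      = (\<Sum>X\<in>\<A>. \<Sum>e\<in>E. - (if e \<in> X then ln (p e) else ln (1 - p e)))"
  proof (rule sum.cong[OF refl])
    fix X assume X: "X \<in> \<A>"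
    then have XE: "X \<subseteq> E" using A by auto
    have nz: "p e \<noteq> 0" if "e \<in> X" for e using pos[OF X that] by simp
    have nz': "p e \<noteq> 1" if "e \<notin> X" for e using neg[OF X that] by simp
    have "ln (edge_weight E p X) = ln (\<Prod>e\<in>X. p e) + ln (\<Prod>e\<in>E - X. 1 - p e)"
      unfolding edge_weight_def using prod_pos[of X p] prod_pos[of "E - X" "\<lambda>e. 1 - p e"] pos[OF X] neg[OF X]
      by (subst ln_mult_pos) auto
    also have "\<dots> = (\<Sum>e\<in>X. ln (p e)) + (\<Sum>e\<in>E - X. ln (1 - p e))"
      using E finite_subset[OF XE E] nz nz' by (subst (1 2) ln_prod) auto
    also have "\<dots> = (\<Sum>e\<in>X. if e \<in> X then ln (p e) else ln (1 - p e)) + (\<Sum>e\<in>E - X. if e \<in> X then ln (p e) else ln (1 - p e))"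
      by (intro arg_cong2[where f="(+)"] sum.cong) auto
    also have "\<dots> = (\<Sum>e\<in>E. if e \<in> X then ln (p e) else ln (1 - p e))"
      by (subst sum.subset_diff[OF XE E]) (simp add: add.commute)
    finally show "- ln (edge_weight E p X) = (\<Sum>e\<in>E. - (if e \<in> X then ln (p e) else ln (1 - p e)))"
      by (simp add: sum_negf)
  qed
  also have "\<dots> = (\<Sum>e\<in>E. \<Sum>X\<in>\<A>. - (if e \<in> X then ln (p e) else ln (1 - p e)))" by (rule sum.swap)
  also have "\<dots> = (\<Sum>e\<in>E. binary_entropy (p e) * real (card \<A>))"
  proof (rule sum.cong[OF refl])
    fix e
    have "(\<Sum>X\<in>\<A>. - (if e \<in> X then ln (p e) else ln (1 - p e)))
        = - (real (card {X \<in> \<A>. e \<in> X}) * ln (p e) + real (card {X \<in> \<A>. e \<notin> X}) * ln (1 - p e))"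
      using fA by (simp add: sum_negf sum.If_cases Int_def conj_commute Compl_eq)
    also have "\<dots> = binary_entropy (p e) * real (card \<A>)"
    proof -
      have a: "real (card {X \<in> \<A>. e \<in> X}) = p e * real (card \<A>)" using c by (simp add: p_def)
      have b: "real (card {X \<in> \<A>. e \<notin> X}) = (1 - p e) * real (card \<A>)" using c by (simp add: 1)
      show ?thesis unfolding a b binary_entropy_def by (simp add: algebra_simps)
    qed
    finally show "(\<Sum>X\<in>\<A>. - (if e \<in> X then ln (p e) else ln (1 - p e))) = binary_entropy (p e) * real (card \<A>)" .
  qed
  finally show ?thesis using c by (simp add: sum_distrib_right[symmetric])
qed

text \<open>Gibbs' inequality with reference weights that are constant on \<open>\<A>\<close> and on its
  complement. If the probability \<open>r\<close> of \<open>\<A>\<close> is close to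
  \<open>1\<close>, a large entropy forces \<open>\<A>\<close> to be large.\<close>

lemma binary_entropy_sum_le_ln_card:
  fixes \<A> :: "'e set set"
  assumes E: "finite E" and p: "\<And>e. e \<in> E \<Longrightarrow> 0 \<le> p e \<and> p e \<le> 1" and A: "\<A> \<subseteq> Pow E"
  defines "r \<equiv> (\<Sum>X\<in>\<A>. edge_weight E p X)"
  shows "(\<Sum>e\<in>E. binary_entropy (p e)) \<le> r * ln (real (card \<A>)) + (1 - r) * (real (card E) * ln 2) + ln 2"
proof -
  have fA: "finite \<A>" using A E by (meson finite_Pow_iff finite_subset)
  define N where "N = real (card (Pow E))"
  have N: "N = 2 ^ card E" "0 < N" using E by (auto simp: N_def card_Pow)
  \<comment> \<open>The reference weights give one half to \<open>\<A>\<close> and at most one half to its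
    complement; this choice costs the summand \<open>ln 2\<close>.\<close>
  define q where "q X = (if X \<in> \<A> then 1 / (2 * real (card \<A>)) else 1 / (2 * N))" for X
  have cpos: "0 < real (card \<A>)" if "X \<in> \<A>" for X using that fA by (auto simp: card_gt_0_iff)
  have q: "0 < q X" for X using cpos[of X] N by (auto simp: q_def)
  have w: "0 \<le> edge_weight E p X" if "X \<in> Pow E" for X using p that by (intro edge_weight_nonneg) auto
  have split: "(\<Sum>X\<in>Pow E. f X) = (\<Sum>X\<in>\<A>. f X) + (\<Sum>X\<in>Pow E - \<A>. f X)" for f :: "'e set \<Rightarrow> real"
    using sum.subset_diff[OF A] E by (simp add: add.commute)
  have r: "(\<Sum>X\<in>Pow E - \<A>. edge_weight E p X) = 1 - r"
    using split[of "edge_weight E p"] by (simp add: sum_edge_weight[OF E] r_def)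
  have "(\<Sum>X\<in>\<A>. q X) \<le> 1/2"
    by (simp add: q_def)
  moreover have "(\<Sum>X\<in>Pow E - \<A>. q X) \<le> 1/2"
  proof -
    have "(\<Sum>X\<in>Pow E - \<A>. q X) = real (card (Pow E - \<A>)) * (1 / (2 * N))"
      by (simp add: q_def)
    also have "\<dots> \<le> N * (1 / (2 * N))"
      unfolding N_def using E by (intro mult_right_mono) (auto intro!: card_mono)
    finally show ?thesis using N by simp
  qed
  ultimately have "(\<Sum>X\<in>Pow E. q X) \<le> (\<Sum>X\<in>Pow E. edge_weight E p X)"
    unfolding sum_edge_weight[OF E] by (simp add: split[of q])
  then have "(\<Sum>X\<in>Pow E. - (edge_weight E p X * ln (edge_weight E p X))) \<le> (\<Sum>X\<in>Pow E. - (edge_weight E p X * ln (q X)))"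
    using E w q by (intro gibbs_inequality) auto
  also have "\<dots> = (\<Sum>X\<in>\<A>. edge_weight E p X * (ln 2 + ln (real (card \<A>))))
      + (\<Sum>X\<in>Pow E - \<A>. edge_weight E p X * (ln 2 + ln N))"
    unfolding split
  proof (intro arg_cong2[where f="(+)"] sum.cong refl)
    fix X assume "X \<in> \<A>"
    then show "- (edge_weight E p X * ln (q X)) = edge_weight E p X * (ln 2 + ln (real (card \<A>)))"
      using cpos[of X] by (simp add: q_def ln_div ln_mult algebra_simps)
  next
    fix X assume "X \<in> Pow E - \<A>"
    then show "- (edge_weight E p X * ln (q X)) = edge_weight E p X * (ln 2 + ln N)"
      using N(2) by (simp add: q_def ln_div ln_mult algebra_simps)
  qed
  also have "\<dots> = r * (ln 2 + ln (real (card \<A>))) + (1 - r) * (ln 2 + ln N)"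
    unfolding sum_distrib_right[symmetric] r by (simp add: r_def)
  also have "\<dots> = r * ln (real (card \<A>)) + (1 - r) * (real (card E) * ln 2) + ln 2"
    by (simp add: N(1) ln_realpow algebra_simps)
  finally show ?thesis using edge_weight_entropy[OF E p] by simp
qed

section \<open>Random graphs sampled from a kernel\<close>

definition all_edges :: "nat \<Rightarrow> nat set set" where
  "all_edges n = {e. e \<subseteq> {1..n} \<and> card e = 2}"

lemma finite_all_edges: "finite (all_edges n)"
  by (rule finite_subset[of _ "Pow {1..n}"]) (auto simp: all_edges_def)

lemma card_all_edges: "real (card (all_edges n)) = real n * (real n - 1) / 2"
proof -
  have "card (all_edges n) = n choose 2" using n_subsets[of "{1..n}" 2] by (simp add: all_edges_def)
  moreover have "real (n choose 2) = real n * (real n - 1) / 2"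
    by (cases n) (auto simp: choose_two real_of_nat_div algebra_simps)
  ultimately show ?thesis by simp
qed

lemma all_edges_ends:
  assumes "e \<in> all_edges n"
  shows "src e \<in> {1..n}" "tgt e \<in> {1..n}" "src e \<noteq> tgt e"
proof -
  have e: "e \<subseteq> {1..n}" "card e = 2" using assms by (auto simp: all_edges_def)
  have "src e \<in> e" "tgt e \<in> e" by (subst (2) edge_ends(1)[OF e(2)], simp)+
  then show "src e \<in> {1..n}" "tgt e \<in> {1..n}" using e(1) by blast+
  show "src e \<noteq> tgt e" by (rule edge_ends(2)[OF e(2)])
qed

text \<open>The graphs counted by \<open>Z\<close>, given by their sets of edges and with densities computed
  from the adjacency matrix.\<close>

definition good_edge_sets :: "nat \<Rightarrow> (nat \<Rightarrow> 'v sgraph) \<Rightarrow> (nat \<Rightarrow> real) \<Rightarrow> nat \<Rightarrow> real \<Rightarrow> nat set set set" where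
  "good_edge_sets k P t n \<delta> = {X. X \<subseteq> all_edges n \<and> (\<forall>i\<in>{1..k}. \<bar>matrix_density (P i) n (adjacency X) - t i\<bar> < \<delta>)}"

lemma finite_good_edge_sets: "finite (good_edge_sets k P t n \<delta>)"
  by (rule finite_subset[of _ "Pow (all_edges n)"]) (auto simp: good_edge_sets_def finite_all_edges)

lemma Z_eq_card:
  assumes P: "\<And>i. i \<in> {1..k} \<Longrightarrow> simple_graph (P i)" and n: "n > 0"
  shows "Z k P t n \<delta> = card (good_edge_sets k P t n \<delta>)"
proof -
  let ?G = "{G :: nat sgraph. simple_graph G \<and> verts G = {1..n} \<and>
       (\<forall>i\<in>{1..k}. hom_density (P i) (checkerboard n G) \<in> {t i - \<delta> <..< t i + \<delta>})}"
  have "bij_betw edges ?G (good_edge_sets k P t n \<delta>)"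
  proof (rule bij_betw_byWitness[where f'="\<lambda>X. \<lparr>verts = {1..n}, edges = X\<rparr>"])
    show "edges ` ?G \<subseteq> good_edge_sets k P t n \<delta>"
    proof (intro subsetI, elim imageE)
      fix X and G :: "nat sgraph"
      assume X: "X = edges G" and "G \<in> ?G"
      then have G: "simple_graph G" "verts G = {1..n}"
        "\<forall>i\<in>{1..k}. hom_density (P i) (checkerboard n G) \<in> {t i - \<delta> <..< t i + \<delta>}" by auto
      have "X \<subseteq> all_edges n" using G(1,2) X by (auto simp: simple_graph_def all_edges_def)
      moreover have "\<bar>matrix_density (P i) n (adjacency X) - t i\<bar> < \<delta>" if "i \<in> {1..k}" for i
        using G(3)[rule_format, OF that] unfolding hom_density_checkerboard[OF P[OF that] n G(1,2)] X by auto
      ultimately show "X \<in> good_edge_sets k P t n \<delta>" by (simp add: good_edge_sets_def)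
    qed
    show "(\<lambda>X. \<lparr>verts = {1..n}, edges = X\<rparr>) ` good_edge_sets k P t n \<delta> \<subseteq> ?G"
    proof (intro subsetI, elim imageE)
      fix X and G :: "nat sgraph"
      assume G: "G = \<lparr>verts = {1..n}, edges = X\<rparr>" and X: "X \<in> good_edge_sets k P t n \<delta>"
      have sg: "simple_graph G" "verts G = {1..n}" using G X by (auto simp: simple_graph_def good_edge_sets_def all_edges_def)
      have "hom_density (P i) (checkerboard n G) \<in> {t i - \<delta> <..< t i + \<delta>}" if "i \<in> {1..k}" for i
      proof -
        have "\<bar>matrix_density (P i) n (adjacency X) - t i\<bar> < \<delta>" using X that by (simp add: good_edge_sets_def)
        then show ?thesis unfolding hom_density_checkerboard[OF P[OF that] n sg] using G by auto
      qed
      then show "G \<in> ?G" using sg by blast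
    qed
  qed auto
  from bij_betw_same_card[OF this] show ?thesis by (simp add: Z_def)
qed

lemma adjacency_prod:
  assumes P: "simple_graph P"
  shows "(\<Prod>e\<in>edges P. adjacency X (\<phi> (src e)) (\<phi> (tgt e))) = (if (`) \<phi> ` edges P \<subseteq> X then 1 else 0)"
proof -
  have e: "adjacency X (\<phi> (src e)) (\<phi> (tgt e)) = (if \<phi> ` e \<in> X then 1 else 0)" if "e \<in> edges P" for e
  proof -
    have "\<phi> ` e = \<phi> ` {src e, tgt e}" using edge_ends(1)[OF simple_graph_edge(4)[OF P that]] by (rule arg_cong)
    then show ?thesis by (simp add: adjacency_def)
  qed
  show ?thesis
  proof (cases "(`) \<phi> ` edges P \<subseteq> X")
    case True
    then have "\<phi> ` e \<in> X" if "e \<in> edges P" for e using that by blast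
    then show ?thesis using True e by simp
  next
    case False
    then obtain e0 where "e0 \<in> edges P" "\<phi> ` e0 \<notin> X" by auto
    then have "(\<Prod>e\<in>edges P. adjacency X (\<phi> (src e)) (\<phi> (tgt e))) = 0"
      using e simple_graph_finite(2)[OF P] by (intro prod_zero) auto
    then show ?thesis using False by simp
  qed
qed

text \<open>The random graph on \<open>{1..n}\<close> obtained from a Borel version \<open>W\<close> of a
  graphon: sample points \<open>x 1, \<dots>, x n\<close> uniformly, then join \<open>i\<close>
  and \<open>j\<close> with probability \<open>W (x i) (x j)\<close>, independently given
  \<open>x\<close>.\<close>

locale random_graph =
  fixes W :: "real \<Rightarrow> real \<Rightarrow> real" and n :: nat
  assumes W: "(\<lambda>(x,y). W x y) \<in> borel_measurable I01sq"
    and W01: "\<And>x y. 0 \<le> W x y \<and> W x y \<le> 1" and Wsym: "\<And>x y. W x y = W y x" and n: "n > 0"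
begin

abbreviation sample_space :: "(nat \<Rightarrow> real) measure" where "sample_space \<equiv> \<Pi>\<^sub>M v\<in>{1..n}. I01"

sublocale S: prob_space sample_space by (rule prob_space_PiM) (rule prob_space_I01)

definition edge_prob :: "(nat \<Rightarrow> real) \<Rightarrow> nat set \<Rightarrow> real" where
  "edge_prob x e = W (x (src e)) (x (tgt e))"

lemma edge_prob01: "0 \<le> edge_prob x e \<and> edge_prob x e \<le> 1" using W01 by (simp add: edge_prob_def)

lemma pair_measurable:
  assumes "a \<in> K" "b \<in> K"
  shows "(\<lambda>x. W (x a) (x b)) \<in> borel_measurable (\<Pi>\<^sub>M v\<in>K. I01)"
proof -
  have "(\<lambda>x. (x a, x b)) \<in> (\<Pi>\<^sub>M v\<in>K. I01) \<rightarrow>\<^sub>M I01sq" using assms by simp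
  from measurable_compose[OF this W] show ?thesis by simp
qed

lemma edge_prob_measurable: "e \<in> all_edges n \<Longrightarrow> (\<lambda>x. edge_prob x e) \<in> borel_measurable sample_space"
  unfolding edge_prob_def using all_edges_ends by (intro pair_measurable) auto

lemma edge_prob_image:
  assumes P: "simple_graph P" and e: "e \<in> edges P" and inj: "inj_on \<phi> (verts P)"
  shows "edge_prob x (\<phi> ` e) = W (x (\<phi> (src e))) (x (\<phi> (tgt e)))"
proof -
  have "\<phi> ` e = \<phi> ` {src e, tgt e}" using edge_ends(1)[OF simple_graph_edge(4)[OF P e]] by (rule arg_cong)
  then have 1: "\<phi> ` e = {\<phi> (src e), \<phi> (tgt e)}" by simp
  have "\<phi> (src e) \<noteq> \<phi> (tgt e)" using inj simple_graph_edge[OF P e] by (auto dest: inj_onD)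
  then have "card (\<phi> ` e) = 2" using 1 by simp
  from edge_ends(1)[OF this] 1 have "{src (\<phi> ` e), tgt (\<phi> ` e)} = {\<phi> (src e), \<phi> (tgt e)}" by metis
  then show ?thesis unfolding edge_prob_def by (metis Wsym doubleton_eq_iff)
qed

text \<open>The distribution of the random graph, with the sample points integrated out; what is needed
  about it are finite sums over edge sets.\<close>

definition law :: "nat set set \<Rightarrow> real" where
  "law X = (\<integral>x. edge_weight (all_edges n) (edge_prob x) X \<partial>sample_space)"

lemma edge_weight01: "X \<subseteq> all_edges n \<Longrightarrow> 0 \<le> edge_weight (all_edges n) (edge_prob x) X \<and> edge_weight (all_edges n) (edge_prob x) X \<le> 1"
proof -
  assume X: "X \<subseteq> all_edges n"
  have w: "0 \<le> edge_weight (all_edges n) (edge_prob x) Y" if "Y \<in> Pow (all_edges n)" for Y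
    using edge_prob01 that by (intro edge_weight_nonneg) auto
  have "edge_weight (all_edges n) (edge_prob x) X \<le> (\<Sum>Y\<in>Pow (all_edges n). edge_weight (all_edges n) (edge_prob x) Y)"
    using w X finite_all_edges by (intro member_le_sum) auto
  then show ?thesis using w X sum_edge_weight[OF finite_all_edges] by auto
qed

lemma edge_weight_integrable:
  assumes X: "X \<subseteq> all_edges n"
  shows "integrable sample_space (\<lambda>x. edge_weight (all_edges n) (edge_prob x) X)"
proof (rule S.integrable_const_bound[where B=1])
  show "AE x in sample_space. norm (edge_weight (all_edges n) (edge_prob x) X) \<le> 1" using edge_weight01[OF X] by (auto simp: abs_le_iff)
  show "(\<lambda>x. edge_weight (all_edges n) (edge_prob x) X) \<in> borel_measurable sample_space"
    unfolding edge_weight_def using X edge_prob_measurable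
    by (intro borel_measurable_times borel_measurable_prod borel_measurable_diff borel_measurable_const) auto
qed

lemma law_nonneg: "X \<subseteq> all_edges n \<Longrightarrow> 0 \<le> law X"
  unfolding law_def using edge_weight01 by (intro Bochner_Integration.integral_nonneg) auto

lemma sum_law_eq:
  "(\<Sum>X\<in>Pow (all_edges n). law X * f X) = (\<integral>x. (\<Sum>X\<in>Pow (all_edges n). edge_weight (all_edges n) (edge_prob x) X * f X) \<partial>sample_space)"
proof -
  have "(\<integral>x. (\<Sum>X\<in>Pow (all_edges n). edge_weight (all_edges n) (edge_prob x) X * f X) \<partial>sample_space)
      = (\<Sum>X\<in>Pow (all_edges n). \<integral>x. edge_weight (all_edges n) (edge_prob x) X * f X \<partial>sample_space)"
    by (intro Bochner_Integration.integral_sum integrable_mult_left edge_weight_integrable) auto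
  then show ?thesis by (simp add: law_def)
qed

lemma sum_law: "(\<Sum>X\<in>Pow (all_edges n). law X) = 1"
  using sum_law_eq[of "\<lambda>_. 1"]
  by (simp only: mult_1_right sum_edge_weight[OF finite_all_edges] lebesgue_integral_const S.prob_space scaleR_one)

lemma law_superset:
  assumes "F \<subseteq> all_edges n"
  shows "(\<Sum>X\<in>Pow (all_edges n). law X * (if F \<subseteq> X then 1 else 0)) = (\<integral>x. (\<Prod>e\<in>F. edge_prob x e) \<partial>sample_space)"
  unfolding sum_law_eq sum_edge_weight_superset[OF finite_all_edges assms] ..

text \<open>Under an injection of the vertices of \<open>P\<close> into the sampled indices, the
  corresponding sample points are again independent and uniform.\<close>

lemma integral_embedding:
  fixes \<phi> :: "'v \<Rightarrow> nat"
  assumes P: "simple_graph P" and K: "finite K" and \<phi>: "inj_on \<phi> (verts P)" "\<phi> ` verts P \<subseteq> K"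
  shows "(\<integral>x. (\<Prod>e\<in>edges P. W (x (\<phi> (src e))) (x (\<phi> (tgt e)))) \<partial>(\<Pi>\<^sub>M v\<in>K. I01)) = hom_density P W"
proof -
  let ?r = "\<lambda>x. \<lambda>v\<in>verts P. x (\<phi> v)"
  have d: "distr (\<Pi>\<^sub>M v\<in>K. I01) (\<Pi>\<^sub>M v\<in>verts P. I01) ?r = (\<Pi>\<^sub>M v\<in>verts P. I01)"
    using distr_PiM_reindex[of K "\<lambda>_. I01" \<phi> "verts P"] \<phi> prob_space_I01 by auto
  have m: "?r \<in> (\<Pi>\<^sub>M v\<in>K. I01) \<rightarrow>\<^sub>M (\<Pi>\<^sub>M v\<in>verts P. I01)"
    using \<phi>(2) by (intro measurable_restrict) (auto intro!: measurable_component_singleton)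
  have "hom_density P W = (\<integral>x. hom_prod P W x \<partial>(\<Pi>\<^sub>M v\<in>verts P. I01))"
    by (rule hom_density_version[OF P W]) simp
  also have "\<dots> = (\<integral>x. hom_prod P W x \<partial>distr (\<Pi>\<^sub>M v\<in>K. I01) (\<Pi>\<^sub>M v\<in>verts P. I01) ?r)" by (simp only: d)
  also have "\<dots> = (\<integral>x. hom_prod P W (?r x) \<partial>(\<Pi>\<^sub>M v\<in>K. I01))"
    by (rule integral_distr[OF m borel_measurable_hom_prod[OF P W]])
  also have "\<dots> = (\<integral>x. (\<Prod>e\<in>edges P. W (x (\<phi> (src e))) (x (\<phi> (tgt e)))) \<partial>(\<Pi>\<^sub>M v\<in>K. I01))"
    using simple_graph_edge[OF P] by (intro Bochner_Integration.integral_cong refl) (auto simp: hom_prod_def intro!: prod.cong)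
  finally show ?thesis ..
qed

lemma image_edges:
  assumes P: "simple_graph P" and \<phi>: "inj_on \<phi> (verts P)" "\<phi> ` verts P \<subseteq> {1..n}"
  shows "(`) \<phi> ` edges P \<subseteq> all_edges n" "inj_on ((`) \<phi>) (edges P)"
    "(\<Prod>e\<in>(`) \<phi> ` edges P. edge_prob x e) = (\<Prod>e\<in>edges P. W (x (\<phi> (src e))) (x (\<phi> (tgt e))))"
proof -
  have eV: "e \<subseteq> verts P" "card e = 2" if "e \<in> edges P" for e using P that by (auto simp: simple_graph_def)
  show "(`) \<phi> ` edges P \<subseteq> all_edges n"
  proof (clarify)
    fix e assume e: "e \<in> edges P"
    have "card (\<phi> ` e) = 2" using card_image[OF inj_on_subset[OF \<phi>(1) eV(1)[OF e]]] eV(2)[OF e] by simp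
    then show "\<phi> ` e \<in> all_edges n" using \<phi>(2) eV(1)[OF e] by (auto simp: all_edges_def)
  qed
  show inj: "inj_on ((`) \<phi>) (edges P)"
    using eV \<phi>(1) by (intro inj_onI) (meson inj_on_image_eq_iff)
  show "(\<Prod>e\<in>(`) \<phi> ` edges P. edge_prob x e) = (\<Prod>e\<in>edges P. W (x (\<phi> (src e))) (x (\<phi> (tgt e))))"
    unfolding prod.reindex[OF inj] comp_def using edge_prob_image[OF P _ \<phi>(1)] by (intro prod.cong) auto
qed

lemma law_embedding:
  assumes P: "simple_graph P" and \<phi>: "inj_on \<phi> (verts P)" "\<phi> ` verts P \<subseteq> {1..n}"
  shows "(\<Sum>X\<in>Pow (all_edges n). law X * (if (`) \<phi> ` edges P \<subseteq> X then 1 else 0)) = hom_density P W"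
  unfolding law_superset[OF image_edges(1)[OF assms]] image_edges(3)[OF assms]
  by (rule integral_embedding[OF P _ \<phi>]) simp

text \<open>Copies of \<open>P\<close> on disjoint sets of vertices depend on disjoint sets of sample
  points, so they are present independently.\<close>

lemma law_two_embeddings:
  assumes P: "simple_graph P" and \<phi>: "inj_on \<phi> (verts P)" "\<phi> ` verts P \<subseteq> {1..n}"
    and \<psi>: "inj_on \<psi> (verts P)" "\<psi> ` verts P \<subseteq> {1..n}" and disj: "\<phi> ` verts P \<inter> \<psi> ` verts P = {}"
  shows "(\<Sum>X\<in>Pow (all_edges n). law X * ((if (`) \<phi> ` edges P \<subseteq> X then 1 else 0) * (if (`) \<psi> ` edges P \<subseteq> X then 1 else 0)))
    = (hom_density P W)\<^sup>2"
proof -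
  let ?F = "(`) \<phi> ` edges P" and ?G = "(`) \<psi> ` edges P"
  let ?f = "\<lambda>\<phi> x. \<Prod>e\<in>edges P. W (x (\<phi> (src e))) (x (\<phi> (tgt e)))"
  have eV: "e \<subseteq> verts P" "e \<noteq> {}" if "e \<in> edges P" for e using P that by (auto simp: simple_graph_def)
  have dFG: "?F \<inter> ?G = {}"
  proof (rule ccontr)
    assume "?F \<inter> ?G \<noteq> {}"
    then obtain e e' where "e \<in> edges P" "e' \<in> edges P" "\<phi> ` e = \<psi> ` e'" by auto
    moreover obtain a where "a \<in> e" using eV(2)[OF \<open>e \<in> edges P\<close>] by auto
    ultimately show False using eV(1)[of e] eV(1)[of e'] disj by blast
  qed
  let ?K = "\<phi> ` verts P"
  define L where "L = {1..n} - ?K"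
  have KL: "{1..n} = ?K \<union> L" "?K \<inter> L = {}" "finite ?K" "finite L"
    using \<phi>(2) simple_graph_finite(1)[OF P] unfolding L_def by (blast, blast, simp, simp)
  have fm: "?f \<eta> \<in> borel_measurable sample_space" if "\<eta> ` verts P \<subseteq> {1..n}" for \<eta>
    using that simple_graph_edge[OF P] by (intro borel_measurable_prod pair_measurable) blast+
  have fabs: "\<bar>?f \<eta> x\<bar> \<le> 1" for \<eta> x
    unfolding abs_prod using W01 by (intro prod_le_1) auto
  have int: "integrable sample_space (\<lambda>x. ?f \<phi> x * ?f \<psi> x)"
  proof (rule S.integrable_const_bound[where B=1])
    have "norm (?f \<phi> x * ?f \<psi> x) \<le> 1" for x unfolding real_norm_def abs_mult by (intro mult_le_one fabs abs_ge_zero)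
    then show "AE x in sample_space. norm (?f \<phi> x * ?f \<psi> x) \<le> 1" by (rule AE_I2)
    show "(\<lambda>x. ?f \<phi> x * ?f \<psi> x) \<in> borel_measurable sample_space"
      by (rule borel_measurable_times[OF fm[OF \<phi>(2)] fm[OF \<psi>(2)]])
  qed
  have "(\<Sum>X\<in>Pow (all_edges n). law X * ((if ?F \<subseteq> X then 1 else 0) * (if ?G \<subseteq> X then 1 else 0)))
      = (\<Sum>X\<in>Pow (all_edges n). law X * (if ?F \<union> ?G \<subseteq> X then 1 else 0))" by (intro sum.cong) auto
  also have "\<dots> = (\<integral>x. (\<Prod>e\<in>?F \<union> ?G. edge_prob x e) \<partial>sample_space)"
    using image_edges(1)[OF P \<phi>] image_edges(1)[OF P \<psi>] by (intro law_superset) auto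
  also have "\<dots> = (\<integral>x. ?f \<phi> x * ?f \<psi> x \<partial>sample_space)"
  proof -
    have "(\<Prod>e\<in>?F \<union> ?G. edge_prob x e) = ?f \<phi> x * ?f \<psi> x" for x
      using dFG simple_graph_finite(2)[OF P] image_edges(3)[OF P \<phi>, of x] image_edges(3)[OF P \<psi>, of x]
      by (subst prod.union_disjoint) auto
    then show ?thesis by simp
  qed
  also have "\<dots> = (\<integral>x. (\<integral>y. ?f \<phi> (merge ?K L (x,y)) * ?f \<psi> (merge ?K L (x,y)) \<partial>(\<Pi>\<^sub>M v\<in>L. I01)) \<partial>(\<Pi>\<^sub>M v\<in>?K. I01))"
    using int unfolding KL(1) by (intro I01_product.product_integral_fold) (use KL(2-4) in auto)
  also have "\<dots> = (\<integral>x. (\<integral>y. ?f \<phi> x * ?f \<psi> y \<partial>(\<Pi>\<^sub>M v\<in>L. I01)) \<partial>(\<Pi>\<^sub>M v\<in>?K. I01))"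
  proof (intro Bochner_Integration.integral_cong refl arg_cong2[where f="(*)"] prod.cong)
    fix x y e assume e: "e \<in> edges P"
    have s: "src e \<in> verts P" "tgt e \<in> verts P" using simple_graph_edge[OF P e] by auto
    then show "W (merge ?K L (x, y) (\<phi> (src e))) (merge ?K L (x, y) (\<phi> (tgt e))) = W (x (\<phi> (src e))) (x (\<phi> (tgt e)))"
      by (auto simp: merge_def)
    have "\<psi> (src e) \<in> L" "\<psi> (tgt e) \<in> L" using s \<psi>(2) disj unfolding L_def by blast+
    moreover from this have "\<psi> (src e) \<notin> ?K" "\<psi> (tgt e) \<notin> ?K" unfolding L_def by simp_all
    ultimately show "W (merge ?K L (x, y) (\<psi> (src e))) (merge ?K L (x, y) (\<psi> (tgt e))) = W (y (\<psi> (src e))) (y (\<psi> (tgt e)))"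
      by (simp add: merge_def)
  qed
  also have "\<dots> = (\<integral>x. ?f \<phi> x \<partial>(\<Pi>\<^sub>M v\<in>?K. I01)) * (\<integral>y. ?f \<psi> y \<partial>(\<Pi>\<^sub>M v\<in>L. I01))" by simp
  also have "(\<integral>x. ?f \<phi> x \<partial>(\<Pi>\<^sub>M v\<in>?K. I01)) = hom_density P W"
    by (rule integral_embedding[OF P KL(3) \<phi>(1)]) simp
  also have "(\<integral>y. ?f \<psi> y \<partial>(\<Pi>\<^sub>M v\<in>L. I01)) = hom_density P W"
    by (rule integral_embedding[OF P KL(4) \<psi>(1)]) (use \<psi>(2) disj in \<open>auto simp: L_def\<close>)
  finally show ?thesis by (simp add: power2_eq_square)
qed

end

section \<open>The second moment and the lower bound\<close>

text \<open>Requiring that the value at \<open>v\<close> be determined by the other values costs a factor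
  \<open>n\<close>; this counts the maps that send two given vertices to the same point, and the
  maps with a prescribed value.\<close>

lemma card_functions_determined:
  assumes V: "finite V" "v \<in> V" and A: "A \<subseteq> V \<rightarrow>\<^sub>E {1..n}"
    and det: "\<And>\<phi> \<psi>. \<phi> \<in> A \<Longrightarrow> \<psi> \<in> A \<Longrightarrow> (\<And>w. w \<in> V - {v} \<Longrightarrow> \<phi> w = \<psi> w) \<Longrightarrow> \<phi> v = \<psi> v"
  shows "card A \<le> n ^ (card V - 1)"
proof -
  have "inj_on (\<lambda>\<phi>. restrict \<phi> (V - {v})) A"
  proof (rule inj_onI)
    fix \<phi> \<psi> assume a: "\<phi> \<in> A" "\<psi> \<in> A" and eq: "restrict \<phi> (V - {v}) = restrict \<psi> (V - {v})"
    have w: "\<phi> w = \<psi> w" if "w \<in> V - {v}" for w using fun_cong[OF eq, of w] that by simp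
    then have "\<phi> w = \<psi> w" if "w \<in> V" for w using det[OF a w] that by (cases "w = v") auto
    moreover have "\<phi> \<in> V \<rightarrow>\<^sub>E {1..n}" "\<psi> \<in> V \<rightarrow>\<^sub>E {1..n}" using A a by blast+
    ultimately show "\<phi> = \<psi>" by (intro extensionalityI[of _ V]) (auto simp: PiE_def)
  qed
  moreover have "(\<lambda>\<phi>. restrict \<phi> (V - {v})) ` A \<subseteq> (V - {v}) \<rightarrow>\<^sub>E {1..n}"
  proof (rule image_subsetI)
    fix \<phi> assume "\<phi> \<in> A"
    then have "\<phi> \<in> V \<rightarrow>\<^sub>E {1..n}" using A by blast
    then show "restrict \<phi> (V - {v}) \<in> (V - {v}) \<rightarrow>\<^sub>E {1..n}" unfolding restrict_PiE_iff by blast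
  qed
  ultimately have "card A \<le> card ((V - {v}) \<rightarrow>\<^sub>E {1..n})"
    using V by (intro card_inj_on_le) (auto intro!: finite_PiE)
  also have "\<dots> = n ^ (card V - 1)" using V by (simp add: card_PiE)
  finally show ?thesis .
qed

text \<open>If a pair of maps fails to be a pair of injections with disjoint ranges, there is a coincidence
  \<open>\<phi> u = \<phi> v\<close>, \<open>\<psi> u = \<psi> v\<close> or
  \<open>\<phi> u = \<psi> v\<close>. With \<open>m\<close> elements in \<open>V\<close> there
  are at most \<open>3 m\<^sup>2\<close> possible coincidences, each with a fraction at most
  \<open>1 / n\<close> of all pairs.\<close>

lemma count_bad_pairs:
  fixes V :: "'v set"
  assumes V: "finite V" and n: "n > 0"
  defines "\<Phi> \<equiv> V \<rightarrow>\<^sub>E {1..n}"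
  shows "(\<Sum>\<phi>\<in>\<Phi>. \<Sum>\<psi>\<in>\<Phi>. of_bool (\<not> (inj_on \<phi> V \<and> inj_on \<psi> V \<and> \<phi> ` V \<inter> \<psi> ` V = {})))
    \<le> 3 * (real (card V))\<^sup>2 / real n * (real n ^ card V * real n ^ card V)"
proof -
  let ?m = "card V"
  have fin: "finite \<Phi>" unfolding \<Phi>_def using V by (intro finite_PiE) auto
  have card\<Phi>: "card \<Phi> = n ^ ?m" unfolding \<Phi>_def using V by (simp add: card_PiE)
  have pw: "real n ^ (?m - 1) = real n ^ ?m / real n" if "v \<in> V" for v
    using that V n by (cases ?m) auto
  have cnt: "(\<Sum>\<psi>\<in>\<Phi>. of_bool (R \<psi>)) \<le> real n ^ ?m / real n"
    if v: "v \<in> V" and "\<And>\<phi> \<psi>. R \<phi> \<Longrightarrow> R \<psi> \<Longrightarrow> (\<And>w. w \<in> V - {v} \<Longrightarrow> \<phi> w = \<psi> w) \<Longrightarrow> \<phi> v = \<psi> v" for R v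
  proof -
    have "card {\<psi>\<in>\<Phi>. R \<psi>} \<le> n ^ (?m - 1)"
      by (rule card_functions_determined[OF V v]) (use that(2) in \<open>auto simp: \<Phi>_def\<close>)
    then have "real (card {\<psi>\<in>\<Phi>. R \<psi>}) \<le> real n ^ (?m - 1)" by (metis of_nat_le_iff of_nat_power)
    moreover have "(\<Sum>\<psi>\<in>\<Phi>. of_bool (R \<psi>)) = real (card {\<psi>\<in>\<Phi>. R \<psi>})"
      using fin by (simp add: Int_def)
    ultimately show ?thesis unfolding pw[OF v] by simp
  qed
  have "(\<Sum>\<phi>\<in>\<Phi>. \<Sum>\<psi>\<in>\<Phi>. of_bool (\<not> (inj_on \<phi> V \<and> inj_on \<psi> V \<and> \<phi> ` V \<inter> \<psi> ` V = {})))
      \<le> (\<Sum>\<phi>\<in>\<Phi>. \<Sum>\<psi>\<in>\<Phi>. \<Sum>u\<in>V. \<Sum>v\<in>V. of_bool (u \<noteq> v \<and> \<phi> u = \<phi> v) + of_bool (u \<noteq> v \<and> \<psi> u = \<psi> v) + (of_bool (\<phi> u = \<psi> v) :: real))"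
  proof (intro sum_mono)
    fix \<phi> \<psi> :: "'v \<Rightarrow> nat"
    let ?b = "\<lambda>u v. of_bool (u \<noteq> v \<and> \<phi> u = \<phi> v) + of_bool (u \<noteq> v \<and> \<psi> u = \<psi> v) + (of_bool (\<phi> u = \<psi> v) :: real)"
    show "of_bool (\<not> (inj_on \<phi> V \<and> inj_on \<psi> V \<and> \<phi> ` V \<inter> \<psi> ` V = {})) \<le> (\<Sum>u\<in>V. \<Sum>v\<in>V. ?b u v)"
    proof (cases "inj_on \<phi> V \<and> inj_on \<psi> V \<and> \<phi> ` V \<inter> \<psi> ` V = {}")
      case True
      have "0 \<le> (\<Sum>u\<in>V. \<Sum>v\<in>V. ?b u v)" by (intro sum_nonneg) auto
      then show ?thesis using True by simp
    next
      case False
      then have "\<exists>u\<in>V. \<exists>v\<in>V. (u \<noteq> v \<and> \<phi> u = \<phi> v) \<or> (u \<noteq> v \<and> \<psi> u = \<psi> v) \<or> \<phi> u = \<psi> v"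
        unfolding inj_on_def by blast
      then obtain u v where uv: "u \<in> V" "v \<in> V" "1 \<le> ?b u v" by fastforce
      have "?b u v \<le> (\<Sum>v\<in>V. ?b u v)" using uv V by (intro member_le_sum) auto
      also have "\<dots> \<le> (\<Sum>u\<in>V. \<Sum>v\<in>V. ?b u v)"
        using uv V by (intro member_le_sum[of u V "\<lambda>u. \<Sum>v\<in>V. ?b u v"] sum_nonneg) auto
      finally show ?thesis using uv(3) False by simp
    qed
  qed
  also have "\<dots> = (\<Sum>u\<in>V. \<Sum>v\<in>V. \<Sum>\<phi>\<in>\<Phi>. \<Sum>\<psi>\<in>\<Phi>. of_bool (u \<noteq> v \<and> \<phi> u = \<phi> v) + of_bool (u \<noteq> v \<and> \<psi> u = \<psi> v) + (of_bool (\<phi> u = \<psi> v) :: real))"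
    (is "(\<Sum>\<phi>\<in>\<Phi>. \<Sum>\<psi>\<in>\<Phi>. \<Sum>u\<in>V. \<Sum>v\<in>V. ?c \<phi> \<psi> u v) = _")
  proof -
    have "(\<Sum>\<phi>\<in>\<Phi>. \<Sum>\<psi>\<in>\<Phi>. \<Sum>u\<in>V. \<Sum>v\<in>V. ?c \<phi> \<psi> u v) = (\<Sum>\<phi>\<in>\<Phi>. \<Sum>u\<in>V. \<Sum>v\<in>V. \<Sum>\<psi>\<in>\<Phi>. ?c \<phi> \<psi> u v)"
    proof (rule sum.cong[OF refl])
      fix \<phi>
      have "(\<Sum>\<psi>\<in>\<Phi>. \<Sum>u\<in>V. \<Sum>v\<in>V. ?c \<phi> \<psi> u v) = (\<Sum>u\<in>V. \<Sum>\<psi>\<in>\<Phi>. \<Sum>v\<in>V. ?c \<phi> \<psi> u v)" by (rule sum.swap)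
      also have "\<dots> = (\<Sum>u\<in>V. \<Sum>v\<in>V. \<Sum>\<psi>\<in>\<Phi>. ?c \<phi> \<psi> u v)" by (intro sum.cong refl sum.swap)
      finally show "(\<Sum>\<psi>\<in>\<Phi>. \<Sum>u\<in>V. \<Sum>v\<in>V. ?c \<phi> \<psi> u v) = (\<Sum>u\<in>V. \<Sum>v\<in>V. \<Sum>\<psi>\<in>\<Phi>. ?c \<phi> \<psi> u v)" .
    qed
    also have "\<dots> = (\<Sum>u\<in>V. \<Sum>\<phi>\<in>\<Phi>. \<Sum>v\<in>V. \<Sum>\<psi>\<in>\<Phi>. ?c \<phi> \<psi> u v)" by (rule sum.swap)
    also have "\<dots> = (\<Sum>u\<in>V. \<Sum>v\<in>V. \<Sum>\<phi>\<in>\<Phi>. \<Sum>\<psi>\<in>\<Phi>. ?c \<phi> \<psi> u v)" by (intro sum.cong refl sum.swap)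
    finally show ?thesis .
  qed
  also have "\<dots> \<le> (\<Sum>u\<in>V. \<Sum>v\<in>V. 3 * (real n ^ ?m * (real n ^ ?m / real n)))"
  proof (intro sum_mono)
    fix u v assume uv: "u \<in> V" "v \<in> V"
    have c: "real (card \<Phi>) = real n ^ ?m" using card\<Phi> by simp
    have inj: "(\<Sum>\<psi>\<in>\<Phi>. of_bool (u \<noteq> v \<and> \<psi> u = \<psi> v)) \<le> real n ^ ?m / real n"
    proof (cases "u = v")
      case True then show ?thesis by simp
    next
      case False
      have "(\<Sum>\<psi>\<in>\<Phi>. of_bool (\<psi> u = \<psi> v)) \<le> real n ^ ?m / real n"
      proof (rule cnt[OF uv(2)])
        fix \<phi> \<psi> assume h: "\<phi> u = \<phi> v" "\<psi> u = \<psi> v" "\<And>w. w \<in> V - {v} \<Longrightarrow> \<phi> w = \<psi> w"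
        have "\<phi> u = \<psi> u" using h(3)[of u] uv(1) False by auto
        then show "\<phi> v = \<psi> v" using h by simp
      qed
      then show ?thesis using False by simp
    qed
    have 1: "(\<Sum>\<phi>\<in>\<Phi>. \<Sum>\<psi>\<in>\<Phi>. of_bool (u \<noteq> v \<and> \<phi> u = \<phi> v)) \<le> real n ^ ?m * (real n ^ ?m / real n)"
    proof -
      have "(\<Sum>\<phi>\<in>\<Phi>. \<Sum>\<psi>\<in>\<Phi>. of_bool (u \<noteq> v \<and> \<phi> u = \<phi> v)) = real (card \<Phi>) * (\<Sum>\<phi>\<in>\<Phi>. of_bool (u \<noteq> v \<and> \<phi> u = \<phi> v))"
        by (simp only: sum_constant sum_distrib_left[symmetric])
      then show ?thesis using inj unfolding c by (simp only:) (intro mult_left_mono, auto)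
    qed
    have 2: "(\<Sum>\<phi>\<in>\<Phi>. \<Sum>\<psi>\<in>\<Phi>. of_bool (u \<noteq> v \<and> \<psi> u = \<psi> v)) \<le> real n ^ ?m * (real n ^ ?m / real n)"
    proof -
      have "(\<Sum>\<phi>\<in>\<Phi>. \<Sum>\<psi>\<in>\<Phi>. of_bool (u \<noteq> v \<and> \<psi> u = \<psi> v)) = real (card \<Phi>) * (\<Sum>\<psi>\<in>\<Phi>. of_bool (u \<noteq> v \<and> \<psi> u = \<psi> v))"
        by (simp only: sum_constant)
      then show ?thesis using inj unfolding c by (simp only:) (intro mult_left_mono, auto)
    qed
    have 3: "(\<Sum>\<phi>\<in>\<Phi>. \<Sum>\<psi>\<in>\<Phi>. of_bool (\<phi> u = \<psi> v)) \<le> real n ^ ?m * (real n ^ ?m / real n)"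
    proof -
      have "(\<Sum>\<phi>\<in>\<Phi>. \<Sum>\<psi>\<in>\<Phi>. of_bool (\<phi> u = \<psi> v)) \<le> (\<Sum>\<phi>\<in>\<Phi>. real n ^ ?m / real n)"
        by (intro sum_mono cnt[OF uv(2)]) simp
      then show ?thesis by (simp only: sum_constant c)
    qed
    show "(\<Sum>\<phi>\<in>\<Phi>. \<Sum>\<psi>\<in>\<Phi>. of_bool (u \<noteq> v \<and> \<phi> u = \<phi> v) + of_bool (u \<noteq> v \<and> \<psi> u = \<psi> v) + of_bool (\<phi> u = \<psi> v))
        \<le> 3 * (real n ^ ?m * (real n ^ ?m / real n))"
      using 1 2 3 unfolding sum.distrib by linarith
  qed
  also have "\<dots> = 3 * (real ?m)\<^sup>2 / real n * (real n ^ ?m * real n ^ ?m)"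
    by (simp add: power2_eq_square)
  finally show ?thesis .
qed

context random_graph begin

lemma hom_density01: assumes P: "simple_graph P" shows "0 \<le> hom_density P W \<and> hom_density P W \<le> 1"
proof -
  interpret VP: prob_space "\<Pi>\<^sub>M v\<in>verts P. I01" by (rule prob_space_PiM) (rule prob_space_I01)
  have 1: "0 \<le> hom_prod P W x \<and> hom_prod P W x \<le> 1" for x
    unfolding hom_prod_def using W01 by (auto intro!: prod_nonneg prod_le_1)
  have "hom_density P W = (\<integral>x. hom_prod P W x \<partial>(\<Pi>\<^sub>M v\<in>verts P. I01))"
    by (rule hom_density_version[OF P W]) simp
  moreover have "(\<integral>x. hom_prod P W x \<partial>(\<Pi>\<^sub>M v\<in>verts P. I01)) \<le> 1"
  proof (rule VP.integral_le_const)
    show "integrable (\<Pi>\<^sub>M v\<in>verts P. I01) (hom_prod P W)"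
      using 1 borel_measurable_hom_prod[OF P W] by (intro VP.integrable_const_bound[where B=1]) auto
  qed (use 1 in auto)
  ultimately show ?thesis using 1 by (auto intro!: Bochner_Integration.integral_nonneg)
qed

text \<open>The mean square deviation is an average over pairs of maps \<open>\<phi>\<close>,
  \<open>\<psi>\<close> of the covariance of two copies of \<open>P\<close>. By
  \<open>law_two_embeddings\<close> it vanishes if \<open>\<phi>\<close> and
  \<open>\<psi>\<close> are injective with disjoint ranges, and the other pairs are a fraction
  \<open>O(1/n)\<close> of all pairs.\<close>

lemma second_moment:
  assumes P: "simple_graph P"
  shows "(\<Sum>X\<in>Pow (all_edges n). law X * (matrix_density P n (adjacency X) - hom_density P W)\<^sup>2)
    \<le> 3 * (real (card (verts P)))\<^sup>2 / real n"
proof -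
  let ?V = "verts P" and ?E = "all_edges n" and ?\<tau> = "hom_density P W"
  let ?\<Phi> = "?V \<rightarrow>\<^sub>E {1..n}" and ?m = "card (verts P)"
  note V = simple_graph_finite(1)[OF P]
  define b where "b \<phi> X = (if (`) \<phi> ` edges P \<subseteq> X then 1 else 0 :: real)" for \<phi> :: "'a \<Rightarrow> nat" and X
  define Q where "Q \<phi> \<psi> = (\<Sum>X\<in>Pow ?E. law X * ((b \<phi> X - ?\<tau>) * (b \<psi> X - ?\<tau>)))" for \<phi> \<psi>
  have card\<Phi>: "real (card ?\<Phi>) = real n ^ ?m" using V by (simp add: card_PiE)
  have npos: "0 < real n ^ ?m" using n by simp
  have dens: "matrix_density P n (adjacency X) - ?\<tau> = (\<Sum>\<phi>\<in>?\<Phi>. b \<phi> X - ?\<tau>) / real n ^ ?m" for X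
    unfolding matrix_density_def adjacency_prod[OF P] sum_subtractf b_def using card\<Phi> npos
    by (simp add: field_simps)
  have "(\<Sum>X\<in>Pow ?E. law X * (matrix_density P n (adjacency X) - ?\<tau>)\<^sup>2)
      = (\<Sum>X\<in>Pow ?E. \<Sum>\<phi>\<in>?\<Phi>. \<Sum>\<psi>\<in>?\<Phi>. law X * ((b \<phi> X - ?\<tau>) * (b \<psi> X - ?\<tau>)) / (real n ^ ?m * real n ^ ?m))"
  proof (rule sum.cong[OF refl])
    fix X
    have "law X * (matrix_density P n (adjacency X) - ?\<tau>)\<^sup>2
        = law X / (real n ^ ?m * real n ^ ?m) * ((\<Sum>\<phi>\<in>?\<Phi>. b \<phi> X - ?\<tau>) * (\<Sum>\<psi>\<in>?\<Phi>. b \<psi> X - ?\<tau>))"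
      unfolding dens by (simp add: power2_eq_square)
    also have "\<dots> = (\<Sum>\<phi>\<in>?\<Phi>. \<Sum>\<psi>\<in>?\<Phi>. law X * ((b \<phi> X - ?\<tau>) * (b \<psi> X - ?\<tau>)) / (real n ^ ?m * real n ^ ?m))"
      by (subst sum_product, subst sum_distrib_left, intro sum.cong refl, subst sum_distrib_left, intro sum.cong refl, simp)
    finally show "law X * (matrix_density P n (adjacency X) - ?\<tau>)\<^sup>2
      = (\<Sum>\<phi>\<in>?\<Phi>. \<Sum>\<psi>\<in>?\<Phi>. law X * ((b \<phi> X - ?\<tau>) * (b \<psi> X - ?\<tau>)) / (real n ^ ?m * real n ^ ?m))" .
  qed
  also have "\<dots> = (\<Sum>\<phi>\<in>?\<Phi>. \<Sum>\<psi>\<in>?\<Phi>. \<Sum>X\<in>Pow ?E. law X * ((b \<phi> X - ?\<tau>) * (b \<psi> X - ?\<tau>)) / (real n ^ ?m * real n ^ ?m))"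
    by (subst sum.swap) (intro sum.cong refl sum.swap)
  also have "\<dots> = (\<Sum>\<phi>\<in>?\<Phi>. \<Sum>\<psi>\<in>?\<Phi>. Q \<phi> \<psi>) / (real n ^ ?m * real n ^ ?m)"
    by (simp add: Q_def sum_divide_distrib)
  also have "\<dots> \<le> (3 * (real ?m)\<^sup>2 / real n * (real n ^ ?m * real n ^ ?m)) / (real n ^ ?m * real n ^ ?m)"
  proof (intro divide_right_mono)
    have "(\<Sum>\<phi>\<in>?\<Phi>. \<Sum>\<psi>\<in>?\<Phi>. Q \<phi> \<psi>)
       \<le> (\<Sum>\<phi>\<in>?\<Phi>. \<Sum>\<psi>\<in>?\<Phi>. of_bool (\<not> (inj_on \<phi> ?V \<and> inj_on \<psi> ?V \<and> \<phi> ` ?V \<inter> \<psi> ` ?V = {})))"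
    proof (intro sum_mono)
      fix \<phi> \<psi> assume \<phi>\<psi>: "\<phi> \<in> ?\<Phi>" "\<psi> \<in> ?\<Phi>"
      show "Q \<phi> \<psi> \<le> of_bool (\<not> (inj_on \<phi> ?V \<and> inj_on \<psi> ?V \<and> \<phi> ` ?V \<inter> \<psi> ` ?V = {}))"
      proof (cases "inj_on \<phi> ?V \<and> inj_on \<psi> ?V \<and> \<phi> ` ?V \<inter> \<psi> ` ?V = {}")
        case True
        have im: "\<phi> ` ?V \<subseteq> {1..n}" "\<psi> ` ?V \<subseteq> {1..n}" using \<phi>\<psi> by auto
        have "Q \<phi> \<psi> = (\<Sum>X\<in>Pow ?E. law X * (b \<phi> X * b \<psi> X)) - ?\<tau> * (\<Sum>X\<in>Pow ?E. law X * b \<phi> X)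
            - ?\<tau> * (\<Sum>X\<in>Pow ?E. law X * b \<psi> X) + ?\<tau>\<^sup>2 * (\<Sum>X\<in>Pow ?E. law X)"
          unfolding Q_def by (simp add: algebra_simps sum.distrib sum_subtractf sum_distrib_left power2_eq_square)
        also have "\<dots> = 0"
          using law_two_embeddings[OF P _ im(1) _ im(2)] law_embedding[OF P _ im(1)] law_embedding[OF P _ im(2)] True
          unfolding b_def sum_law by (simp add: power2_eq_square)
        finally show ?thesis by simp
      next
        case False
        have "Q \<phi> \<psi> \<le> (\<Sum>X\<in>Pow ?E. law X * 1)"
          unfolding Q_def
        proof (intro sum_mono mult_left_mono law_nonneg)
          fix X
          have "\<bar>b \<phi> X - ?\<tau>\<bar> \<le> 1" "\<bar>b \<psi> X - ?\<tau>\<bar> \<le> 1" using hom_density01[OF P] by (auto simp: b_def)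
          then have "\<bar>(b \<phi> X - ?\<tau>) * (b \<psi> X - ?\<tau>)\<bar> \<le> 1" unfolding abs_mult by (intro mult_le_one) auto
          then show "(b \<phi> X - ?\<tau>) * (b \<psi> X - ?\<tau>) \<le> 1" by linarith
        qed auto
        then show ?thesis using sum_law False by simp
      qed
    qed
    also have "\<dots> \<le> 3 * (real ?m)\<^sup>2 / real n * (real n ^ ?m * real n ^ ?m)" by (rule count_bad_pairs[OF V n])
    finally show "(\<Sum>\<phi>\<in>?\<Phi>. \<Sum>\<psi>\<in>?\<Phi>. Q \<phi> \<psi>) \<le> 3 * (real ?m)\<^sup>2 / real n * (real n ^ ?m * real n ^ ?m)" .
  qed simp
  also have "\<dots> = 3 * (real ?m)\<^sup>2 / real n" using npos by simp
  finally show ?thesis .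
qed

text \<open>The entropy bound for fixed sample points, integrated over the sample points: each of the
  \<open>n (n - 1) / 2\<close> potential edges contributes \<open>2 \<integral> H (W)\<close>.\<close>

lemma entropy_le_ln_card:
  assumes A: "\<A> \<subseteq> Pow (all_edges n)"
  defines "r \<equiv> (\<Sum>X\<in>\<A>. law X)"
  shows "real n * (real n - 1) * (\<integral>z. H (W (fst z) (snd z)) \<partial>I01sq)
    \<le> r * ln (real (card \<A>)) + (1 - r) * (real n * (real n - 1) / 2 * ln 2) + ln 2"
proof -
  let ?E = "all_edges n" and ?c = "ln (real (card \<A>))" and ?d = "real (card (all_edges n)) * ln 2"
  have bm: "binary_entropy \<in> borel_measurable borel" unfolding binary_entropy_def[abs_def] by measurable
  have bi: "integrable sample_space (\<lambda>x. binary_entropy (edge_prob x e))" if "e \<in> ?E" for e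
    using edge_prob01 binary_entropy_bounds measurable_compose[OF edge_prob_measurable[OF that] bm]
    by (intro S.integrable_const_bound[where B=2]) auto
  have ri: "integrable sample_space (\<lambda>x. \<Sum>X\<in>\<A>. edge_weight ?E (edge_prob x) X)"
    using A by (intro Bochner_Integration.integrable_sum edge_weight_integrable) auto
  have r: "(\<integral>x. (\<Sum>X\<in>\<A>. edge_weight ?E (edge_prob x) X) \<partial>sample_space) = r"
    unfolding r_def law_def using A by (intro Bochner_Integration.integral_sum edge_weight_integrable) auto
  have be: "(\<integral>x. binary_entropy (edge_prob x e) \<partial>sample_space) = 2 * (\<integral>z. H (W (fst z) (snd z)) \<partial>I01sq)" if e: "e \<in> ?E" for e
  proof -
    have m: "(\<lambda>x. (x (src e), x (tgt e))) \<in> sample_space \<rightarrow>\<^sub>M I01sq" using all_edges_ends[OF e] by simp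
    have W': "(\<lambda>z. H (W (fst z) (snd z))) \<in> borel_measurable I01sq"
      using measurable_compose[OF W H_measurable] by (simp add: case_prod_beta)
    have "(\<integral>z. H (W (fst z) (snd z)) \<partial>I01sq)
        = (\<integral>z. H (W (fst z) (snd z)) \<partial>distr sample_space I01sq (\<lambda>x. (x (src e), x (tgt e))))"
      using all_edges_ends[OF e] by (subst distr_PiM_pair) auto
    also have "\<dots> = (\<integral>x. H (edge_prob x e) \<partial>sample_space)" by (subst integral_distr[OF m W']) (simp add: edge_prob_def)
    finally show ?thesis by (simp add: binary_entropy_eq_H)
  qed
  have "real n * (real n - 1) * (\<integral>z. H (W (fst z) (snd z)) \<partial>I01sq)
      = (\<Sum>e\<in>?E. \<integral>x. binary_entropy (edge_prob x e) \<partial>sample_space)"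
  proof -
    have "(\<Sum>e\<in>?E. \<integral>x. binary_entropy (edge_prob x e) \<partial>sample_space) = (\<Sum>e\<in>?E. 2 * (\<integral>z. H (W (fst z) (snd z)) \<partial>I01sq))"
      by (intro sum.cong refl be)
    then show ?thesis by (simp add: card_all_edges)
  qed
  also have "\<dots> = (\<integral>x. (\<Sum>e\<in>?E. binary_entropy (edge_prob x e)) \<partial>sample_space)"
    by (intro Bochner_Integration.integral_sum[symmetric] bi)
  also have "\<dots> \<le> (\<integral>x. (\<Sum>X\<in>\<A>. edge_weight ?E (edge_prob x) X) * ?c + (1 - (\<Sum>X\<in>\<A>. edge_weight ?E (edge_prob x) X)) * ?d + ln 2 \<partial>sample_space)"
  proof (intro integral_mono)
    show "integrable sample_space (\<lambda>x. \<Sum>e\<in>?E. binary_entropy (edge_prob x e))"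
      by (intro Bochner_Integration.integrable_sum bi)
    show "integrable sample_space (\<lambda>x. (\<Sum>X\<in>\<A>. edge_weight ?E (edge_prob x) X) * ?c + (1 - (\<Sum>X\<in>\<A>. edge_weight ?E (edge_prob x) X)) * ?d + ln 2)"
      by (intro Bochner_Integration.integrable_add Bochner_Integration.integrable_diff integrable_mult_left ri S.integrable_const)
    show "(\<Sum>e\<in>?E. binary_entropy (edge_prob x e)) \<le> (\<Sum>X\<in>\<A>. edge_weight ?E (edge_prob x) X) * ?c + (1 - (\<Sum>X\<in>\<A>. edge_weight ?E (edge_prob x) X)) * ?d + ln 2" for x
      using edge_prob01 by (intro binary_entropy_sum_le_ln_card finite_all_edges A) auto
  qed
  also have "\<dots> = (\<integral>x. (\<Sum>X\<in>\<A>. edge_weight ?E (edge_prob x) X) * (?c - ?d) + (?d + ln 2) \<partial>sample_space)"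
    by (intro Bochner_Integration.integral_cong refl) (simp add: algebra_simps)
  also have "\<dots> = r * (?c - ?d) + (?d + ln 2)"
    unfolding Bochner_Integration.integral_add[OF integrable_mult_left[OF ri] S.integrable_const]
      integral_mult_left_zero r lebesgue_integral_const S.prob_space by simp
  also have "\<dots> = r * ?c + (1 - r) * ?d + ln 2" by (simp add: algebra_simps)
  finally show ?thesis by (simp add: card_all_edges)
qed

end

text \<open>By Chebyshev's inequality and \<open>second_moment\<close>, the random graph sampled from a
  Borel version of \<open>g\<close> misses the prescribed densities with probability at most
  \<open>C / n\<close>. Then \<open>entropy_le_ln_card\<close> bounds its entropy, which is
  \<open>n (n - 1) S\<close>, by the logarithm of the number of graphs with the right densities,
  up to \<open>O(n)\<close>.\<close>

lemma shannon_entropy_le_liminf: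
  assumes P: "\<And>i. i \<in> {1..k} \<Longrightarrow> simple_graph (P i)" and g: "g \<in> graphons_with k P t" and \<delta>: "\<delta> > 0"
  shows "ereal (shannon_entropy g) \<le> liminf (log_Z_rate k P t \<delta>)"
proof -
  have gg: "graphon g" and gt: "\<And>i. i \<in> {1..k} \<Longrightarrow> hom_density (P i) g = t i" using g by (auto simp: graphons_with_def)
  obtain W where W: "(\<lambda>(x,y). W x y) \<in> borel_measurable borel" "\<And>x y. 0 \<le> W x y" "\<And>x y. W x y \<le> 1"
    "\<And>x y. W x y = W y x" "AE z in I01sq. g (fst z) (snd z) = W (fst z) (snd z)"
    using graphon_borel_version[OF gg] by blast
  have Wm: "(\<lambda>(x,y). W x y) \<in> borel_measurable I01sq"
    unfolding I01_pair_eq by (rule measurable_restrict_space1) (use W(1) in simp)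
  define S where "S = (\<integral>z. H (W (fst z) (snd z)) \<partial>I01sq)"
  have S: "shannon_entropy g = S"
    unfolding S_def using shannon_entropy_version[OF Wm _ W(5)] gg by (simp add: graphon_def)
  have Wt: "hom_density (P i) W = t i" if "i \<in> {1..k}" for i
    using hom_density_version[OF P[OF that] Wm W(5)] hom_density_version[OF P[OF that] Wm, of W] gt[OF that] by simp
  define C where "C = (\<Sum>i\<in>{1..k}. 3 * (real (card (verts (P i))))\<^sup>2) / \<delta>\<^sup>2"
  \<comment> \<open>The lower bound for the rate at \<open>n\<close>, which tends to \<open>S\<close>: the terms
    with \<open>C\<close> come from the probability of bad densities, the last one from the
    additional \<open>ln 2\<close> in the entropy bound.\<close>
  define a where "a n = S - S * (1 / real n) - C * ln 2 / 2 * (1 / real n) + C * ln 2 / 2 * (1 / real n) * (1 / real n) - ln 2 * (1 / real n) * (1 / real n)" for n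
  have main: "ereal (a n) \<le> log_Z_rate k P t \<delta> n" if nC: "n > 0" "real n > C" for n
  proof -
    interpret random_graph W n by unfold_locales (use Wm W nC in auto)
    let ?E = "all_edges n" and ?A = "good_edge_sets k P t n \<delta>"
    define r where "r = (\<Sum>X\<in>?A. law X)"
    have A: "?A \<subseteq> Pow ?E" by (auto simp: good_edge_sets_def)
    let ?d = "\<lambda>i X. (matrix_density (P i) n (adjacency X) - t i)\<^sup>2 / \<delta>\<^sup>2"
    have "1 - r = (\<Sum>X\<in>Pow ?E - ?A. law X * 1)"
      using sum.subset_diff[OF A, of law] finite_all_edges sum_law by (simp add: r_def)
    also have "\<dots> \<le> (\<Sum>X\<in>Pow ?E - ?A. law X * (\<Sum>i\<in>{1..k}. ?d i X))"
    proof (intro sum_mono mult_left_mono law_nonneg)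
      fix X assume X: "X \<in> Pow ?E - ?A"
      then obtain i where i: "i \<in> {1..k}" "\<delta> \<le> \<bar>matrix_density (P i) n (adjacency X) - t i\<bar>"
        by (auto simp: good_edge_sets_def not_less)
      then have "\<delta>\<^sup>2 \<le> \<bar>matrix_density (P i) n (adjacency X) - t i\<bar>\<^sup>2" using \<delta> by (intro power_mono) auto
      then have "1 \<le> ?d i X" using \<delta> by simp
      also have "\<dots> \<le> (\<Sum>i\<in>{1..k}. ?d i X)" using i by (intro member_le_sum) auto
      finally show "1 \<le> (\<Sum>i\<in>{1..k}. ?d i X)" .
    qed auto
    also have "\<dots> \<le> (\<Sum>X\<in>Pow ?E. law X * (\<Sum>i\<in>{1..k}. ?d i X))"
      using finite_all_edges law_nonneg by (intro sum_mono2) (auto intro!: mult_nonneg_nonneg sum_nonneg)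
    also have "\<dots> = (\<Sum>i\<in>{1..k}. (\<Sum>X\<in>Pow ?E. law X * (matrix_density (P i) n (adjacency X) - t i)\<^sup>2) / \<delta>\<^sup>2)"
      by (simp add: sum_distrib_left sum_divide_distrib) (rule sum.swap)
    also have "\<dots> \<le> (\<Sum>i\<in>{1..k}. (3 * (real (card (verts (P i))))\<^sup>2 / real n) / \<delta>\<^sup>2)"
      using second_moment[OF P] Wt by (intro sum_mono divide_right_mono) auto
    also have "\<dots> = C / real n" by (simp add: C_def sum_divide_distrib[symmetric])
    finally have r: "1 - r \<le> C / real n" .
    have "C / real n < 1" using nC by simp
    then have "0 < r" using r by linarith
    then have "?A \<noteq> {}" by (auto simp: r_def)
    then have cA: "1 \<le> real (card ?A)" using finite_good_edge_sets[of k P t n \<delta>] by (simp add: Suc_le_eq card_gt_0_iff)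
    have "r \<le> (\<Sum>X\<in>Pow ?E. law X)"
      unfolding r_def using finite_all_edges A law_nonneg by (intro sum_mono2) auto
    then have "r * ln (real (card ?A)) \<le> ln (real (card ?A))"
      using cA sum_law by (intro mult_left_le_one_le) (auto simp: \<open>0 < r\<close> less_imp_le)
    moreover have "(1 - r) * (real n * (real n - 1) / 2 * ln 2) \<le> C / real n * (real n * (real n - 1) / 2 * ln 2)"
      using r n by (intro mult_right_mono) auto
    ultimately have "real n * (real n - 1) * S \<le> ln (real (card ?A)) + C / real n * (real n * (real n - 1) / 2 * ln 2) + ln 2"
      using entropy_le_ln_card[OF A] unfolding S_def r_def by linarith
    moreover have "a n * (real n)\<^sup>2 = real n * (real n - 1) * S - C / real n * (real n * (real n - 1) / 2 * ln 2) - ln 2"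
      using n by (simp add: a_def field_simps power2_eq_square)
    ultimately have "a n * (real n)\<^sup>2 \<le> ln (real (card ?A))" by linarith
    then have "a n \<le> ln (real (card ?A)) / (real n)\<^sup>2" using n by (simp add: pos_le_divide_eq)
    then show ?thesis using Z_eq_card[OF P nC(1)] cA by (simp add: log_Z_rate_def)
  qed
  obtain N :: nat where N: "C < real N" using reals_Archimedean2 by blast
  have ev: "eventually (\<lambda>n. ereal (a n) \<le> log_Z_rate k P t \<delta> n) sequentially"
    using eventually_ge_at_top[of "Suc N"]
  proof eventually_elim
    case (elim n)
    then have "n > 0" "real N \<le> real n" by auto
    moreover from this N have "C < real n" by linarith
    ultimately show ?case using main by blast
  qed
  have "a \<longlonglongrightarrow> S"
    unfolding a_def[abs_def] by (rule tendsto_eq_intros lim_1_over_n refl | simp)+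
  then have "(\<lambda>n. ereal (a n)) \<longlonglongrightarrow> ereal S" by simp
  then have "liminf (\<lambda>n. ereal (a n)) = ereal S" by (intro lim_imp_Liminf) auto
  with Liminf_mono[OF ev] show ?thesis by (simp add: S)
qed

section \<open>Weak limits of kernels\<close>

text \<open>A sequence in a compact product space has a cluster point, hence converges to it along a filter
  finer than \<open>sequentially\<close>. All coordinates converge along the same filter,
  however many there are; in general no subsequence does this for uncountably many coordinates.\<close>

lemma common_cluster_filter:
  fixes X :: "nat \<Rightarrow> 'i \<Rightarrow> real"
  assumes X: "\<And>m i. \<bar>X m i\<bar> \<le> 1"
  obtains F x where "F \<noteq> bot" "F \<le> sequentially" "\<And>i. ((\<lambda>m. X m i) \<longlongrightarrow> x i) F"
proof -
  let ?K = "UNIV \<rightarrow>\<^sub>E {-1..1::real} :: ('i \<Rightarrow> real) set"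
  have "compactin (product_topology (\<lambda>_. euclidean) UNIV) ?K"
    by (subst compactin_PiE) (simp add: compactin_euclidean_iff)
  then have K: "compact ?K" by (simp add: euclidean_product_topology compactin_euclidean_iff)
  have "X m \<in> ?K" for m using X[of m] by (auto simp: PiE_iff abs_le_iff minus_le_iff)
  then have "eventually (\<lambda>y. y \<in> ?K) (filtermap X sequentially)" by (simp add: eventually_filtermap)
  moreover have "filtermap X sequentially \<noteq> bot" by (simp add: filtermap_bot_iff)
  ultimately obtain x where x: "inf (nhds x) (filtermap X sequentially) \<noteq> bot"
    using K unfolding compact_filter by blast
  define F where "F = inf (filtercomap X (nhds x)) sequentially"
  have "F \<noteq> bot"
  proof
    assume "F = bot"
    then have "eventually (\<lambda>_. False) F" by simp
    then obtain Q R where QR: "eventually Q (filtercomap X (nhds x))" "eventually R sequentially" "\<And>m. Q m \<Longrightarrow> R m \<Longrightarrow> False"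
      unfolding F_def eventually_inf by blast
    obtain P where P: "eventually P (nhds x)" "\<And>m. P (X m) \<Longrightarrow> Q m"
      using QR(1) unfolding eventually_filtercomap by blast
    have "eventually (\<lambda>m. \<not> P (X m)) sequentially" using QR(2) by eventually_elim (use P(2) QR(3) in blast)
    then have "eventually (\<lambda>y. \<not> P y) (filtermap X sequentially)" by (simp add: eventually_filtermap)
    with P(1) have "eventually (\<lambda>_. False) (inf (nhds x) (filtermap X sequentially))"
      unfolding eventually_inf by blast
    with x show False by (simp add: trivial_limit_def)
  qed
  moreover have "F \<le> sequentially" by (simp add: F_def)
  moreover have "((\<lambda>m. X m i) \<longlongrightarrow> x i) F" for i
  proof -
    have "filterlim X (nhds x) (filtercomap X (nhds x))" by (rule filterlim_filtercomap)
    then have lim: "(X \<longlongrightarrow> x) F" by (rule filterlim_mono) (auto simp: F_def)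
    show ?thesis
    proof (rule topological_tendstoI)
      fix S assume S: "open S" "x i \<in> S"
      have "open ((\<lambda>f. f i) -` S)"
        using continuous_on_product_coordinates S(1) by (rule open_vimage[rotated])
      from topological_tendstoD[OF lim this] S(2) show "eventually (\<lambda>m. X m i \<in> S) F" by simp
    qed
  qed
  ultimately show ?thesis by (rule that)
qed

definition kernel :: "(real \<Rightarrow> real \<Rightarrow> real) \<Rightarrow> bool" where
  "kernel W \<longleftrightarrow> (\<lambda>(x,y). W x y) \<in> borel_measurable I01sq \<and> (\<forall>x y. 0 \<le> W x y \<and> W x y \<le> 1) \<and> (\<forall>x y. W x y = W y x)"

lemma kernelD:
  assumes "kernel W"
  shows "(\<lambda>(x,y). W x y) \<in> borel_measurable I01sq" "(\<lambda>z. W (fst z) (snd z)) \<in> borel_measurable I01sq"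
    "\<And>x y. 0 \<le> W x y" "\<And>x y. W x y \<le> 1" "\<And>x y. \<bar>W x y\<bar> \<le> 1" "\<And>x y. W x y = W y x"
  using assms by (auto simp: kernel_def case_prod_beta)

lemma integrable_I01sq:
  fixes f :: "real \<times> real \<Rightarrow> real"
  assumes "f \<in> borel_measurable I01sq" "\<And>z. \<bar>f z\<bar> \<le> B"
  shows "integrable I01sq f"
  using assms by (intro I01_pair.integrable_const_bound[where B=B]) auto

lemma integrable_kernel:
  assumes "kernel W" "f \<in> borel_measurable I01sq" "\<And>z. \<bar>f z\<bar> \<le> B"
  shows "integrable I01sq (\<lambda>z. f z * W (fst z) (snd z))"
proof (rule integrable_I01sq)
  show "(\<lambda>z. f z * W (fst z) (snd z)) \<in> borel_measurable I01sq"
    using assms(2) kernelD(2)[OF assms(1)] by simp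
  have "0 \<le> B" using assms(3)[of undefined] by linarith
  then show "\<bar>f z * W (fst z) (snd z)\<bar> \<le> B" for z
    using mult_mono[OF assms(3)[of z] kernelD(5)[OF assms(1), of "fst z" "snd z"]] by (simp add: abs_mult)
qed

text \<open>The limit \<open>\<nu>\<close> of the set functions is additive and dominated by the measure of
  the square, and this domination makes it countably additive. Its density lies between
  \<open>0\<close> and \<open>1\<close> almost everywhere; averaging it with its reflection
  makes it symmetric without changing \<open>\<nu>\<close>, which is symmetric itself.\<close>

lemma kernel_of_set_limit:
  fixes W :: "nat \<Rightarrow> real \<Rightarrow> real \<Rightarrow> real"
  assumes W: "\<And>m. kernel (W m)" and F: "F \<noteq> bot"
    and lim: "\<And>A. A \<in> sets I01sq \<Longrightarrow> ((\<lambda>m. \<integral>z. indicator A z * W m (fst z) (snd z) \<partial>I01sq) \<longlongrightarrow> \<nu> A) F"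
  obtains g where "kernel g" "\<And>A. A \<in> sets I01sq \<Longrightarrow> (\<integral>z. indicator A z * g (fst z) (snd z) \<partial>I01sq) = \<nu> A"
proof -
  define J where "J m A = (\<integral>z. indicator A z * W m (fst z) (snd z) \<partial>I01sq)" for m and A :: "(real\<times>real) set"
  have int: "integrable I01sq (\<lambda>z. indicator A z * W m (fst z) (snd z))" if "A \<in> sets I01sq" for m A
    using that by (intro integrable_kernel[OF W, where B=1]) (auto simp: indicator_def)
  have lim: "((\<lambda>m. J m A) \<longlongrightarrow> \<nu> A) F" if "A \<in> sets I01sq" for A using lim[OF that] by (simp add: J_def)
  have J0: "0 \<le> J m A" for m A
    unfolding J_def using kernelD(3)[OF W] by (intro Bochner_Integration.integral_nonneg) auto
  have J1: "J m A \<le> measure I01sq A" if A: "A \<in> sets I01sq" for m A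
  proof -
    have "J m A \<le> (\<integral>z. indicator A z \<partial>I01sq)"
      unfolding J_def using kernelD(4)[OF W] A by (intro integral_mono int integrable_I01sq[where B=1]) (auto simp: indicator_def)
    then show ?thesis using A by simp
  qed
  have \<nu>0: "0 \<le> \<nu> A" if "A \<in> sets I01sq" for A
    by (rule tendsto_lowerbound[OF lim[OF that] _ F]) (simp add: J0)
  have \<nu>1: "\<nu> A \<le> measure I01sq A" if "A \<in> sets I01sq" for A
    by (rule tendsto_upperbound[OF lim[OF that] _ F]) (simp add: J1[OF that])
  have \<nu>add: "\<nu> (A \<union> B) = \<nu> A + \<nu> B" if "A \<in> sets I01sq" "B \<in> sets I01sq" "A \<inter> B = {}" for A B
  proof (rule tendsto_unique[OF F])
    show "((\<lambda>m. J m (A \<union> B)) \<longlongrightarrow> \<nu> (A \<union> B)) F" using that by (intro lim) auto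
    have "J m (A \<union> B) = J m A + J m B" for m
    proof -
      have "J m A + J m B = (\<integral>z. indicator A z * W m (fst z) (snd z) + indicator B z * W m (fst z) (snd z) \<partial>I01sq)"
        unfolding J_def using that by (intro Bochner_Integration.integral_add[symmetric] int) auto
      also have "\<dots> = J m (A \<union> B)"
        unfolding J_def using that(3) by (intro Bochner_Integration.integral_cong) (auto simp: indicator_def)
      finally show ?thesis ..
    qed
    then show "((\<lambda>m. J m (A \<union> B)) \<longlongrightarrow> \<nu> A + \<nu> B) F" using tendsto_add[OF lim[OF that(1)] lim[OF that(2)]] by simp
  qed
  define N where "N = measure_of (space I01sq) (sets I01sq) (\<lambda>A. ennreal (\<nu> A))"
  have sN: "sets N = sets I01sq" "space N = space I01sq" by (auto simp: N_def)
  have \<nu>e: "\<nu> {} = 0" using \<nu>0[of "{}"] \<nu>1[of "{}"] by simp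
  have leN: "ennreal (\<nu> A) \<le> emeasure I01sq A" if "A \<in> sets I01sq" for A
    using \<nu>1[OF that] by (simp add: I01_pair.P.emeasure_eq_measure ennreal_leI)
  have pos: "positive (sets I01sq) (\<lambda>A. ennreal (\<nu> A))" using \<nu>e by (simp add: positive_def)
  have "countably_additive (sets I01sq) (\<lambda>A. ennreal (\<nu> A))"
  proof (rule sets.empty_continuous_imp_countably_additive[OF pos])
    show "additive (sets I01sq) (\<lambda>A. ennreal (\<nu> A))"
      unfolding additive_def using \<nu>add \<nu>0 by (simp add: ennreal_plus)
    fix A :: "nat \<Rightarrow> (real\<times>real) set" assume A: "range A \<subseteq> sets I01sq" "decseq A" "(\<Inter>i. A i) = {}"
    have "(\<lambda>i. emeasure I01sq (A i)) \<longlonglongrightarrow> emeasure I01sq (\<Inter>i. A i)"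
      using A by (intro Lim_emeasure_decseq) (auto simp: I01_pair.P.emeasure_eq_measure)
    then have "(\<lambda>i. emeasure I01sq (A i)) \<longlonglongrightarrow> 0" using A(3) by simp
    then show "(\<lambda>i. ennreal (\<nu> (A i))) \<longlonglongrightarrow> 0"
      by (rule tendsto_sandwich[OF always_eventually always_eventually tendsto_const, rotated 2])
         (use A(1) leN in auto)
  qed auto
  then have eN: "emeasure N A = ennreal (\<nu> A)" if "A \<in> sets I01sq" for A
    unfolding N_def using that pos by (intro emeasure_measure_of_sigma) (auto intro: sets.sigma_algebra_axioms)
  have "absolutely_continuous I01sq N"
    unfolding absolutely_continuous_def
  proof
    fix A assume A: "A \<in> null_sets I01sq"
    then have "emeasure N A \<le> 0" using eN[OF null_setsD2[OF A]] leN[OF null_setsD2[OF A]] null_setsD1[OF A] by metis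
    then show "A \<in> null_sets N" using null_setsD2[OF A] sN by (intro null_setsI) auto
  qed
  from I01_pair.Radon_Nikodym[OF this sN(1)] obtain f where f: "f \<in> borel_measurable I01sq" "density I01sq f = N" by blast
  have fA: "(\<integral>\<^sup>+ z. f z * indicator A z \<partial>I01sq) = ennreal (\<nu> A)" if "A \<in> sets I01sq" for A
    using emeasure_density[OF f(1) that] eN[OF that] f(2) by simp
  have f1: "AE z in I01sq. f z \<le> 1"
  proof -
    \<comment> \<open>On \<open>?A\<close> the density exceeds \<open>1\<close>, while the integral over
      \<open>?A\<close> is at most its measure.\<close>
    let ?A = "{z\<in>space I01sq. 1 < f z}"
    have A: "?A \<in> sets I01sq" using f(1) by measurable
    have fin: "(\<integral>\<^sup>+ z. indicator ?A z \<partial>I01sq) \<noteq> \<infinity>" using A by (simp add: I01_pair.P.emeasure_eq_measure)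
    have "(\<integral>\<^sup>+ z. f z * indicator ?A z - indicator ?A z \<partial>I01sq)
        = (\<integral>\<^sup>+ z. f z * indicator ?A z \<partial>I01sq) - (\<integral>\<^sup>+ z. indicator ?A z \<partial>I01sq)"
      using f(1) A fin by (intro nn_integral_diff AE_I2) (auto simp: indicator_def)
    also have "\<dots> = 0" unfolding fA[OF A] using leN[OF A] A by (intro diff_eq_0_ennreal) auto
    finally have "AE z in I01sq. f z * indicator ?A z - indicator ?A z = 0"
      using f(1) A by (subst (asm) nn_integral_0_iff_AE) auto
    moreover have "AE z in I01sq. z \<in> space I01sq" by (rule AE_space)
    ultimately show ?thesis
    proof eventually_elim
      case (elim z)
      show ?case
      proof (rule ccontr)
        assume "\<not> f z \<le> 1"
        then have z: "z \<in> ?A" using elim by auto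
        then have "f z - 1 = 0" using elim(1) by simp
        then show False using \<open>\<not> f z \<le> 1\<close> by (simp add: diff_eq_0_iff_ennreal)
      qed
    qed
  qed
  define g0 where "g0 z = min 1 (enn2real (f z))" for z
  have g0m: "g0 \<in> borel_measurable I01sq" unfolding g0_def[abs_def] using f(1) by measurable
  have g01: "0 \<le> g0 z" "g0 z \<le> 1" for z by (auto simp: g0_def)
  have g0A: "(\<integral>z. indicator A z * g0 z \<partial>I01sq) = \<nu> A" if A: "A \<in> sets I01sq" for A
  proof -
    have "(\<integral>z. indicator A z * g0 z \<partial>I01sq) = enn2real (\<integral>\<^sup>+ z. ennreal (indicator A z * g0 z) \<partial>I01sq)"
      using A g0m g01 by (intro integral_eq_nn_integral) auto
    also have "(\<integral>\<^sup>+ z. ennreal (indicator A z * g0 z) \<partial>I01sq) = (\<integral>\<^sup>+ z. f z * indicator A z \<partial>I01sq)"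
    proof (rule nn_integral_cong_AE)
      show "AE z in I01sq. ennreal (indicator A z * g0 z) = f z * indicator A z"
        using f1
      proof eventually_elim
        case (elim z)
        then have "ennreal (enn2real (f z)) = f z" "enn2real (f z) \<le> 1"
          by (auto simp: top_unique intro!: ennreal_enn2real enn2real_leI order_le_less_trans[OF elim])
        then show ?case by (simp add: g0_def indicator_def)
      qed
    qed
    finally show ?thesis using fA[OF A] \<nu>0[OF A] by simp
  qed
  define g where "g x y = (g0 (x, y) + g0 (y, x)) / 2" for x y
  have swap_m: "(\<lambda>z. g0 (snd z, fst z)) \<in> borel_measurable I01sq"
    using measurable_compose[OF measurable_pair_swap' g0m] by (simp add: case_prod_beta)
  have "kernel g"
    unfolding kernel_def g_def using g0m swap_m g01 
    by (auto simp: case_prod_beta add.commute intro!: order_trans[OF add_mono[OF g01(2) g01(2)]])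
  moreover have "(\<integral>z. indicator A z * g (fst z) (snd z) \<partial>I01sq) = \<nu> A" if A: "A \<in> sets I01sq" for A
  proof -
    let ?B = "(\<lambda>(x,y). (y,x)) -` A \<inter> space I01sq"
    have B: "?B \<in> sets I01sq" using measurable_sets[OF measurable_pair_swap' A] .
    have sw: "(\<integral>z. h z \<partial>I01sq) = (\<integral>z. h (snd z, fst z) \<partial>I01sq)" if "h \<in> borel_measurable I01sq" for h :: "real\<times>real \<Rightarrow> real"
      using I01_pair.integral_product_swap[OF that] by (simp add: split_beta')
    have spc: "(snd z, fst z) \<in> space I01sq \<longleftrightarrow> z \<in> space I01sq" for z by (cases z) (auto simp: space_pair_measure)
    have Bi: "indicator ?B (snd z, fst z) = (indicator A z :: real)" if "z \<in> space I01sq" for z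
      using that spc[of z] by (cases z) (auto simp: indicator_def)
    have "J m ?B = J m A" for m
    proof -
      have "J m ?B = (\<integral>z. indicator ?B (snd z, fst z) * W m (snd z) (fst z) \<partial>I01sq)"
        unfolding J_def by (subst sw) (use int[OF B] in auto)
      also have "\<dots> = J m A"
        unfolding J_def using Bi kernelD(6)[OF W] by (intro Bochner_Integration.integral_cong refl) metis
      finally show ?thesis .
    qed
    then have "\<nu> ?B = \<nu> A" using tendsto_unique[OF F lim[OF B]] lim[OF A] by simp
    have i1: "integrable I01sq (\<lambda>z. indicator A z * g0 z)" "integrable I01sq (\<lambda>z. indicator A z * g0 (snd z, fst z))"
      using A g0m swap_m g01 by (auto intro!: integrable_I01sq[where B=1] simp: indicator_def)
    have "(\<integral>z. indicator A z * g0 (snd z, fst z) \<partial>I01sq) = (\<integral>z. indicator ?B (snd z, fst z) * g0 (snd z, fst z) \<partial>I01sq)"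
      using Bi by (intro Bochner_Integration.integral_cong) auto
    also have "\<dots> = (\<integral>z. indicator ?B z * g0 z \<partial>I01sq)"
      by (rule sw[symmetric]) (use B g0m in auto)
    also have "\<dots> = \<nu> A" using g0A[OF B] \<open>\<nu> ?B = \<nu> A\<close> by simp
    finally have 2: "(\<integral>z. indicator A z * g0 (snd z, fst z) \<partial>I01sq) = \<nu> A" .
    have "(\<integral>z. indicator A z * g (fst z) (snd z) \<partial>I01sq)
        = (\<integral>z. (indicator A z * g0 z + indicator A z * g0 (snd z, fst z)) / 2 \<partial>I01sq)"
      by (intro Bochner_Integration.integral_cong) (auto simp: g_def algebra_simps add_divide_distrib)
    also have "\<dots> = ((\<integral>z. indicator A z * g0 z \<partial>I01sq) + (\<integral>z. indicator A z * g0 (snd z, fst z) \<partial>I01sq)) / 2"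
      using i1 by simp
    finally show ?thesis using 2 g0A[OF A] by simp
  qed
  ultimately show ?thesis by (rule that)
qed

text \<open>From sets to bounded measurable functions: rounding \<open>f\<close> down to a multiple of
  \<open>1 / k\<close> gives a combination of finitely many indicators, with an error of at most
  \<open>1 / k\<close>.\<close>

lemma tendsto_integral_of_set_limit:
  fixes W :: "nat \<Rightarrow> real \<Rightarrow> real \<Rightarrow> real"
  assumes W: "\<And>m. kernel (W m)" and g: "kernel g"
    and lim: "\<And>A. A \<in> sets I01sq \<Longrightarrow> ((\<lambda>m. \<integral>z. indicator A z * W m (fst z) (snd z) \<partial>I01sq)
       \<longlongrightarrow> (\<integral>z. indicator A z * g (fst z) (snd z) \<partial>I01sq)) F"
    and f: "f \<in> borel_measurable I01sq" "\<And>z. \<bar>f z\<bar> \<le> B"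
  shows "((\<lambda>m. \<integral>z. f z * W m (fst z) (snd z) \<partial>I01sq) \<longlongrightarrow> (\<integral>z. f z * g (fst z) (snd z) \<partial>I01sq)) F"
proof (rule tendstoI)
  fix e :: real assume e: "e > 0"
  obtain k :: nat where k: "k > 0" "1 / real k < e / 4"
    using e reals_Archimedean[of "e / 4"] by (metis inverse_eq_divide zero_less_Suc divide_pos_pos zero_less_numeral)
  define s where "s z = real_of_int \<lfloor>real k * f z\<rfloor> / real k" for z
  define K where "K = {- \<lceil>real k * B\<rceil> - 1..\<lceil>real k * B\<rceil>}"
  define A where "A i = {z\<in>space I01sq. \<lfloor>real k * f z\<rfloor> = i}" for i
  have A: "A i \<in> sets I01sq" for i unfolding A_def using f(1) by measurable
  have K: "finite K" by (simp add: K_def)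
  have fK: "\<lfloor>real k * f z\<rfloor> \<in> K" for z
  proof -
    have "\<bar>real k * f z\<bar> \<le> real k * B" using f(2)[of z] by (simp add: abs_mult mult_left_mono)
    then show ?thesis unfolding K_def atLeastAtMost_iff by linarith
  qed
  have s_sum: "s z = (\<Sum>i\<in>K. real_of_int i / real k * indicator (A i) z)" if "z \<in> space I01sq" for z
  proof -
    have "(\<Sum>i\<in>K. real_of_int i / real k * indicator (A i) z) = (\<Sum>i\<in>K. if i = \<lfloor>real k * f z\<rfloor> then real_of_int i / real k else 0)"
      using that by (intro sum.cong) (auto simp: A_def indicator_def)
    also have "\<dots> = s z" using K fK by (subst sum.delta) (auto simp: s_def)
    finally show ?thesis ..
  qed
  have sf: "\<bar>f z - s z\<bar> \<le> 1 / real k" for z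
  proof -
    have "f z - s z = (real k * f z - real_of_int \<lfloor>real k * f z\<rfloor>) / real k" using k by (simp add: s_def field_simps)
    also have "\<bar>\<dots>\<bar> \<le> 1 / real k"
    proof -
      have "\<bar>real k * f z - real_of_int \<lfloor>real k * f z\<rfloor>\<bar> \<le> 1" by linarith
      from divide_right_mono[OF this, of "real k"] show ?thesis by (simp add: abs_divide)
    qed
    finally show ?thesis .
  qed
  have sm: "s \<in> borel_measurable I01sq" unfolding s_def[abs_def] using f(1) by measurable
  have sB: "\<bar>s z\<bar> \<le> B + 1 / real k" for z using sf[of z] f(2)[of z] by linarith
  have s_int: "(\<integral>z. s z * V (fst z) (snd z) \<partial>I01sq) = (\<Sum>i\<in>K. real_of_int i / real k * (\<integral>z. indicator (A i) z * V (fst z) (snd z) \<partial>I01sq))"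
    if V: "kernel V" for V
  proof -
    have int: "integrable I01sq (\<lambda>z. indicator (A i) z * V (fst z) (snd z))" for i
      using A by (intro integrable_kernel[OF V, where B=1]) (auto simp: indicator_def)
    have "(\<integral>z. s z * V (fst z) (snd z) \<partial>I01sq) = (\<integral>z. (\<Sum>i\<in>K. real_of_int i / real k * (indicator (A i) z * V (fst z) (snd z))) \<partial>I01sq)"
      by (intro Bochner_Integration.integral_cong refl) (simp only: s_sum sum_distrib_right mult.assoc)
    also have "\<dots> = (\<Sum>i\<in>K. \<integral>z. real_of_int i / real k * (indicator (A i) z * V (fst z) (snd z)) \<partial>I01sq)"
      by (intro Bochner_Integration.integral_sum integrable_mult_right int)
    finally show ?thesis by simp
  qed
  have close: "\<bar>(\<integral>z. f z * V (fst z) (snd z) \<partial>I01sq) - (\<integral>z. s z * V (fst z) (snd z) \<partial>I01sq)\<bar> \<le> 1 / real k" if V: "kernel V" for V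
  proof -
    have "(\<integral>z. f z * V (fst z) (snd z) \<partial>I01sq) - (\<integral>z. s z * V (fst z) (snd z) \<partial>I01sq)
        = (\<integral>z. f z * V (fst z) (snd z) - s z * V (fst z) (snd z) \<partial>I01sq)"
      by (rule Bochner_Integration.integral_diff[symmetric, OF integrable_kernel[OF V f(1) f(2)] integrable_kernel[OF V sm sB]])
    also have "\<bar>\<dots>\<bar> \<le> 1 / real k"
    proof (rule I01_pair.P.abs_integral_le_bound)
      fix z
      have "\<bar>f z * V (fst z) (snd z) - s z * V (fst z) (snd z)\<bar> = \<bar>f z - s z\<bar> * \<bar>V (fst z) (snd z)\<bar>"
        by (simp add: left_diff_distrib[symmetric] abs_mult)
      also have "\<dots> \<le> 1 / real k * 1" using sf[of z] kernelD(5)[OF V] by (intro mult_mono) auto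
      finally show "\<bar>f z * V (fst z) (snd z) - s z * V (fst z) (snd z)\<bar> \<le> 1 / real k" by simp
    qed
    finally show ?thesis .
  qed
  have "((\<lambda>m. \<integral>z. s z * W m (fst z) (snd z) \<partial>I01sq) \<longlongrightarrow> (\<integral>z. s z * g (fst z) (snd z) \<partial>I01sq)) F"
    unfolding s_int[OF W] s_int[OF g] by (intro tendsto_sum tendsto_mult_left lim A)
  then have "eventually (\<lambda>m. dist (\<integral>z. s z * W m (fst z) (snd z) \<partial>I01sq) (\<integral>z. s z * g (fst z) (snd z) \<partial>I01sq) < e / 2) F"
    using e by (intro tendstoD) auto
  then show "eventually (\<lambda>m. dist (\<integral>z. f z * W m (fst z) (snd z) \<partial>I01sq) (\<integral>z. f z * g (fst z) (snd z) \<partial>I01sq) < e) F"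
  proof eventually_elim
    case (elim m)
    then show ?case using close[OF W[of m]] close[OF g] k(2) unfolding dist_real_def by linarith
  qed
qed

section \<open>Upper semicontinuity of the entropy\<close>

text \<open>By concavity, \<open>H (W m)\<close> lies below the tangent of \<open>H\<close> at any reference
  value. With the values of \<open>g\<close> as reference the tangent would have unbounded slope
  where \<open>g\<close> is close to \<open>0\<close> or \<open>1\<close>, so \<open>g\<close>
  is clamped to \<open>[\<eta>, 1 - \<eta>]\<close>. The integral of the tangent is affine in
  \<open>W m\<close> with bounded coefficients, hence converges along \<open>F\<close>. At
  \<open>g\<close> itself the tangent differs from \<open>H (g)\<close> only where
  \<open>g\<close> has been clamped, and there it is at most
  \<open>H \<eta> \<le> 2 sqrt \<eta>\<close>.\<close>

lemma entropy_upper_semicontinuous: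
  fixes W :: "nat \<Rightarrow> real \<Rightarrow> real \<Rightarrow> real"
  assumes W: "\<And>m. kernel (W m)" and g: "kernel g" and F: "F \<noteq> bot"
    and lim: "\<And>f B. f \<in> borel_measurable I01sq \<Longrightarrow> (\<And>z. \<bar>f z\<bar> \<le> B) \<Longrightarrow>
      ((\<lambda>m. \<integral>z. f z * W m (fst z) (snd z) \<partial>I01sq) \<longlongrightarrow> (\<integral>z. f z * g (fst z) (snd z) \<partial>I01sq)) F"
    and c: "(c \<longlongrightarrow> l) F" "\<And>m. c m \<le> (\<integral>z. H (W m (fst z) (snd z)) \<partial>I01sq)"
  shows "l \<le> (\<integral>z. H (g (fst z) (snd z)) \<partial>I01sq)"
proof -
  have Hm: "(\<lambda>z. H (V (fst z) (snd z))) \<in> borel_measurable I01sq" if "kernel V" for V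
    using measurable_compose[OF kernelD(2)[OF that] H_measurable] .
  have Hi: "integrable I01sq (\<lambda>z. H (V (fst z) (snd z)))" if "kernel V" for V
    using Hm[OF that] kernelD(3,4)[OF that] by (intro integrable_I01sq[where B=1] H_bound)
  have main: "l \<le> (\<integral>z. H (g (fst z) (snd z)) \<partial>I01sq) + 2 * sqrt \<eta>" if \<eta>: "0 < \<eta>" "\<eta> \<le> 1 / 2" for \<eta>
  proof -
    \<comment> \<open>\<open>a z\<close> and \<open>b z\<close> are the slope and the intercept of the tangent at the
      clamped value \<open>q z\<close>.\<close>
    define q where "q z = max \<eta> (min (1 - \<eta>) (g (fst z) (snd z)))" for z
    define a where "a z = - (ln (q z) - ln (1 - q z)) / 2" for z
    define b where "b z = - ln (1 - q z) / 2" for z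
    have q: "\<eta> \<le> q z" "q z \<le> 1 - \<eta>" for z using \<eta> by (auto simp: q_def)
    have qm: "q \<in> borel_measurable I01sq" unfolding q_def[abs_def] using kernelD(2)[OF g] by measurable
    have lnb: "\<bar>ln x\<bar> \<le> - ln \<eta>" if "\<eta> \<le> x" "x \<le> 1" for x :: real
    proof -
      have "ln \<eta> \<le> ln x" "ln x \<le> 0" using that \<eta> by auto
      then show ?thesis by linarith
    qed
    have lq: "\<bar>ln (q z)\<bar> \<le> - ln \<eta>" "\<bar>ln (1 - q z)\<bar> \<le> - ln \<eta>" for z
      using q[of z] \<eta> by (auto intro!: lnb)
    have a_le: "\<bar>a z\<bar> \<le> - ln \<eta>" for z using lq[of z] by (auto simp: a_def abs_le_iff)
    have b_le: "\<bar>b z\<bar> \<le> - ln \<eta>" for z using lq[of z] by (auto simp: b_def abs_le_iff)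
    note ab = a_le b_le
    have am: "a \<in> borel_measurable I01sq" "b \<in> borel_measurable I01sq"
      unfolding a_def[abs_def] b_def[abs_def] using qm by measurable
    have bi: "integrable I01sq b" using am ab by (intro integrable_I01sq)
    have ai: "integrable I01sq (\<lambda>z. a z * V (fst z) (snd z))" if "kernel V" for V
      by (rule integrable_kernel[OF that am(1) ab(1)])
    have up: "c m \<le> (\<integral>z. a z * W m (fst z) (snd z) \<partial>I01sq) + (\<integral>z. b z \<partial>I01sq)" for m
    proof -
      have "c m \<le> (\<integral>z. a z * W m (fst z) (snd z) + b z \<partial>I01sq)"
      proof (rule order_trans[OF c(2) integral_mono])
        show "integrable I01sq (\<lambda>z. H (W m (fst z) (snd z)))" by (rule Hi[OF W])
        show "integrable I01sq (\<lambda>z. a z * W m (fst z) (snd z) + b z)"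
          by (intro Bochner_Integration.integrable_add ai W bi)
        fix z
        have "H (W m (fst z) (snd z)) \<le> - (1 / 2) * (W m (fst z) (snd z) * ln (q z) + (1 - W m (fst z) (snd z)) * ln (1 - q z))"
          using kernelD(3,4)[OF W] q[of z] \<eta> by (intro binary_cross_entropy) auto
        also have "\<dots> = a z * W m (fst z) (snd z) + b z" by (simp add: a_def b_def field_simps)
        finally show "H (W m (fst z) (snd z)) \<le> a z * W m (fst z) (snd z) + b z" .
      qed
      then show ?thesis by (simp add: Bochner_Integration.integral_add[OF ai[OF W] bi])
    qed
    have "((\<lambda>m. (\<integral>z. a z * W m (fst z) (snd z) \<partial>I01sq) + (\<integral>z. b z \<partial>I01sq)) \<longlongrightarrow> (\<integral>z. a z * g (fst z) (snd z) \<partial>I01sq) + (\<integral>z. b z \<partial>I01sq)) F"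
      by (intro tendsto_add lim[OF am(1) ab(1)] tendsto_const)
    from tendsto_le[OF F this c(1)] up
    have "l \<le> (\<integral>z. a z * g (fst z) (snd z) \<partial>I01sq) + (\<integral>z. b z \<partial>I01sq)" by simp
    also have "\<dots> = (\<integral>z. a z * g (fst z) (snd z) + b z \<partial>I01sq)"
      by (rule Bochner_Integration.integral_add[OF ai[OF g] bi, symmetric])
    also have "\<dots> \<le> (\<integral>z. H (g (fst z) (snd z)) + 2 * sqrt \<eta> \<partial>I01sq)"
    proof (rule integral_mono)
      show "integrable I01sq (\<lambda>z. a z * g (fst z) (snd z) + b z)"
        by (intro Bochner_Integration.integrable_add ai g bi)
      show "integrable I01sq (\<lambda>z. H (g (fst z) (snd z)) + 2 * sqrt \<eta>)"
        by (intro Bochner_Integration.integrable_add Hi g) simp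
      fix z
      let ?u = "g (fst z) (snd z)"
      have u: "0 \<le> ?u" "?u \<le> 1" using kernelD(3,4)[OF g] by auto
      have Hq: "H (q z) = a z * q z + b z" by (simp add: H_def a_def b_def field_simps)
      have sym: "H (1 - \<eta>) = H \<eta>" by (simp add: H_def)
      have ln: "ln \<eta> \<le> ln (1 - \<eta>)" using \<eta> by auto
      consider "?u < \<eta>" | "\<eta> \<le> ?u" "?u \<le> 1 - \<eta>" | "1 - \<eta> < ?u" by linarith
      then show "a z * ?u + b z \<le> H ?u + 2 * sqrt \<eta>"
      proof cases
        case 1
        then have qz: "q z = \<eta>" using \<eta> by (simp add: q_def)
        have "0 \<le> a z" using ln by (simp add: a_def qz)
        then have "a z * ?u \<le> a z * q z" using 1 qz by (intro mult_left_mono) auto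
        then have "a z * ?u + b z \<le> H \<eta>" using Hq qz by simp
        then show ?thesis using H_le_sqrt[OF \<eta>] H_nonneg[OF u] by linarith
      next
        case 2
        then have "q z = ?u" by (simp add: q_def)
        then show ?thesis using Hq \<eta> by simp
      next
        case 3
        then have qz: "q z = 1 - \<eta>" using \<eta> by (simp add: q_def)
        have "a z \<le> 0" using ln by (simp add: a_def qz)
        then have "a z * ?u \<le> a z * q z" using 3 qz by (intro mult_left_mono_neg) auto
        then have "a z * ?u + b z \<le> H \<eta>" using Hq qz sym by simp
        then show ?thesis using H_le_sqrt[OF \<eta>] H_nonneg[OF u] by linarith
      qed
    qed
    also have "\<dots> = (\<integral>z. H (g (fst z) (snd z)) \<partial>I01sq) + 2 * sqrt \<eta>"
      by (simp add: Bochner_Integration.integral_add[OF Hi[OF g]] I01_pair.P.prob_space)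
    finally show ?thesis .
  qed
  have "((\<lambda>\<eta>. (\<integral>z. H (g (fst z) (snd z)) \<partial>I01sq) + 2 * sqrt \<eta>) \<longlongrightarrow> (\<integral>z. H (g (fst z) (snd z)) \<partial>I01sq) + 2 * sqrt 0) (at_right 0)"
    by (intro tendsto_intros)
  moreover have "eventually (\<lambda>\<eta>. l \<le> (\<integral>z. H (g (fst z) (snd z)) \<partial>I01sq) + 2 * sqrt \<eta>) (at_right 0)"
  proof -
    have "eventually (\<lambda>\<eta>. \<eta> \<in> {0<..<1/2}) (at_right (0::real))" by (rule eventually_at_right_real) simp
    then show ?thesis by eventually_elim (rule main, auto)
  qed
  ultimately have "l \<le> (\<integral>z. H (g (fst z) (snd z)) \<partial>I01sq) + 2 * sqrt 0"
    by (rule tendsto_lowerbound) simp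
  then show ?thesis by simp
qed

section \<open>Convergence in cut norm\<close>

lemma integral_I01sq_product:
  fixes u v :: "real \<Rightarrow> real"
  assumes u: "u \<in> borel_measurable I01" "\<And>x. \<bar>u x\<bar> \<le> B" and v: "v \<in> borel_measurable I01" "\<And>x. \<bar>v x\<bar> \<le> C"
  shows "integrable I01sq (\<lambda>z. u (fst z) * v (snd z))"
    and "(\<integral>z. u (fst z) * v (snd z) \<partial>I01sq) = (\<integral>x. u x \<partial>I01) * (\<integral>y. v y \<partial>I01)"
proof -
  have "0 \<le> B" using u(2)[of 0] by linarith
  show int: "integrable I01sq (\<lambda>z. u (fst z) * v (snd z))"
  proof (rule integrable_I01sq[where B="B * C"])
    show "(\<lambda>z. u (fst z) * v (snd z)) \<in> borel_measurable I01sq"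
      by (intro borel_measurable_times measurable_compose[OF measurable_fst u(1)] measurable_compose[OF measurable_snd v(1)])
    show "\<bar>u (fst z) * v (snd z)\<bar> \<le> B * C" for z
      unfolding abs_mult using u(2) v(2) \<open>0 \<le> B\<close> by (intro mult_mono) auto
  qed
  have "(\<integral>z. u (fst z) * v (snd z) \<partial>I01sq) = (\<integral>x. (\<integral>y. u x * v y \<partial>I01) \<partial>I01)"
    using I01_pair.integral_fst'[OF int] by simp
  then show "(\<integral>z. u (fst z) * v (snd z) \<partial>I01sq) = (\<integral>x. u x \<partial>I01) * (\<integral>y. v y \<partial>I01)" by simp
qed

lemma staircase_bound: "\<bar>staircase s q x\<bar> \<le> 2 ^ Suc q"
proof -
  have "\<bar>staircase s q x\<bar> \<le> (\<Sum>c<2 ^ Suc q. \<bar>(-1) ^ Suc c * of_bool (x \<le> s q c) :: real\<bar>)"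
    unfolding staircase_def by (rule sum_abs)
  also have "\<dots> \<le> (\<Sum>c<(2::nat) ^ Suc q. 1)" by (intro sum_mono) (auto simp: abs_mult)
  finally show ?thesis by simp
qed

lemma staircase_measurable [measurable]: "staircase (s :: nat \<Rightarrow> nat \<Rightarrow> real) q \<in> borel_measurable I01"
  unfolding staircase_def[abs_def] of_bool_def
  by (rule measurable_restrict_space1) measurable

text \<open>Moving the end point of an initial segment from \<open>a\<close> to \<open>b\<close> changes its
  indicator on a set of measure at most \<open>\<bar>a - b\<bar>\<close>. The bound does not
  depend on the test function \<open>f\<close>.\<close>

lemma integral_staircase_diff:
  fixes s s' :: "nat \<Rightarrow> nat \<Rightarrow> real"
  assumes f: "f \<in> borel_measurable I01" "\<And>x. \<bar>f x\<bar> \<le> 1"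
  shows "\<bar>(\<integral>x. f x * staircase s q x \<partial>I01) - (\<integral>x. f x * staircase s' q x \<partial>I01)\<bar>
    \<le> (\<Sum>c<2 ^ Suc q. \<bar>s q c - s' q c\<bar>)"
proof -
  let ?i = "\<lambda>a x. f x * of_bool (x \<le> (a::real))"
  have int: "integrable I01 (?i a)" for a
  proof (rule I01.integrable_const_bound[where B=1])
    show "AE x in I01. norm (?i a x) \<le> 1" using f(2) by (intro AE_I2) (auto simp: abs_mult)
    have "(\<lambda>x. of_bool (x \<le> a) :: real) \<in> borel_measurable I01"
      unfolding of_bool_def by (rule measurable_restrict_space1) measurable
    then show "?i a \<in> borel_measurable I01" using f(1) by simp
  qed
  have st: "(\<integral>x. f x * staircase s q x \<partial>I01) = (\<Sum>c<2 ^ Suc q. (-1) ^ Suc c * (\<integral>x. ?i (s q c) x \<partial>I01))" for s :: "nat \<Rightarrow> nat \<Rightarrow> real"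
  proof -
    have "(\<integral>x. f x * staircase s q x \<partial>I01) = (\<integral>x. (\<Sum>c<2 ^ Suc q. (-1) ^ Suc c * ?i (s q c) x) \<partial>I01)"
      unfolding staircase_def sum_distrib_left by (intro Bochner_Integration.integral_cong sum.cong refl) simp
    also have "\<dots> = (\<Sum>c<2 ^ Suc q. \<integral>x. (-1) ^ Suc c * ?i (s q c) x \<partial>I01)"
      by (intro Bochner_Integration.integral_sum integrable_mult_right int)
    finally show ?thesis by simp
  qed
  have one: "\<bar>(\<integral>x. ?i a x \<partial>I01) - (\<integral>x. ?i b x \<partial>I01)\<bar> \<le> \<bar>a - b\<bar>" for a b
  proof -
    have "(\<integral>x. ?i a x \<partial>I01) - (\<integral>x. ?i b x \<partial>I01) = (\<integral>x. ?i a x - ?i b x \<partial>I01)"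
      by (rule Bochner_Integration.integral_diff[symmetric, OF int int])
    also have "\<bar>\<dots>\<bar> \<le> (\<integral>x. \<bar>?i a x - ?i b x\<bar> \<partial>I01)" by (rule integral_abs_bound)
    also have "\<dots> \<le> (\<integral>x. indicator {min a b..max a b} x \<partial>I01)"
    proof (rule integral_mono)
      show "integrable I01 (\<lambda>x. \<bar>?i a x - ?i b x\<bar>)" by (intro integrable_abs Bochner_Integration.integrable_diff int)
      show "integrable I01 (indicator {min a b..max a b} :: real \<Rightarrow> real)"
        by (rule I01.integrable_const_bound[where B=1]) (auto intro!: measurable_restrict_space1)
      show "\<bar>?i a x - ?i b x\<bar> \<le> indicator {min a b..max a b} x" for x
        using f(2)[of x] by (auto simp: indicator_def)
    qed
    also have "\<dots> = measure I01 ({min a b..max a b} \<inter> space I01)" by simp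
    also have "\<dots> = measure lborel ({min a b..max a b} \<inter> {0..1})"
      unfolding space_I01 by (rule measure_restrict_space) auto
    also have "\<dots> \<le> measure lborel {min a b..max a b}"
      by (intro measure_mono_fmeasurable) (auto intro!: fmeasurableI simp: emeasure_lborel_Icc_eq)
    also have "\<dots> = \<bar>a - b\<bar>" by (simp add: min_def max_def)
    finally show ?thesis .
  qed
  have "(\<integral>x. f x * staircase s q x \<partial>I01) - (\<integral>x. f x * staircase s' q x \<partial>I01)
      = (\<Sum>c<2 ^ Suc q. (-1) ^ Suc c * ((\<integral>x. ?i (s q c) x \<partial>I01) - (\<integral>x. ?i (s' q c) x \<partial>I01)))"
    unfolding st by (simp only: sum_subtractf[symmetric] right_diff_distrib)
  also have "\<bar>\<dots>\<bar> \<le> (\<Sum>c<2 ^ Suc q. \<bar>s q c - s' q c\<bar>)"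
    by (rule order_trans[OF sum_abs sum_mono]) (simp only: abs_mult power_abs abs_minus abs_one power_one mult_1 one)
  finally show ?thesis .
qed

lemma integral_staircase_sum:
  fixes s :: "nat \<Rightarrow> nat \<Rightarrow> real"
  assumes f: "f \<in> borel_measurable I01" "\<And>x. \<bar>f x\<bar> \<le> 1" and h: "h \<in> borel_measurable I01" "\<And>x. \<bar>h x\<bar> \<le> 1"
  shows "integrable I01sq (\<lambda>z. f (fst z) * staircase_sum l \<sigma> s (fst z) (snd z) * h (snd z))"
    and "(\<integral>z. f (fst z) * staircase_sum l \<sigma> s (fst z) (snd z) * h (snd z) \<partial>I01sq)
     = 1 / real (Suc l) * (\<Sum>q\<in>{level_start l..<level_start (Suc l)}.
         \<sigma> q * ((\<integral>x. f x * staircase s (2 * q) x \<partial>I01) * (\<integral>y. h y * staircase s (2 * q + 1) y \<partial>I01)))"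
proof -
  let ?u = "\<lambda>q x. f x * staircase s (2 * q) x" and ?v = "\<lambda>q x. h x * staircase s (2 * q + 1) x"
  have b: "\<bar>e x * staircase s q x\<bar> \<le> 2 ^ Suc q" if "\<And>x. \<bar>e x\<bar> \<le> 1" for e :: "real \<Rightarrow> real" and q x
    unfolding abs_mult using mult_mono[OF that[of x] staircase_bound[of s q x]] by simp
  have um: "?u q \<in> borel_measurable I01" "?v q \<in> borel_measurable I01" for q
    using f(1) h(1) by measurable
  have bu: "\<bar>?u q x\<bar> \<le> 2 ^ Suc (2 * q)" for q x by (rule b) (rule f(2))
  have bv: "\<bar>?v q x\<bar> \<le> 2 ^ Suc (2 * q + 1)" for q x by (rule b) (rule h(2))
  note int = integral_I01sq_product[OF um(1) bu um(2) bv]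
  have eq: "f (fst z) * staircase_sum l \<sigma> s (fst z) (snd z) * h (snd z)
      = 1 / real (Suc l) * (\<Sum>q\<in>{level_start l..<level_start (Suc l)}. \<sigma> q * (?u q (fst z) * ?v q (snd z)))" for z
    unfolding staircase_sum_def by (simp add: sum_distrib_left sum_distrib_right mult_ac)
  show "integrable I01sq (\<lambda>z. f (fst z) * staircase_sum l \<sigma> s (fst z) (snd z) * h (snd z))"
    unfolding eq by (intro integrable_mult_right Bochner_Integration.integrable_sum int(1))
  have "(\<integral>z. (\<Sum>q\<in>{level_start l..<level_start (Suc l)}. \<sigma> q * (?u q (fst z) * ?v q (snd z))) \<partial>I01sq)
      = (\<Sum>q\<in>{level_start l..<level_start (Suc l)}. \<integral>z. \<sigma> q * (?u q (fst z) * ?v q (snd z)) \<partial>I01sq)"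
    by (intro Bochner_Integration.integral_sum integrable_mult_right int(1))
  also have "\<dots> = (\<Sum>q\<in>{level_start l..<level_start (Suc l)}. \<sigma> q * ((\<integral>x. ?u q x \<partial>I01) * (\<integral>y. ?v q y \<partial>I01)))"
    by (simp only: integral_mult_right_zero int(2))
  finally show "(\<integral>z. f (fst z) * staircase_sum l \<sigma> s (fst z) (snd z) * h (snd z) \<partial>I01sq)
     = 1 / real (Suc l) * (\<Sum>q\<in>{level_start l..<level_start (Suc l)}. \<sigma> q * ((\<integral>x. ?u q x \<partial>I01) * (\<integral>y. ?v q y \<partial>I01)))"
    unfolding eq by (simp only: integral_mult_right_zero)
qed

text \<open>An upper bound for the cut norm distance of two staircase sums, continuous in their parameters.\<close>

definition staircase_distance ::
    "nat \<Rightarrow> (nat \<Rightarrow> real) \<Rightarrow> (nat \<Rightarrow> nat \<Rightarrow> real) \<Rightarrow> (nat \<Rightarrow> real) \<Rightarrow> (nat \<Rightarrow> nat \<Rightarrow> real) \<Rightarrow> real" where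
  "staircase_distance l \<sigma> s \<sigma>' s' = 1 / real (Suc l) * (\<Sum>q\<in>{level_start l..<level_start (Suc l)}.
     \<bar>\<sigma> q - \<sigma>' q\<bar> * (2 ^ Suc (2 * q) * 2 ^ Suc (2 * q + 1))
     + (\<Sum>c<2 ^ Suc (2 * q). \<bar>s (2 * q) c - s' (2 * q) c\<bar>) * 2 ^ Suc (2 * q + 1)
     + 2 ^ Suc (2 * q) * (\<Sum>c<2 ^ Suc (2 * q + 1). \<bar>s (2 * q + 1) c - s' (2 * q + 1) c\<bar>))"

lemma integral_staircase_sum_diff:
  fixes s s' :: "nat \<Rightarrow> nat \<Rightarrow> real"
  assumes f: "f \<in> borel_measurable I01" "\<And>x. \<bar>f x\<bar> \<le> 1" and h: "h \<in> borel_measurable I01" "\<And>x. \<bar>h x\<bar> \<le> 1"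
    and \<sigma>: "\<And>q. \<bar>\<sigma> q\<bar> \<le> 1"
  shows "\<bar>(\<integral>z. f (fst z) * staircase_sum l \<sigma> s (fst z) (snd z) * h (snd z) \<partial>I01sq)
     - (\<integral>z. f (fst z) * staircase_sum l \<sigma>' s' (fst z) (snd z) * h (snd z) \<partial>I01sq)\<bar> \<le> staircase_distance l \<sigma> s \<sigma>' s'"
proof -
  let ?u = "\<lambda>s q. \<integral>x. f x * staircase s (2 * q) x \<partial>I01" and ?v = "\<lambda>s q. \<integral>x. h x * staircase s (2 * q + 1) x \<partial>I01"
  have ub: "\<bar>\<integral>x. e x * staircase s q x \<partial>I01\<bar> \<le> 2 ^ Suc q" if "\<And>x. \<bar>e x\<bar> \<le> 1" for e :: "real \<Rightarrow> real" and q and s :: "nat \<Rightarrow> nat \<Rightarrow> real"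
  proof (rule I01.abs_integral_le_bound)
    show "\<bar>e x * staircase s q x\<bar> \<le> 2 ^ Suc q" for x
      unfolding abs_mult using mult_mono[OF that[of x] staircase_bound[of s q x]] by simp
  qed
  have ubf: "\<bar>?u s q\<bar> \<le> 2 ^ Suc (2 * q)" for q and s :: "nat \<Rightarrow> nat \<Rightarrow> real"
    by (rule ub) (rule f(2))
  have ubh: "\<bar>?v s q\<bar> \<le> 2 ^ Suc (2 * q + 1)" for q and s :: "nat \<Rightarrow> nat \<Rightarrow> real"
    by (rule ub) (rule h(2))
  have product_diff: "\<bar>a * (p * r) - a' * (p' * r')\<bar> \<le> \<bar>a - a'\<bar> * (N * K) + \<bar>p - p'\<bar> * K + N * \<bar>r - r'\<bar>"
    if "\<bar>a\<bar> \<le> 1" "\<bar>p\<bar> \<le> N" "\<bar>r\<bar> \<le> K" "\<bar>p'\<bar> \<le> N" "\<bar>r'\<bar> \<le> K" for a a' p p' r r' N K :: real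
  proof -
    have nn: "0 \<le> N" "0 \<le> K" using that by linarith+
    have "a * (p * r) - a' * (p' * r') = (a - a') * (p' * r') + a * ((p - p') * r) + a * (p' * (r - r'))"
      by (simp add: algebra_simps)
    also have "\<bar>\<dots>\<bar> \<le> \<bar>(a - a') * (p' * r')\<bar> + \<bar>a * ((p - p') * r)\<bar> + \<bar>a * (p' * (r - r'))\<bar>" by linarith
    also have "\<dots> \<le> \<bar>a - a'\<bar> * (N * K) + 1 * (\<bar>p - p'\<bar> * K) + 1 * (N * \<bar>r - r'\<bar>)"
      unfolding abs_mult using that nn by (intro add_mono mult_mono mult_nonneg_nonneg) auto
    finally show ?thesis by simp
  qed
  define a where "a q = \<sigma> q * (?u s q * ?v s q) - \<sigma>' q * (?u s' q * ?v s' q)" for q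
  define b where "b q = \<bar>\<sigma> q - \<sigma>' q\<bar> * (2 ^ Suc (2 * q) * 2 ^ Suc (2 * q + 1))
     + (\<Sum>c<2 ^ Suc (2 * q). \<bar>s (2 * q) c - s' (2 * q) c\<bar>) * 2 ^ Suc (2 * q + 1)
     + 2 ^ Suc (2 * q) * (\<Sum>c<2 ^ Suc (2 * q + 1). \<bar>s (2 * q + 1) c - s' (2 * q + 1) c\<bar>)" for q
  have step: "\<bar>a q\<bar> \<le> b q" for q
  proof -
    have "\<bar>a q\<bar> \<le> \<bar>\<sigma> q - \<sigma>' q\<bar> * (2 ^ Suc (2 * q) * 2 ^ Suc (2 * q + 1)) + \<bar>?u s q - ?u s' q\<bar> * 2 ^ Suc (2 * q + 1)
        + 2 ^ Suc (2 * q) * \<bar>?v s q - ?v s' q\<bar>"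
      unfolding a_def by (rule product_diff[OF \<sigma> ubf ubh ubf ubh])
    also have "\<dots> \<le> b q"
      unfolding b_def
      by (rule add_mono[OF add_mono[OF order_refl mult_right_mono[OF integral_staircase_diff[OF f]]]
            mult_left_mono[OF integral_staircase_diff[OF h]]]) simp_all
    finally show ?thesis .
  qed
  let ?Q = "{level_start l..<level_start (Suc l)}"
  have "(\<integral>z. f (fst z) * staircase_sum l \<sigma> s (fst z) (snd z) * h (snd z) \<partial>I01sq)
     - (\<integral>z. f (fst z) * staircase_sum l \<sigma>' s' (fst z) (snd z) * h (snd z) \<partial>I01sq) = 1 / real (Suc l) * sum a ?Q"
    unfolding integral_staircase_sum(2)[OF f h] a_def sum_subtractf right_diff_distrib ..
  also have "\<bar>\<dots>\<bar> = 1 / real (Suc l) * \<bar>sum a ?Q\<bar>" by (simp only: abs_mult) simp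
  also have "\<dots> \<le> 1 / real (Suc l) * sum b ?Q"
  proof (rule mult_left_mono)
    show "\<bar>sum a ?Q\<bar> \<le> sum b ?Q" by (rule order_trans[OF sum_abs]) (intro sum_mono step)
  qed simp
  also have "\<dots> = staircase_distance l \<sigma> s \<sigma>' s'" unfolding staircase_distance_def b_def ..
  finally show ?thesis .
qed

lemma staircase_distance_tendsto_0:
  assumes "\<And>q. ((\<lambda>m. \<sigma> m q) \<longlongrightarrow> \<sigma>' q) F" "\<And>q c. ((\<lambda>m. s m q c) \<longlongrightarrow> s' q c) F"
  shows "((\<lambda>m. staircase_distance l (\<sigma> m) (s m) \<sigma>' s') \<longlongrightarrow> 0) F"
proof -
  have 1: "((\<lambda>m. \<bar>\<sigma> m q - \<sigma>' q\<bar>) \<longlongrightarrow> 0) F" for q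
    using tendsto_rabs[OF tendsto_diff[OF assms(1)[of q] tendsto_const[of "\<sigma>' q"]]] by simp
  have 2: "((\<lambda>m. \<bar>s m q c - s' q c\<bar>) \<longlongrightarrow> 0) F" for q c
    using tendsto_rabs[OF tendsto_diff[OF assms(2)[of q c] tendsto_const[of "s' q c"]]] by simp
  have "((\<lambda>m. staircase_distance l (\<sigma> m) (s m) \<sigma>' s') \<longlongrightarrow> 1 / real (Suc l) * (\<Sum>q\<in>{level_start l..<level_start (Suc l)}.
     0 * (2 ^ Suc (2 * q) * 2 ^ Suc (2 * q + 1)) + (\<Sum>c<(2::nat) ^ Suc (2 * q). 0) * 2 ^ Suc (2 * q + 1)
     + 2 ^ Suc (2 * q) * (\<Sum>c<(2::nat) ^ Suc (2 * q + 1). 0))) F"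
    unfolding staircase_distance_def by (intro tendsto_intros 1 2)
  then show ?thesis by simp
qed

text \<open>Write \<open>T\<close> for the staircase sum that belongs to \<open>W m\<close> at a fixed level
  and \<open>T'\<close> for the one with the limiting parameters. The distance of
  \<open>W m\<close> and \<open>T\<close> is small by assumption, that of \<open>T\<close> and
  \<open>T'\<close> because the parameters converge, and that of \<open>T'\<close> and
  \<open>g\<close> is small since each of its test integrals is a limit of test integrals of
  \<open>T - W m\<close>. Only the last step uses the weak convergence, for a fixed pair of test
  functions, so the conclusion is uniform in the test functions.\<close>

lemma cut_convergence:
  fixes W :: "nat \<Rightarrow> real \<Rightarrow> real \<Rightarrow> real"
  assumes W: "\<And>m. kernel (W m)" and g: "kernel g" and F: "F \<noteq> bot"
    and lim: "\<And>f B. f \<in> borel_measurable I01sq \<Longrightarrow> (\<And>z. \<bar>f z\<bar> \<le> B) \<Longrightarrow>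
      ((\<lambda>m. \<integral>z. f z * W m (fst z) (snd z) \<partial>I01sq) \<longlongrightarrow> (\<integral>z. f z * g (fst z) (snd z) \<partial>I01sq)) F"
    and \<sigma>: "\<And>m q. \<bar>\<sigma> m q\<bar> \<le> 1" "\<And>q. ((\<lambda>m. \<sigma> m q) \<longlongrightarrow> \<sigma>' q) F" and s: "\<And>q c. ((\<lambda>m. s m q c) \<longlongrightarrow> s' q c) F"
    and close: "\<And>l. eventually (\<lambda>m. cut_bounded (1 / real (Suc l)) (\<lambda>x y. W m x y - staircase_sum l (\<sigma> m) (s m) x y)) F"
    and \<epsilon>: "\<epsilon> > 0"
  shows "eventually (\<lambda>m. cut_bounded \<epsilon> (\<lambda>x y. W m x y - g x y)) F"
proof -
  obtain l :: nat where l: "1 / real (Suc l) < \<epsilon> / 3"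
    using reals_Archimedean[of "\<epsilon> / 3"] \<epsilon> by (auto simp: inverse_eq_divide)
  let ?e = "1 / real (Suc l)"
  let ?T = "\<lambda>m. staircase_sum l (\<sigma> m) (s m)" and ?T' = "staircase_sum l \<sigma>' s'"
  have dist0: "((\<lambda>m. staircase_distance l (\<sigma> m) (s m) \<sigma>' s') \<longlongrightarrow> 0) F"
    by (rule staircase_distance_tendsto_0[OF \<sigma>(2) s])
  define B where "B f h V = (\<integral>z. f (fst z) * V (fst z) (snd z) * h (snd z) \<partial>I01sq)"
    for f h :: "real \<Rightarrow> real" and V :: "real \<Rightarrow> real \<Rightarrow> real"
  define ok where "ok f \<longleftrightarrow> f \<in> borel_measurable I01 \<and> (\<forall>x. 0 \<le> f x \<and> f x \<le> 1)" for f :: "real \<Rightarrow> real"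
  have okD: "f \<in> borel_measurable I01" "\<bar>f x\<bar> \<le> 1" if "ok f" for f x
    using that by (auto simp: ok_def abs_le_iff intro: order_trans[of _ 0])
  have fh: "(\<lambda>z. f (fst z) * h (snd z)) \<in> borel_measurable I01sq" "\<bar>f (fst z) * h (snd z)\<bar> \<le> 1" if "ok f" "ok h" for f h z
    using okD[OF that(1)] okD[OF that(2)]
    by (auto simp: abs_mult intro!: mult_le_one borel_measurable_times measurable_compose[OF measurable_fst] measurable_compose[OF measurable_snd])
  have BK: "B f h V = (\<integral>z. (f (fst z) * h (snd z)) * V (fst z) (snd z) \<partial>I01sq)" for f h V
    unfolding B_def by (intro Bochner_Integration.integral_cong) auto
  have int: "integrable I01sq (\<lambda>z. f (fst z) * V (fst z) (snd z) * h (snd z))" if "ok f" "ok h" "kernel V" for f h V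
    using integrable_kernel[OF that(3) fh[OF that(1,2)]] by (simp add: mult_ac)
  have diff: "(\<integral>z. f (fst z) * (V (fst z) (snd z) - U (fst z) (snd z)) * h (snd z) \<partial>I01sq) = B f h V - B f h U"
    if "integrable I01sq (\<lambda>z. f (fst z) * V (fst z) (snd z) * h (snd z))"
      "integrable I01sq (\<lambda>z. f (fst z) * U (fst z) (snd z) * h (snd z))" for f h V U
    unfolding B_def using Bochner_Integration.integral_diff[OF that] by (simp add: algebra_simps)
  have intT: "integrable I01sq (\<lambda>z. f (fst z) * staircase_sum l \<tau> r (fst z) (snd z) * h (snd z))" if "ok f" "ok h"
    for f h \<tau> and r :: "nat \<Rightarrow> nat \<Rightarrow> real"
    by (rule integral_staircase_sum(1)) (use okD[OF that(1)] okD[OF that(2)] in auto)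
  have WT: "\<bar>B f h (W m) - B f h (?T m)\<bar> \<le> ?e"
    if "cut_bounded ?e (\<lambda>x y. W m x y - ?T m x y)" "ok f" "ok h" for m f h
    using cut_boundedD[OF that(1), of f h] that(2,3) unfolding ok_def
    by (simp add: diff[OF int[OF that(2,3) W] intT[OF that(2,3)]])
  have TT: "\<bar>B f h (?T m) - B f h ?T'\<bar> \<le> staircase_distance l (\<sigma> m) (s m) \<sigma>' s'" if "ok f" "ok h" for m f h
    unfolding B_def by (rule integral_staircase_sum_diff) (use okD[OF that(1)] okD[OF that(2)] \<sigma>(1) in auto)
  have gT: "\<bar>B f h g - B f h ?T'\<bar> \<le> ?e" if fhok: "ok f" "ok h" for f h
  proof (rule tendsto_upperbound[OF _ _ F])
    have "((\<lambda>m. B f h (?T m) - B f h ?T') \<longlongrightarrow> 0) F"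
      by (rule Lim_null_comparison[OF _ dist0]) (use TT[OF fhok] in auto)
    then have "((\<lambda>m. B f h (?T m)) \<longlongrightarrow> B f h ?T') F" by (simp add: LIM_zero_iff)
    moreover have "((\<lambda>m. B f h (W m)) \<longlongrightarrow> B f h g) F" unfolding BK by (rule lim[OF fh[OF fhok]])
    ultimately show "((\<lambda>m. \<bar>B f h (W m) - B f h (?T m)\<bar>) \<longlongrightarrow> \<bar>B f h g - B f h ?T'\<bar>) F"
      by (intro tendsto_rabs tendsto_diff)
    show "eventually (\<lambda>m. \<bar>B f h (W m) - B f h (?T m)\<bar> \<le> ?e) F"
      using close[of l] by eventually_elim (use WT fhok in auto)
  qed
  have "eventually (\<lambda>m. staircase_distance l (\<sigma> m) (s m) \<sigma>' s' < \<epsilon> / 3) F"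
    using order_tendstoD(2)[OF dist0, of "\<epsilon> / 3"] \<epsilon> by simp
  with close[of l] show ?thesis
  proof eventually_elim
    case (elim m)
    show ?case
      unfolding cut_bounded_def
    proof (intro ballI impI)
      fix f h :: "real \<Rightarrow> real"
      assume "f \<in> borel_measurable I01" "h \<in> borel_measurable I01" "\<forall>x. 0 \<le> f x \<and> f x \<le> 1" "\<forall>x. 0 \<le> h x \<and> h x \<le> 1"
      then have fhok: "ok f" "ok h" by (auto simp: ok_def)
      have "\<bar>B f h (W m) - B f h g\<bar> \<le> \<epsilon>"
        using WT[OF elim(1) fhok] TT[OF fhok, of m] gT[OF fhok] elim(2) l by linarith
      then show "\<bar>\<integral>z. f (fst z) * (W m (fst z) (snd z) - g (fst z) (snd z)) * h (snd z) \<partial>I01sq\<bar> \<le> \<epsilon>"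
        unfolding diff[OF int[OF fhok W] int[OF fhok g]] .
    qed
  qed
qed

text \<open>The coordinates that have to converge together are the integrals of \<open>W m\<close> over all
  measurable sets and the parameters of the staircase sums.\<close>

lemma limit_graphon:
  fixes W :: "nat \<Rightarrow> real \<Rightarrow> real \<Rightarrow> real" and P :: "nat \<Rightarrow> 'v sgraph"
  assumes W: "\<And>m. kernel (W m)"
    and \<sigma>: "\<And>m q. \<bar>\<sigma> m q\<bar> \<le> 1" and s: "\<And>m q c. \<bar>s m q c\<bar> \<le> 1"
    and close: "\<And>l m. l \<le> m \<Longrightarrow> cut_bounded (1 / real (Suc l)) (\<lambda>x y. W m x y - staircase_sum l (\<sigma> m) (s m) x y)"
    and P: "\<And>i. i \<in> {1..k} \<Longrightarrow> simple_graph (P i)"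
    and dens: "\<And>i. i \<in> {1..k} \<Longrightarrow> (\<lambda>m. hom_density (P i) (W m)) \<longlonglongrightarrow> t i"
    and c: "c \<longlonglongrightarrow> b" "\<And>m. c m \<le> (\<integral>z. H (W m (fst z) (snd z)) \<partial>I01sq)"
  shows "\<exists>g\<in>graphons_with k P t. b \<le> shannon_entropy g"
proof -
  \<comment> \<open>Sets that are not measurable are replaced by the empty set, so that the index type is the type
    of all sets.\<close>
  define A where "A a = (if a \<in> sets I01sq then a else {})" for a :: "(real \<times> real) set"
  define X where "X m i = (case i of Inl a \<Rightarrow> \<integral>z. indicator (A a) z * W m (fst z) (snd z) \<partial>I01sq
     | Inr (Inl (q, c)) \<Rightarrow> s m q c | Inr (Inr q) \<Rightarrow> \<sigma> m q)" for m i
  have "\<bar>X m i\<bar> \<le> 1" for m i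
  proof (cases i)
    case (Inl a)
    have "\<bar>\<integral>z. indicator (A a) z * W m (fst z) (snd z) \<partial>I01sq\<bar> \<le> 1"
      by (rule I01_pair.P.abs_integral_le_bound) (use kernelD(5)[OF W] in \<open>auto simp: indicator_def\<close>)
    then show ?thesis by (simp add: X_def Inl)
  next
    case (Inr j)
    then show ?thesis using \<sigma> s by (cases j) (auto simp: X_def)
  qed
  then obtain F x where F: "F \<noteq> bot" "F \<le> sequentially" and x: "\<And>i. ((\<lambda>m. X m i) \<longlongrightarrow> x i) F"
    using common_cluster_filter[of X] by blast
  have sl: "((\<lambda>m. s m q c) \<longlongrightarrow> x (Inr (Inl (q, c)))) F" for q c using x[of "Inr (Inl (q, c))"] by (simp add: X_def)
  have \<sigma>l: "((\<lambda>m. \<sigma> m q) \<longlongrightarrow> x (Inr (Inr q))) F" for q using x[of "Inr (Inr q)"] by (simp add: X_def)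
  have Wl: "((\<lambda>m. \<integral>z. indicator a z * W m (fst z) (snd z) \<partial>I01sq) \<longlongrightarrow> x (Inl a)) F" if "a \<in> sets I01sq" for a
    using x[of "Inl a"] that by (simp add: X_def A_def)
  from kernel_of_set_limit[of W F "\<lambda>a. x (Inl a)", OF W F(1) Wl] obtain g where g: "kernel g"
    and gA: "\<And>a. a \<in> sets I01sq \<Longrightarrow> (\<integral>z. indicator a z * g (fst z) (snd z) \<partial>I01sq) = x (Inl a)" by blast
  have lim: "((\<lambda>m. \<integral>z. f z * W m (fst z) (snd z) \<partial>I01sq) \<longlongrightarrow> (\<integral>z. f z * g (fst z) (snd z) \<partial>I01sq)) F"
    if "f \<in> borel_measurable I01sq" "\<And>z. \<bar>f z\<bar> \<le> B" for f B
    by (rule tendsto_integral_of_set_limit[OF W g _ that]) (use Wl gA in auto)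
  have cut: "eventually (\<lambda>m. cut_bounded \<epsilon> (\<lambda>x y. W m x y - g x y)) F" if "\<epsilon> > 0" for \<epsilon>
  proof (rule cut_convergence[OF W g F(1) lim \<sigma> \<sigma>l sl _ that])
    fix l
    have "eventually (\<lambda>m. cut_bounded (1 / real (Suc l)) (\<lambda>x y. W m x y - staircase_sum l (\<sigma> m) (s m) x y)) sequentially"
      using eventually_ge_at_top[of l] by eventually_elim (rule close)
    then show "eventually (\<lambda>m. cut_bounded (1 / real (Suc l)) (\<lambda>x y. W m x y - staircase_sum l (\<sigma> m) (s m) x y)) F"
      by (rule filter_leD[OF F(2)])
  qed
  have "hom_density (P i) g = t i" if i: "i \<in> {1..k}" for i
  proof (rule tendsto_unique[OF F(1)])
    show "((\<lambda>m. hom_density (P i) (W m)) \<longlongrightarrow> t i) F" by (rule tendsto_mono[OF F(2) dens[OF i]])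
    show "((\<lambda>m. hom_density (P i) (W m)) \<longlongrightarrow> hom_density (P i) g) F"
    proof (rule tendstoI)
      fix e :: real assume e: "e > 0"
      let ?E = "real (card (edges (P i)))"
      have "0 < e / (?E + 1)" using e by (intro divide_pos_pos) auto
      from cut[OF this] show "eventually (\<lambda>m. dist (hom_density (P i) (W m)) (hom_density (P i) g) < e) F"
      proof eventually_elim
        case (elim m)
        have "\<bar>hom_density (P i) (W m) - hom_density (P i) g\<bar> \<le> ?E * (e / (?E + 1))"
          by (rule counting_lemma[OF P[OF i] kernelD(1)[OF W] _ kernelD(1)[OF g] _ elim])
             (use kernelD(3,4)[OF W] kernelD(3,4)[OF g] in auto)
        also have "\<dots> < e" using e by (simp add: field_simps add_pos_nonneg)
        finally show ?case by (simp add: dist_real_def)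
      qed
    qed
  qed
  moreover have gm: "(\<lambda>(x, y). g x y) \<in> borel_measurable (lebesgue_on ({0..1} \<times> {0..1}))"
    by (rule borel_measurable_lebesgue_square(1)[OF kernelD(1)[OF g]])
  then have "graphon g" unfolding graphon_def using kernelD(3,4,6)[OF g] by auto
  ultimately have "g \<in> graphons_with k P t" by (auto simp: graphons_with_def)
  moreover have "b \<le> (\<integral>z. H (g (fst z) (snd z)) \<partial>I01sq)"
    by (rule entropy_upper_semicontinuous[OF W g F(1) lim tendsto_mono[OF F(2) c(1)] c(2)])
  then have "b \<le> shannon_entropy g"
    using shannon_entropy_version[OF kernelD(1)[OF g] gm] by simp
  ultimately show ?thesis by blast
qed

section \<open>The upper bound\<close>

text \<open>The averages of the test functions over the cells are test vectors for the matrix.\<close>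

lemma cut_bounded_step:
  assumes n: "n > 0" and U: "matrix_cut_bounded n \<epsilon> U"
  shows "cut_bounded \<epsilon> (step_kernel n U)"
  unfolding cut_bounded_def
proof (intro ballI impI)
  fix f h :: "real \<Rightarrow> real"
  assume fh: "f \<in> borel_measurable I01" "h \<in> borel_measurable I01" "\<forall>x. 0 \<le> f x \<and> f x \<le> 1" "\<forall>x. 0 \<le> h x \<and> h x \<le> 1"
  define u where "u e i = real n * (\<integral>x. e x * (if cell n x = i then 1 else 0) \<partial>I01)" for e :: "real \<Rightarrow> real" and i
  have u01: "0 \<le> u e i \<and> u e i \<le> 1"
    if e: "e \<in> borel_measurable I01" "\<forall>x. 0 \<le> e x \<and> e x \<le> 1" and i: "i \<in> {1..n}" for e i
  proof -
    have "(\<integral>x. e x * (if cell n x = i then 1 else 0) \<partial>I01) \<le> (\<integral>x. (if cell n x = i then 1 else 0) \<partial>I01)"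
      using e by (intro integral_mono I01.integrable_const_bound[where B=1] AE_I2) (auto simp: abs_mult)
    also have "\<dots> = 1 / real n" by (rule integral_cell_indicator[OF n i])
    finally have "u e i \<le> 1" using n by (simp add: u_def field_simps)
    moreover have "0 \<le> u e i" unfolding u_def using e by (intro mult_nonneg_nonneg Bochner_Integration.integral_nonneg) auto
    ultimately show ?thesis by simp
  qed
  have "(\<integral>z. f (fst z) * step_kernel n U (fst z) (snd z) * h (snd z) \<partial>I01sq)
      = (\<Sum>i\<in>{1..n}. \<Sum>j\<in>{1..n}. (u f i / real n) * U i j * (u h j / real n))"
  proof (subst integral_pair_step[OF n])
    show "\<bar>f x\<bar> \<le> 1" "\<bar>h x\<bar> \<le> 1" for x using fh by (auto simp: abs_le_iff intro: order_trans[of _ 0])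
  qed (use n fh in \<open>simp_all add: u_def\<close>)
  also have "\<dots> = (\<Sum>i\<in>{1..n}. \<Sum>j\<in>{1..n}. u f i * U i j * u h j) / (real n)\<^sup>2"
    by (simp add: sum_divide_distrib power2_eq_square)
  also have "\<bar>\<dots>\<bar> \<le> \<epsilon>"
  proof -
    have "\<bar>\<Sum>i\<in>{1..n}. \<Sum>j\<in>{1..n}. u f i * U i j * u h j\<bar> \<le> \<epsilon> * (real n)\<^sup>2"
      using fh by (intro matrix_cut_bounded_functions[OF U] u01) auto
    then show ?thesis using n by (simp add: abs_divide pos_divide_le_eq)
  qed
  finally show "\<bar>\<integral>z. f (fst z) * step_kernel n U (fst z) (snd z) * h (snd z) \<partial>I01sq\<bar> \<le> \<epsilon>" .
qed

lemma staircase_sum_cell: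
  assumes "n > 0"
  shows "staircase_sum l \<sigma> s (cell n x) (cell n y) = staircase_sum l \<sigma> (\<lambda>q c. real (s q c) / real n) x y"
proof -
  have "cell n x \<le> a \<longleftrightarrow> x \<le> real a / real n" for a x
  proof -
    have "cell n x \<le> a \<longleftrightarrow> \<lceil>real n * x\<rceil> \<le> int a" unfolding cell_def by (rule nat_le_iff)
    also have "\<dots> \<longleftrightarrow> real n * x \<le> real a"
      using ceiling_le_iff[of "real n * x" "int a"] by (simp only: of_int_of_nat_eq)
    also have "\<dots> \<longleftrightarrow> x \<le> real a / real n" using assms by (simp add: field_simps)
    finally show ?thesis .
  qed
  then show ?thesis by (simp add: staircase_sum_def staircase_def)
qed

lemma matrix_density_permute:
  assumes P: "simple_graph P" and \<pi>: "bij_betw \<pi> {1..n} {1..n}"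
  shows "matrix_density P n (\<lambda>i j. M (\<pi> i) (\<pi> j)) = matrix_density P n M"
proof -
  let ?V = "verts P" and ?\<rho> = "inv_into {1..n} \<pi>"
  have inv: "?\<rho> (\<pi> i) = i" "\<pi> (?\<rho> i) = i" "\<pi> i \<in> {1..n}" "?\<rho> i \<in> {1..n}" if "i \<in> {1..n}" for i
    using bij_betw_inv_into_left[OF \<pi> that] bij_betw_inv_into_right[OF \<pi> that]
      bij_betwE[OF \<pi>] bij_betwE[OF bij_betw_inv_into[OF \<pi>]] that by blast+
  have comp: "(\<lambda>v\<in>?V. \<alpha> (\<phi> v)) \<in> ?V \<rightarrow>\<^sub>E {1..n}" if "\<phi> \<in> ?V \<rightarrow>\<^sub>E {1..n}" "\<And>i. i \<in> {1..n} \<Longrightarrow> \<alpha> i \<in> {1..n}" for \<phi> \<alpha>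
    unfolding restrict_PiE_iff using that by blast
  have ext: "(\<lambda>v\<in>?V. \<alpha> ((\<lambda>v\<in>?V. \<beta> (\<phi> v)) v)) = \<phi>" if "\<phi> \<in> ?V \<rightarrow>\<^sub>E {1..n}" "\<And>i. i \<in> {1..n} \<Longrightarrow> \<alpha> (\<beta> i) = i" for \<phi> \<alpha> \<beta>
  proof (rule extensionalityI[of _ ?V])
    show "\<phi> \<in> extensional ?V" using that(1) by (simp add: PiE_def)
    fix v assume v: "v \<in> ?V"
    then have "\<phi> v \<in> {1..n}" using that(1) by blast
    then show "(\<lambda>v\<in>?V. \<alpha> ((\<lambda>v\<in>?V. \<beta> (\<phi> v)) v)) v = \<phi> v" using v that(2) by simp
  qed simp
  have "(\<Sum>\<phi>\<in>?V \<rightarrow>\<^sub>E {1..n}. \<Prod>e\<in>edges P. M (\<pi> (\<phi> (src e))) (\<pi> (\<phi> (tgt e))))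
      = (\<Sum>\<phi>\<in>?V \<rightarrow>\<^sub>E {1..n}. \<Prod>e\<in>edges P. M (\<phi> (src e)) (\<phi> (tgt e)))"
  proof (rule sum.reindex_bij_witness[where i="\<lambda>\<phi>. \<lambda>v\<in>?V. ?\<rho> (\<phi> v)" and j="\<lambda>\<phi>. \<lambda>v\<in>?V. \<pi> (\<phi> v)"])
    fix \<phi> assume \<phi>: "\<phi> \<in> ?V \<rightarrow>\<^sub>E {1..n}"
    show "(\<lambda>v\<in>?V. ?\<rho> ((\<lambda>v\<in>?V. \<pi> (\<phi> v)) v)) = \<phi>" "(\<lambda>v\<in>?V. \<pi> ((\<lambda>v\<in>?V. ?\<rho> (\<phi> v)) v)) = \<phi>"
      by (rule ext[OF \<phi>], rule inv, assumption)+
    show "(\<lambda>v\<in>?V. \<pi> (\<phi> v)) \<in> ?V \<rightarrow>\<^sub>E {1..n}" "(\<lambda>v\<in>?V. ?\<rho> (\<phi> v)) \<in> ?V \<rightarrow>\<^sub>E {1..n}"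
      by (rule comp[OF \<phi>], rule inv, assumption)+
    show "(\<Prod>e\<in>edges P. M ((\<lambda>v\<in>?V. \<pi> (\<phi> v)) (src e)) ((\<lambda>v\<in>?V. \<pi> (\<phi> v)) (tgt e)))
        = (\<Prod>e\<in>edges P. M (\<pi> (\<phi> (src e))) (\<pi> (\<phi> (tgt e))))"
      using simple_graph_edge[OF P] by (intro prod.cong) auto
  qed
  then show ?thesis by (simp add: matrix_density_def)
qed

lemma sum_over_pairs_eq_sum_over_edges:
  fixes h :: "nat set \<Rightarrow> real"
  shows "(\<Sum>a\<in>{1..n}. \<Sum>b\<in>{1..n}. if {a, b} \<in> all_edges n then h {a, b} else 0) = (\<Sum>e\<in>all_edges n. 2 * h e)"
proof -
  let ?S = "{z \<in> {1..n} \<times> {1..n}. {fst z, snd z} \<in> all_edges n}" and ?q = "\<lambda>z. {fst z, snd z}"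
  have pair: "{z \<in> ?S. ?q z = {u, v}} = {(u, v), (v, u)}" "u \<in> {1..n}" "v \<in> {1..n}"
    if "{u, v} \<in> all_edges n" for u v
  proof -
    show uv: "u \<in> {1..n}" "v \<in> {1..n}" using that by (auto simp: all_edges_def)
    show "{z \<in> ?S. ?q z = {u, v}} = {(u, v), (v, u)}"
    proof (intro set_eqI iffI)
      fix z assume "z \<in> {z \<in> ?S. ?q z = {u, v}}"
      then have "{fst z, snd z} = {u, v}" by blast
      then show "z \<in> {(u, v), (v, u)}" by (cases z) (auto simp: doubleton_eq_iff)
    next
      fix z assume "z \<in> {(u, v), (v, u)}"
      then show "z \<in> {z \<in> ?S. ?q z = {u, v}}" using uv that by (auto simp: insert_commute)
    qed
  qed
  have "(\<Sum>a\<in>{1..n}. \<Sum>b\<in>{1..n}. if {a, b} \<in> all_edges n then h {a, b} else 0)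
      = (\<Sum>z\<in>{1..n} \<times> {1..n}. if {fst z, snd z} \<in> all_edges n then h {fst z, snd z} else 0)"
    by (simp add: sum.cartesian_product case_prod_beta)
  also have "\<dots> = (\<Sum>z\<in>?S. h (?q z))" by (rule sum.inter_filter[symmetric]) simp
  also have "\<dots> = (\<Sum>e\<in>?q ` ?S. \<Sum>z\<in>{z \<in> ?S. ?q z = e}. h (?q z))"
    by (rule sum.image_gen) simp
  also have "?q ` ?S = all_edges n"
  proof (intro equalityI subsetI)
    fix e assume e: "e \<in> all_edges n"
    then obtain u v where uv: "e = {u, v}" by (auto simp: all_edges_def card_2_iff)
    then show "e \<in> ?q ` ?S" using pair[of u v] e by (intro image_eqI[of _ _ "(u, v)"]) auto
  qed auto
  also have "(\<Sum>e\<in>all_edges n. \<Sum>z\<in>{z \<in> ?S. ?q z = e}. h (?q z)) = (\<Sum>e\<in>all_edges n. 2 * h e)"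
  proof (rule sum.cong[OF refl])
    fix e assume e: "e \<in> all_edges n"
    then obtain u v where uv: "e = {u, v}" "u \<noteq> v" by (auto simp: all_edges_def card_2_iff)
    have "{z \<in> ?S. ?q z = e} = {(u, v), (v, u)}" unfolding uv(1) by (rule pair(1)) (use e uv in simp)
    then have "(\<Sum>z\<in>{z \<in> ?S. ?q z = e}. h (?q z)) = (\<Sum>z\<in>{(u, v), (v, u)}. h (?q z))" by (rule arg_cong)
    also have "\<dots> = 2 * h e" using uv by (simp add: insert_commute)
    finally show "(\<Sum>z\<in>{z \<in> ?S. ?q z = e}. h (?q z)) = 2 * h e" .
  qed
  finally show ?thesis .
qed

lemma integral_step_kernel:
  assumes n: "n > 0"
  shows "(\<integral>z. step_kernel n M (fst z) (snd z) \<partial>I01sq) = (\<Sum>i\<in>{1..n}. \<Sum>j\<in>{1..n}. M i j) / (real n)\<^sup>2"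
proof -
  have "(\<integral>z. step_kernel n M (fst z) (snd z) \<partial>I01sq) = (\<Sum>i\<in>{1..n}. \<Sum>j\<in>{1..n}. 1 / real n * M i j * (1 / real n))"
    using integral_pair_step[OF n, of "\<lambda>_. 1" "\<lambda>_. 1" M] integral_cell_indicator[OF n] by simp
  then show ?thesis by (simp add: sum_divide_distrib power2_eq_square)
qed

text \<open>\<open>W\<close> is the average of the graphs in a large subfamily with common staircase sums,
  after sorting. The entropy of \<open>W\<close>, times \<open>n\<^sup>2\<close>, is at least
  the logarithm of the size of the subfamily, and the pigeonhole step loses only the last
  summand, which is linear in \<open>n\<close>. For the densities, compare \<open>W\<close> with
  any member of the subfamily: both are within \<open>1 / (m + 1)\<close> of the same staircase
  sum.\<close>

lemma averaged_kernel:
  fixes P :: "nat \<Rightarrow> 'v sgraph"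
  assumes P: "\<And>i. i \<in> {1..k} \<Longrightarrow> simple_graph (P i)" and n: "n > 0"
    and ne: "good_edge_sets k P t n \<delta> \<noteq> {}"
  obtains W \<sigma> s where "kernel W" "\<And>q. \<bar>\<sigma> q\<bar> \<le> 1" "\<And>q c. \<bar>s q c\<bar> \<le> 1"
    "\<And>l. l \<le> m \<Longrightarrow> cut_bounded (1 / real (Suc l)) (\<lambda>x y. W x y - staircase_sum l \<sigma> s x y)"
    "\<And>i. i \<in> {1..k} \<Longrightarrow> \<bar>hom_density (P i) W - t i\<bar> \<le> \<delta> + real (card (edges (P i))) * (2 / real (Suc m))"
    "ln (real (card (good_edge_sets k P t n \<delta>))) \<le> (real n)\<^sup>2 * (\<integral>z. H (W (fst z) (snd z)) \<partial>I01sq)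
       + real (level_start (Suc m)) * ln (3 * 4 ^ n)"
proof -
  let ?A = "good_edge_sets k P t n \<delta>" and ?e = "1 / real (Suc m)"
  have adj: "0 \<le> adjacency X i j" "adjacency X i j \<le> 1" "\<bar>adjacency X i j\<bar> \<le> 1" "adjacency X i j = adjacency X j i" for X i j
    by (auto simp: adjacency_def insert_commute)
  obtain A' \<sigma> s \<pi> where A': "A' \<subseteq> ?A" "card ?A \<le> card A' * (3 * 4 ^ n) ^ level_start (Suc m)"
    and \<sigma>: "\<And>q. \<bar>\<sigma> q\<bar> \<le> 1" and s: "\<And>q c. s q c \<le> n" and \<pi>: "bij_betw \<pi> {1..n} {1..n}"
    and cut: "\<And>X l. X \<in> A' \<Longrightarrow> l < Suc m \<Longrightarrow> matrix_cut_bounded n (1 / real (Suc l))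
       (\<lambda>i j. adjacency X (\<pi> i) (\<pi> j) - staircase_sum l \<sigma> s i j)"
    using common_staircase_sums[OF n, of adjacency ?A "Suc m", OF adj(3) finite_good_edge_sets] by blast
  have cA: "0 < card ?A" using ne finite_good_edge_sets[of k P t n \<delta>] by (simp add: card_gt_0_iff)
  have "card A' \<noteq> 0" using A'(2) cA by (cases "card A' = 0") auto
  then have A'ne: "A' \<noteq> {}" and A'fin: "finite A'" by (auto intro: card_ge_0_finite)
  have c': "0 < real (card A')" using \<open>card A' \<noteq> 0\<close> by simp
  define M where "M i j = (\<Sum>X\<in>A'. adjacency X (\<pi> i) (\<pi> j)) / real (card A')" for i j
  define W where "W = step_kernel n M"
  have M01: "0 \<le> M i j" "M i j \<le> 1" for i j
  proof -
    show "0 \<le> M i j" unfolding M_def using adj by (intro divide_nonneg_nonneg sum_nonneg) auto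
    have "(\<Sum>X\<in>A'. adjacency X (\<pi> i) (\<pi> j)) \<le> (\<Sum>X\<in>A'. 1)" using adj by (intro sum_mono) auto
    then show "M i j \<le> 1" using c' by (simp add: M_def)
  qed
  have Msym: "M i j = M j i" for i j unfolding M_def using adj(4) by metis
  have W: "kernel W"
    unfolding kernel_def
  proof (intro conjI allI)
    show "(\<lambda>(x, y). W x y) \<in> borel_measurable I01sq" unfolding W_def by (rule step_kernel_measurable)
    show "0 \<le> W x y" "W x y \<le> 1" for x y using M01 by (auto simp: W_def step_kernel_def)
    show "W x y = W y x" for x y unfolding W_def step_kernel_def by (rule Msym)
  qed
  have Mcut: "matrix_cut_bounded n (1 / real (Suc l)) (\<lambda>i j. M i j - staircase_sum l \<sigma> s i j)" if "l \<le> m" for l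
    unfolding M_def using that by (intro matrix_cut_bounded_average[OF A'fin A'ne] cut) auto
  show ?thesis
  proof (rule that[OF W \<sigma>, of "\<lambda>q c. real (s q c) / real n"])
    show "\<bar>real (s q c) / real n\<bar> \<le> 1" for q c using s[of q c] n by simp
    show "cut_bounded (1 / real (Suc l)) (\<lambda>x y. W x y - staircase_sum l \<sigma> (\<lambda>q c. real (s q c) / real n) x y)" if "l \<le> m" for l
    proof -
      have "(\<lambda>x y. W x y - staircase_sum l \<sigma> (\<lambda>q c. real (s q c) / real n) x y)
          = step_kernel n (\<lambda>i j. M i j - staircase_sum l \<sigma> s i j)"
        by (intro ext) (simp add: W_def step_kernel_def staircase_sum_cell[OF n])
      then show ?thesis using cut_bounded_step[OF n Mcut[OF that]] by simp
    qed
    show "\<bar>hom_density (P i) W - t i\<bar> \<le> \<delta> + real (card (edges (P i))) * (2 / real (Suc m))" if i: "i \<in> {1..k}" for i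
    proof -
      obtain X where X: "X \<in> A'" using A'ne by auto
      let ?X = "\<lambda>i j. adjacency X (\<pi> i) (\<pi> j)"
      have "matrix_cut_bounded n (?e + ?e) (\<lambda>i j. ?X i j - M i j)"
        using cut[OF X, of m] Mcut[of m] by (intro matrix_cut_bounded_triangle) auto
      then have "cut_bounded (2 / real (Suc m)) (step_kernel n (\<lambda>i j. ?X i j - M i j))"
        by (intro cut_bounded_step[OF n]) simp
      moreover have "step_kernel n (\<lambda>i j. ?X i j - M i j) = (\<lambda>x y. step_kernel n ?X x y - W x y)"
        by (intro ext) (simp add: W_def step_kernel_def)
      ultimately have "\<bar>hom_density (P i) (step_kernel n ?X) - hom_density (P i) W\<bar> \<le> real (card (edges (P i))) * (2 / real (Suc m))"
        using W adj by (intro counting_lemma[OF P[OF i] step_kernel_measurable _ kernelD(1)[OF W]])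
          (auto simp: step_kernel_def kernel_def)
      moreover have "hom_density (P i) (step_kernel n ?X) = matrix_density (P i) n (adjacency X)"
        using hom_density_step[OF P[OF i] n, of "step_kernel n ?X" ?X] matrix_density_permute[OF P[OF i] \<pi>, of "adjacency X"] by simp
      moreover have "\<bar>matrix_density (P i) n (adjacency X) - t i\<bar> < \<delta>"
        using A'(1) X i by (auto simp: good_edge_sets_def)
      ultimately show ?thesis by linarith
    qed
    let ?p = "\<lambda>e. real (card {X \<in> A'. e \<in> X}) / real (card A')"
    have A'E: "A' \<subseteq> Pow (all_edges n)" using A'(1) by (auto simp: good_edge_sets_def)
    define f where "f a b = (if {a, b} \<in> all_edges n then H (?p {a, b}) else 0)" for a b
    have Mp: "H (\<Sum>X\<in>A'. adjacency X a b / real (card A')) = f a b" for a b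
    proof (cases "{a, b} \<in> all_edges n")
      case True
      have "(\<Sum>X\<in>A'. adjacency X a b) = real (card {X \<in> A'. {a, b} \<in> X})"
        unfolding adjacency_def using A'fin by (simp add: sum.If_cases Int_def)
      then show ?thesis using True by (simp add: f_def sum_divide_distrib[symmetric])
    next
      case False
      then have "adjacency X a b = 0" if "X \<in> A'" for X using A'E that by (auto simp: adjacency_def)
      then show ?thesis using False by (simp add: f_def H_def)
    qed
    have "(\<integral>z. H (W (fst z) (snd z)) \<partial>I01sq) = (\<integral>z. step_kernel n (\<lambda>i j. H (M i j)) (fst z) (snd z) \<partial>I01sq)"
      by (simp add: W_def step_kernel_def)
    also have "\<dots> = (\<Sum>i\<in>{1..n}. \<Sum>j\<in>{1..n}. H (M i j)) / (real n)\<^sup>2" by (rule integral_step_kernel[OF n])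
    also have "(\<Sum>i\<in>{1..n}. \<Sum>j\<in>{1..n}. H (M i j))
        = (\<Sum>i\<in>{1..n}. \<Sum>j\<in>{1..n}. f (\<pi> i) (\<pi> j))"
      unfolding M_def sum_divide_distrib Mp ..
    also have "\<dots> = (\<Sum>i\<in>{1..n}. \<Sum>b\<in>{1..n}. f (\<pi> i) b)"
      by (intro sum.cong refl sum.reindex_bij_betw[OF \<pi>])
    also have "\<dots> = (\<Sum>a\<in>{1..n}. \<Sum>b\<in>{1..n}. f a b)" by (rule sum.reindex_bij_betw[OF \<pi>])
    also have "\<dots> = (\<Sum>e\<in>all_edges n. binary_entropy (?p e))"
      unfolding f_def binary_entropy_eq_H
      by (rule sum_over_pairs_eq_sum_over_edges[where h="\<lambda>e. H (?p e)"])
    finally have ent: "(real n)\<^sup>2 * (\<integral>z. H (W (fst z) (snd z)) \<partial>I01sq) = (\<Sum>e\<in>all_edges n. binary_entropy (?p e))"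
      using n by simp
    have "ln (real (card ?A)) \<le> ln (real (card A') * (3 * 4 ^ n) ^ level_start (Suc m))"
    proof -
      have "real (card ?A) \<le> real (card A' * (3 * 4 ^ n) ^ level_start (Suc m))" using A'(2) by (simp only: of_nat_le_iff)
      then show ?thesis using cA c' by (subst ln_le_cancel_iff) auto
    qed
    also have "\<dots> = ln (real (card A')) + real (level_start (Suc m)) * ln (3 * 4 ^ n)"
      using c' by (subst ln_mult_pos) (simp_all only: ln_realpow zero_less_power zero_less_mult_iff, auto)
    also have "ln (real (card A')) \<le> (\<Sum>e\<in>all_edges n. binary_entropy (?p e))"
      by (rule ln_card_le_binary_entropy[OF finite_all_edges A'E A'ne])
    finally show "ln (real (card ?A)) \<le> (real n)\<^sup>2 * (\<integral>z. H (W (fst z) (snd z)) \<partial>I01sq) + real (level_start (Suc m)) * ln (3 * 4 ^ n)"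
      unfolding ent by simp
  qed
qed

lemma log_Z_rate_mono:
  assumes P: "\<And>i. i \<in> {1..k} \<Longrightarrow> simple_graph (P i)" and n: "n > 0" and "\<delta> \<le> \<delta>'"
  shows "log_Z_rate k P t \<delta> n \<le> log_Z_rate k P t \<delta>' n"
proof -
  have "good_edge_sets k P t n \<delta> \<subseteq> good_edge_sets k P t n \<delta>'" using assms(3) by (force simp: good_edge_sets_def)
  then have "card (good_edge_sets k P t n \<delta>) \<le> card (good_edge_sets k P t n \<delta>')"
    by (rule card_mono[OF finite_good_edge_sets])
  then have "Z k P t n \<delta> \<le> Z k P t n \<delta>'"
    using Z_eq_card[where P=P and k=k and t=t, OF P n] by simp
  then show ?thesis by (auto simp: log_Z_rate_def intro!: divide_right_mono)
qed

lemma log_Z_rate_le_1: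
  assumes P: "\<And>i. i \<in> {1..k} \<Longrightarrow> simple_graph (P i)" and n: "n > 0"
  shows "log_Z_rate k P t \<delta> n \<le> 1"
proof (cases "Z k P t n \<delta> = 0")
  case False
  have "Z k P t n \<delta> = card (good_edge_sets k P t n \<delta>)" by (rule Z_eq_card[OF P n])
  also have "\<dots> \<le> card (Pow (all_edges n))"
    by (intro card_mono) (auto simp: good_edge_sets_def finite_all_edges)
  also have "\<dots> = 2 ^ card (all_edges n)" by (simp add: card_Pow finite_all_edges)
  finally have "real (Z k P t n \<delta>) \<le> 2 ^ card (all_edges n)" by (metis of_nat_le_iff of_nat_numeral of_nat_power)
  then have "ln (real (Z k P t n \<delta>)) \<le> ln (2 ^ card (all_edges n))" using False by (subst ln_le_cancel_iff) auto
  also have "\<dots> = real n * (real n - 1) / 2 * ln 2" by (simp add: ln_realpow card_all_edges)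
  also have "\<dots> \<le> (real n)\<^sup>2 * 1"
    using n ln_le_minus_one[of 2] by (intro mult_mono) (auto simp: power2_eq_square field_simps)
  finally have "ln (real (Z k P t n \<delta>)) / (real n)\<^sup>2 \<le> 1" using n by (simp add: pos_divide_le_eq)
  then show ?thesis using False by (simp add: log_Z_rate_def one_ereal_def)
qed (simp add: log_Z_rate_def)

text \<open>For each \<open>m\<close> take \<open>\<delta> = 1 / (m + 1)\<close>, a number \<open>n\<close>
  of vertices at which the rate nearly reaches \<open>b\<close> and which is so large that the
  loss in \<open>averaged_kernel\<close> is negligible, and let \<open>m\<close> tend to
  infinity.\<close>

lemma maximizing_graphon:
  fixes P :: "nat \<Rightarrow> 'v sgraph" and b :: real
  assumes P: "\<And>i. i \<in> {1..k} \<Longrightarrow> simple_graph (P i)"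
    and b: "\<And>\<delta>. \<delta> > 0 \<Longrightarrow> ereal b \<le> limsup (log_Z_rate k P t \<delta>)"
  shows "\<exists>g\<in>graphons_with k P t. b \<le> shannon_entropy g"
proof -
  define d where "d m = 1 / real (Suc m)" for m
  have d: "d m > 0" for m by (simp add: d_def)
  define Q where "Q m W \<sigma> s \<longleftrightarrow> kernel W \<and> (\<forall>q. \<bar>\<sigma> q\<bar> \<le> 1) \<and> (\<forall>q c. \<bar>s q c\<bar> \<le> 1) \<and>
    (\<forall>l\<le>m. cut_bounded (1 / real (Suc l)) (\<lambda>x y. W x y - staircase_sum l \<sigma> s x y)) \<and>
    (\<forall>i\<in>{1..k}. \<bar>hom_density (P i) W - t i\<bar> \<le> d m + real (card (edges (P i))) * (2 / real (Suc m))) \<and>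
    b - 2 * d m \<le> (\<integral>z. H (W (fst z) (snd z)) \<partial>I01sq)" for m W and \<sigma> :: "nat \<Rightarrow> real" and s :: "nat \<Rightarrow> nat \<Rightarrow> real"
  have "\<exists>W \<sigma> s. Q m W \<sigma> s" for m
  proof -
    let ?L = "real (level_start (Suc m))"
    have "\<not> eventually (\<lambda>n. log_Z_rate k P t (d m) n \<le> ereal (b - d m)) sequentially"
    proof
      assume "eventually (\<lambda>n. log_Z_rate k P t (d m) n \<le> ereal (b - d m)) sequentially"
      then have "limsup (log_Z_rate k P t (d m)) \<le> ereal (b - d m)" by (rule Limsup_bounded)
      then have "ereal b \<le> ereal (b - d m)" using b[OF d[of m]] by (rule order_trans[rotated])
      then show False using d[of m] by simp
    qed
    \<comment> \<open>The loss is at most \<open>5 n\<close> times the number of rectangles, since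
      \<open>ln 3 + n ln 4 \<le> 5 n\<close>.\<close>
    moreover obtain N :: nat where N: "5 * ?L * real (Suc m) + 1 < real N" using reals_Archimedean2 by blast
    ultimately obtain n where n: "n \<ge> N" "ereal (b - d m) < log_Z_rate k P t (d m) n"
      unfolding eventually_sequentially by (meson not_le)
    have nN: "5 * ?L * real (Suc m) + 1 < real n" using N n(1) by (meson less_le_trans of_nat_le_iff)
    have "0 \<le> 5 * ?L * real (Suc m)" by simp
    then have n1: "1 < real n" "n > 0" using nN by (linarith, cases n, auto)
    let ?A = "good_edge_sets k P t n (d m)"
    have Z: "Z k P t n (d m) = card ?A" by (rule Z_eq_card[OF P n1(2)])
    have "Z k P t n (d m) \<noteq> 0"
    proof
      assume "Z k P t n (d m) = 0"
      then show False using n(2) by (simp add: log_Z_rate_def)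
    qed
    then have ne: "?A \<noteq> {}" and rate: "b - d m < ln (real (card ?A)) / (real n)\<^sup>2"
      using n(2) Z by (auto simp: log_Z_rate_def)
    obtain W \<sigma> s where W: "kernel W" "\<And>q. \<bar>\<sigma> q\<bar> \<le> 1" "\<And>q c. \<bar>s q c\<bar> \<le> 1"
      "\<And>l. l \<le> m \<Longrightarrow> cut_bounded (1 / real (Suc l)) (\<lambda>x y. W x y - staircase_sum l \<sigma> s x y)"
      "\<And>i. i \<in> {1..k} \<Longrightarrow> \<bar>hom_density (P i) W - t i\<bar> \<le> d m + real (card (edges (P i))) * (2 / real (Suc m))"
      "ln (real (card ?A)) \<le> (real n)\<^sup>2 * (\<integral>z. H (W (fst z) (snd z)) \<partial>I01sq) + ?L * ln (3 * 4 ^ n)"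
      using averaged_kernel[OF P n1(2) ne, of m] by blast
    have "ln (3 * 4 ^ n) = ln 3 + real n * ln (4::real)" by (simp add: ln_mult_pos ln_realpow)
    also have "\<dots> \<le> 2 * real n + real n * 3"
      using ln_le_minus_one[of 3] ln_le_minus_one[of 4] n1 by (intro add_mono mult_left_mono) linarith+
    finally have "?L * ln (3 * 4 ^ n) \<le> ?L * (5 * real n)" by (intro mult_left_mono) auto
    also have "\<dots> \<le> d m * (real n)\<^sup>2"
    proof -
      have "5 * ?L * real (Suc m) * real n \<le> real n * real n" using nN n1 by (intro mult_right_mono) auto
      then show ?thesis by (simp add: d_def field_simps power2_eq_square)
    qed
    finally have L: "?L * ln (3 * 4 ^ n) \<le> d m * (real n)\<^sup>2" .
    have "(b - d m) * (real n)\<^sup>2 < ln (real (card ?A))" using rate n1 by (simp add: pos_less_divide_eq)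
    then have "(b - d m) * (real n)\<^sup>2 \<le> (real n)\<^sup>2 * (\<integral>z. H (W (fst z) (snd z)) \<partial>I01sq) + d m * (real n)\<^sup>2"
      using W(6) L by linarith
    then have "(b - 2 * d m) * (real n)\<^sup>2 \<le> (\<integral>z. H (W (fst z) (snd z)) \<partial>I01sq) * (real n)\<^sup>2"
      by (simp add: algebra_simps)
    then have "b - 2 * d m \<le> (\<integral>z. H (W (fst z) (snd z)) \<partial>I01sq)" using n1 by (simp add: mult_le_cancel_right)
    then have "Q m W \<sigma> s" unfolding Q_def using W(1-5) by blast
    then show ?thesis by blast
  qed
  then obtain W \<sigma> s where Q: "\<And>m. Q m (W m) (\<sigma> m) (s m)" by metis
  have d0: "d \<longlonglongrightarrow> 0" unfolding d_def[abs_def] using LIMSEQ_inverse_real_of_nat by (simp add: inverse_eq_divide)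
  show ?thesis
  proof (rule limit_graphon[where W=W and \<sigma>=\<sigma> and s=s and c="\<lambda>m. b - 2 * d m"])
    show "kernel (W m)" "\<bar>\<sigma> m q\<bar> \<le> 1" "\<bar>s m q c\<bar> \<le> 1" "b - 2 * d m \<le> (\<integral>z. H (W m (fst z) (snd z)) \<partial>I01sq)" for m q c
      using Q[of m] by (auto simp: Q_def)
    show "cut_bounded (1 / real (Suc l)) (\<lambda>x y. W m x y - staircase_sum l (\<sigma> m) (s m) x y)" if "l \<le> m" for l m
      using Q[of m] that by (auto simp: Q_def)
    show "(\<lambda>m. b - 2 * d m) \<longlonglongrightarrow> b" using tendsto_diff[OF tendsto_const tendsto_mult_left[OF d0]] by force
    show "simple_graph (P i)" if "i \<in> {1..k}" for i by (rule P[OF that])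
    fix i assume i: "i \<in> {1..k}"
    have "(\<lambda>m. hom_density (P i) (W m) - t i) \<longlonglongrightarrow> 0"
    proof (rule Lim_null_comparison)
      show "eventually (\<lambda>m. norm (hom_density (P i) (W m) - t i) \<le> d m + real (card (edges (P i))) * 2 * d m) sequentially"
        using Q i by (auto simp: Q_def d_def)
      show "(\<lambda>m. d m + real (card (edges (P i))) * 2 * d m) \<longlonglongrightarrow> 0"
        using tendsto_add[OF d0 tendsto_mult_left[OF d0]] by force
    qed
    then show "(\<lambda>m. hom_density (P i) (W m)) \<longlonglongrightarrow> t i" by (simp add: LIM_zero_iff)
  qed
qed

section \<open>The variational formula\<close>

theorem theorem5:
  fixes k :: nat and P :: "nat \<Rightarrow> 'v sgraph" and t :: "nat \<Rightarrow> real"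
  assumes "\<And>i. i \<in> {1..k} \<Longrightarrow> simple_graph (P i)"
    and "achievable k P t"
  shows "\<exists>B :: real.
      ((\<lambda>\<delta>. liminf (log_Z_rate k P t \<delta>)) \<longlongrightarrow> ereal B) (at_right 0) \<and>
      ((\<lambda>\<delta>. limsup (log_Z_rate k P t \<delta>)) \<longlongrightarrow> ereal B) (at_right 0) \<and>
      B \<in> shannon_entropy ` graphons_with k P t \<and>
      (\<forall>g\<in>graphons_with k P t. shannon_entropy g \<le> B)"
proof -
  note P = assms(1)
  define R where "R \<delta> = limsup (log_Z_rate k P t \<delta>)" for \<delta>
  define r where "r \<delta> = liminf (log_Z_rate k P t \<delta>)" for \<delta>
  define B where "B = (INF \<delta>\<in>{0<..}. R \<delta>)"
  have rR: "r \<delta> \<le> R \<delta>" for \<delta> unfolding r_def R_def by (rule Liminf_le_Limsup) simp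
  have low: "ereal (shannon_entropy g) \<le> r \<delta>" if "g \<in> graphons_with k P t" "\<delta> > 0" for g \<delta>
    unfolding r_def by (rule shannon_entropy_le_liminf[OF P that])
  have pos: "eventually (\<lambda>n::nat. n > 0) sequentially" by (rule eventually_gt_at_top)
  have mono: "R \<delta> \<le> R \<delta>'" if "\<delta> \<le> \<delta>'" for \<delta> \<delta>'
    unfolding R_def by (rule Limsup_mono, use pos in eventually_elim, rule log_Z_rate_mono[OF P _ that])
  have R1: "R \<delta> \<le> 1" for \<delta>
    unfolding R_def by (rule Limsup_bounded, use pos in eventually_elim, rule log_Z_rate_le_1[OF P])
  have Ble: "B \<le> R \<delta>" if "\<delta> > 0" for \<delta> unfolding B_def using that by (intro INF_lower) auto
  have SB: "ereal (shannon_entropy g) \<le> B" if "g \<in> graphons_with k P t" for g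
    unfolding B_def using low[OF that] rR by (intro INF_greatest) (auto intro: order_trans)
  obtain h where h: "h \<in> graphons_with k P t" using assms(2) by (auto simp: achievable_def)
  have "B \<noteq> -\<infinity>" "B \<noteq> \<infinity>" using SB[OF h] Ble[of 1] R1[of 1] by auto
  then obtain b where b: "B = ereal b" by (cases B) auto
  obtain g where g: "g \<in> graphons_with k P t" "b \<le> shannon_entropy g"
    using maximizing_graphon[where P=P and k=k and b=b and t=t, OF P] Ble unfolding b R_def by blast
  have gb: "shannon_entropy g = b" using SB[OF g(1)] g(2) b by simp
  have gt0: "eventually (\<lambda>\<delta>::real. \<delta> > 0) (at_right 0)" by (rule eventually_at_right_less)
  have Rlim: "(R \<longlongrightarrow> ereal b) (at_right 0)"
  proof (rule order_tendstoI)
    fix a assume a: "a < ereal b"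
    show "eventually (\<lambda>\<delta>. a < R \<delta>) (at_right 0)"
      using gt0 by eventually_elim (use Ble a b in \<open>auto intro: less_le_trans\<close>)
  next
    fix a assume "ereal b < a"
    then obtain \<delta>0 where \<delta>0: "\<delta>0 > 0" "R \<delta>0 < a" unfolding b[symmetric] B_def by (auto simp: INF_less_iff)
    have "eventually (\<lambda>\<delta>. \<delta> \<in> {0<..<\<delta>0}) (at_right 0)" by (rule eventually_at_right_real[OF \<delta>0(1)])
    then show "eventually (\<lambda>\<delta>. R \<delta> < a) (at_right 0)"
      by eventually_elim (rule le_less_trans[OF mono \<delta>0(2)], simp)
  qed
  have rlim: "(r \<longlongrightarrow> ereal b) (at_right 0)"
  proof (rule tendsto_sandwich[OF _ _ tendsto_const Rlim])
    show "eventually (\<lambda>\<delta>. ereal b \<le> r \<delta>) (at_right 0)"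
      using gt0 by eventually_elim (use low[OF g(1)] gb in auto)
    show "eventually (\<lambda>\<delta>. r \<delta> \<le> R \<delta>) (at_right 0)" using rR by simp
  qed
  show ?thesis
  proof (intro exI[of _ b] conjI ballI)
    show "((\<lambda>\<delta>. liminf (log_Z_rate k P t \<delta>)) \<longlongrightarrow> ereal b) (at_right 0)" using rlim unfolding r_def[abs_def] .
    show "((\<lambda>\<delta>. limsup (log_Z_rate k P t \<delta>)) \<longlongrightarrow> ereal b) (at_right 0)" using Rlim unfolding R_def[abs_def] .
    show "b \<in> shannon_entropy ` graphons_with k P t" using g(1) gb by blast
    show "shannon_entropy g \<le> b" if "g \<in> graphons_with k P t" for g using SB[OF that] b by simp
  qed
qed

end
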